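(* Consider planar discontinuous piecewise differential systems \[ (\dot x,\dot y)=\begin{cases} F^{+}(x,y), & x\ge 0,\\ F^{-}(x,y), & x\le 0,\end{cases} \] separated by the straight line $\Sigma=\{x=0\}$, each of whose two subsystems belongs to one of the classes $(\mathtt{S}_1),\dots,(\mathtt{S}_4)$ defined in the context. Then: \begin{itemize} \item[(i)] there exist such piecewise systems formed by a subsystem of class $(\mathtt{S}_1)$ and a subsystem of class $(\mathtt{S}_2)$ with three crossing limit cycles; \item[(ii)] there exist such piecewise systems formed by two subsystems of class $(\mathtt{S}_3)$ with three crossing limit cycles; \item[(iii)] there exist such piecewise systems formed by a subsystem of class $(\mathtt{S}_3)$ and a subsystem of class $(\mathtt{S}_4)$ with three crossing limit cycles; \item[(iv)] there exist such piecewise systems formed by two subsystems of class $(\mathtt{S}_4)$ with three crossing limit cycles. \end{itemize}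
   Context: The four cubic isochronous centers are $S_1:\ \dot x=-y+x^3-xy^2,\ \dot y=x+x^2y-y^3$; $S_2:\ \dot x=-y+x^3-3xy^2,\ \dot y=x+3x^2y-y^3$; $S_3:\ \dot x=-y+3x^2y,\ \dot y=x-2x^3+9xy^2$; $S_4:\ \dot x=-y-3x^2y,\ \dot y=x+2x^3-9xy^2$. For $i=1,2,3,4$, a vector field $F$ on $\mathbb{R}^2$ belongs to class $(\mathtt{S}_i)$ if there is an invertible affine map $\varphi(x,y)=(ax+by+c,\ \alpha x+\beta y+\gamma)$ (with $b\alpha-a\beta\neq0$) such that $F(p)=(D\varphi)^{-1}S_i(\varphi(p))$ for all $p$, i.e. $F$ is $S_i$ written in the coordinates given by the affine change of variables $\varphi$. Writing $F^{\pm}=(X^{\pm},Y^{\pm})$, a point $p\in\Sigma$ is a crossing point if $X^{+}(p)X^{-}(p)>0$. A periodic solution of the piecewise system is of crossing type if it intersects $\Sigma$ at exactly two points, both crossing points; a crossing limit cycle is a crossing-type periodic solution that is isolated among such periodic solutions. *)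

theory Defs
  imports "HOL-Analysis.Analysis"
begin

text \<open>The four cubic isochronous centers, as vector fields on the plane (real x real).\<close>

definition S1 :: "real \<times> real \<Rightarrow> real \<times> real" where
  "S1 = (\<lambda>(x, y). (- y + x^3 - x * y^2, x + x^2 * y - y^3))"

definition S2 :: "real \<times> real \<Rightarrow> real \<times> real" where
  "S2 = (\<lambda>(x, y). (- y + x^3 - 3 * x * y^2, x + 3 * x^2 * y - y^3))"

definition S3 :: "real \<times> real \<Rightarrow> real \<times> real" where
  "S3 = (\<lambda>(x, y). (- y + 3 * x^2 * y, x - 2 * x^3 + 9 * x * y^2))"

definition S4 :: "real \<times> real \<Rightarrow> real \<times> real" where
  "S4 = (\<lambda>(x, y). (- y - 3 * x^2 * y, x + 2 * x^3 - 9 * x * y^2))"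

text \<open>F belongs to class (S): F(p) = (D phi)^{-1} S(phi(p)) for an invertible affine map
  phi(x,y) = (a x + b y + c, alpha x + beta y + gamma).  D phi is the matrix
  [[a,b],[alpha,beta]] with determinant a beta - b alpha; its inverse is written out explicitly.\<close>

definition in_class :: "(real \<times> real \<Rightarrow> real \<times> real) \<Rightarrow> (real \<times> real \<Rightarrow> real \<times> real) \<Rightarrow> bool" where
  "in_class S F \<longleftrightarrow>
     (\<exists>a b c \<alpha> \<beta> \<gamma> :: real. b * \<alpha> - a * \<beta> \<noteq> 0 \<and>
        (\<forall>x y. let (u, v) = S (a * x + b * y + c, \<alpha> * x + \<beta> * y + \<gamma>);
                   d = a * \<beta> - b * \<alpha>
               in F (x, y) = ((\<beta> * u - b * v) / d, (a * v - \<alpha> * u) / d)))"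

definition crossing_point :: "(real \<times> real \<Rightarrow> real \<times> real) \<Rightarrow> (real \<times> real \<Rightarrow> real \<times> real) \<Rightarrow> real \<times> real \<Rightarrow> bool" where
  "crossing_point Fp Fm p \<longleftrightarrow> fst p = 0 \<and> fst (Fp p) * fst (Fm p) > 0"

definition crossing_periodic_orbit :: "(real \<times> real \<Rightarrow> real \<times> real) \<Rightarrow> (real \<times> real \<Rightarrow> real \<times> real) \<Rightarrow> (real \<times> real) set \<Rightarrow> bool" where
  "crossing_periodic_orbit Fp Fm \<Gamma> \<longleftrightarrow>
     (\<exists>p q T1 T2 g1 g2.
        p \<noteq> q \<and> crossing_point Fp Fm p \<and> crossing_point Fp Fm q \<and>
        T1 > 0 \<and> T2 > 0 \<and>
        (\<forall>t\<in>{0..T1}. (g1 has_vector_derivative Fp (g1 t)) (at t within {0..T1})) \<and>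
        g1 0 = p \<and> g1 T1 = q \<and> (\<forall>t\<in>{0<..<T1}. fst (g1 t) > 0) \<and>
        (\<forall>t\<in>{0..T2}. (g2 has_vector_derivative Fm (g2 t)) (at t within {0..T2})) \<and>
        g2 0 = q \<and> g2 T2 = p \<and> (\<forall>t\<in>{0<..<T2}. fst (g2 t) < 0) \<and>
        \<Gamma> = g1 ` {0..T1} \<union> g2 ` {0..T2})"

definition crossing_limit_cycle :: "(real \<times> real \<Rightarrow> real \<times> real) \<Rightarrow> (real \<times> real \<Rightarrow> real \<times> real) \<Rightarrow> (real \<times> real) set \<Rightarrow> bool" where
  "crossing_limit_cycle Fp Fm \<Gamma> \<longleftrightarrow>
     crossing_periodic_orbit Fp Fm \<Gamma> \<and>
     (\<exists>U. open U \<and> \<Gamma> \<subseteq> U \<and>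
        (\<forall>\<Gamma>'. crossing_periodic_orbit Fp Fm \<Gamma>' \<and> \<Gamma>' \<subseteq> U \<longrightarrow> \<Gamma>' = \<Gamma>))"

definition has_three_crossing_limit_cycles :: "(real \<times> real \<Rightarrow> real \<times> real) \<Rightarrow> (real \<times> real \<Rightarrow> real \<times> real) \<Rightarrow> bool" where
  "has_three_crossing_limit_cycles Fp Fm \<longleftrightarrow>
     (\<exists>C1 C2 C3. C1 \<noteq> C2 \<and> C1 \<noteq> C3 \<and> C2 \<noteq> C3 \<and>
        crossing_limit_cycle Fp Fm C1 \<and> crossing_limit_cycle Fp Fm C2 \<and> crossing_limit_cycle Fp Fm C3)"

end

theory Submission
  imports Defs
begin

text \<open>
  Each of the four centers has a rational first integral whose closed level curves fill a
  neighbourhood of the center. After an affine change of variables the line \<open>x = 0\<close> carries two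
  functions \<open>f\<close> and \<open>g\<close>, the restrictions of the two first integrals; both decrease up to the point
  where the respective vector field is tangent to the line and increase afterwards. Crossing
  periodic orbits therefore correspond to pairs \<open>a < b\<close> separated by both tangency points with
  \<open>f a = f b\<close> and \<open>g a = g b\<close>. Inside a box of pairs, strict inequalities of \<open>f\<close> and \<open>g\<close> at two
  opposite corners force a solution by the intermediate value theorem; and if \<open>f - k g\<close> is decreasing
  on both edges for some constant \<open>k\<close>, the solution is unique in the box, so the orbit is isolated.
  For explicit affine maps with rational coefficients, three disjoint boxes are exhibited.
\<close>

section \<open>Uniqueness of solutions and first integrals\<close>

text \<open>Level curves alone do not give cycles: a crossing periodic orbit consists of solution
  arcs that run from one point of the line to the other in finite time. Each center is therefore
  integrated in coordinates in which the motion is a rigid rotation. Isolation concerns every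
  competing orbit near a cycle, so the neighbourhood has to confine such orbits to the domains of
  the first integrals and, on the line, to the two edges of a box. In the plane of pairs
  \<open>(a, b)\<close> the equations \<open>f a = f b\<close> and \<open>g a = g b\<close> describe
  two decreasing curves, and cycles are their intersections. Successive intersections cross in
  opposite directions, which is why the roles of \<open>f\<close> and \<open>g\<close> are exchanged
  in the middle one of the three boxes. The affine maps are orientation-preserving similarities:
  along the line only a base point and a direction matter, and a quarter turn of the direction
  supplies the other column. Both centers then turn counterclockwise, so their crossing directions
  agree below both tangency points and above both.\<close>

definition solves :: "(real \<times> real \<Rightarrow> real \<times> real) \<Rightarrow> (real \<Rightarrow> real \<times> real) \<Rightarrow> real \<Rightarrow> bool" where
  "solves F g T \<longleftrightarrow> (\<forall>t\<in>{0..T}. (g has_vector_derivative F (g t)) (at t within {0..T}))"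

lemma solvesD: "solves F g T \<Longrightarrow> t \<in> {0..T} \<Longrightarrow> (g has_vector_derivative F (g t)) (at t within {0..T})"
  by (auto simp: solves_def)

lemma solves_continuous: "solves F g T \<Longrightarrow> continuous_on {0..T} g"
  by (meson solvesD continuous_on_eq_continuous_within has_vector_derivative_continuous)

lemma solves_subset: "solves F g T \<Longrightarrow> S \<le> T \<Longrightarrow> solves F g S"
  unfolding solves_def
proof
  fix t assume "\<forall>t\<in>{0..T}. (g has_vector_derivative F (g t)) (at t within {0..T})" "S \<le> T" "t \<in> {0..S}"
  then show "(g has_vector_derivative F (g t)) (at t within {0..S})"
    by (intro has_vector_derivative_within_subset[of g "F (g t)" t "{0..T}" "{0..S}"]) auto
qed

text \<open>Cubic fields are not globally Lipschitz, but two solutions on a compact time interval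
  stay in a common ball, so one constant per radius suffices. In this form the property is stable
  under products.\<close>

definition lipschitz_on_balls :: "('a::real_normed_vector \<Rightarrow> 'b::real_normed_vector) \<Rightarrow> bool" where
  "lipschitz_on_balls f \<longleftrightarrow>
     (\<forall>r. \<exists>L\<ge>0. \<forall>p q. norm p \<le> r \<longrightarrow> norm q \<le> r \<longrightarrow> norm (f p - f q) \<le> L * norm (p - q))"

lemma lipschitz_on_ballsE:
  assumes "lipschitz_on_balls f"
  obtains L where "L \<ge> 0" "\<And>p q. norm p \<le> r \<Longrightarrow> norm q \<le> r \<Longrightarrow> norm (f p - f q) \<le> L * norm (p - q)"
  using assms unfolding lipschitz_on_balls_def by blast

lemma lipschitz_on_ballsI:
  assumes "\<And>r. \<exists>L\<ge>0. \<forall>p q. norm p \<le> r \<longrightarrow> norm q \<le> r \<longrightarrow> norm (f p - f q) \<le> L * norm (p - q)"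
  shows "lipschitz_on_balls f"
  using assms unfolding lipschitz_on_balls_def by blast

lemma lipschitz_on_balls_const: "lipschitz_on_balls (\<lambda>_. c)"
  by (auto simp: lipschitz_on_balls_def)

lemma lipschitz_on_balls_bounded_linear:
  assumes "bounded_linear f" shows "lipschitz_on_balls f"
proof -
  obtain K where K: "K > 0" "\<And>x. norm (f x) \<le> norm x * K"
    using bounded_linear.pos_bounded[OF assms] by blast
  have "norm (f p - f q) \<le> K * norm (p - q)" for p q
    using K(2)[of "p - q"] by (simp add: bounded_linear.linear[OF assms] linear_diff mult.commute)
  then show ?thesis
    using K(1) by (intro lipschitz_on_ballsI exI[of _ K]) auto
qed

lemma lipschitz_on_balls_add:
  assumes "lipschitz_on_balls f" "lipschitz_on_balls g"
  shows "lipschitz_on_balls (\<lambda>p. f p + g p)"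
  unfolding lipschitz_on_balls_def
proof
  fix r
  obtain L where L: "L \<ge> 0" "\<And>p q. norm p \<le> r \<Longrightarrow> norm q \<le> r \<Longrightarrow> norm (f p - f q) \<le> L * norm (p - q)"
    using lipschitz_on_ballsE[OF assms(1), of r] unfolding real_norm_def by blast
  obtain M where M: "M \<ge> 0" "\<And>p q. norm p \<le> r \<Longrightarrow> norm q \<le> r \<Longrightarrow> norm (g p - g q) \<le> M * norm (p - q)"
    using lipschitz_on_ballsE[OF assms(2), of r] unfolding real_norm_def by blast
  have "norm (f p + g p - (f q + g q)) \<le> (L + M) * norm (p - q)" if "norm p \<le> r" "norm q \<le> r" for p q
    using norm_triangle_ineq[of "f p - f q" "g p - g q"] L(2)[OF that] M(2)[OF that]
    by (simp add: algebra_simps)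
  then show "\<exists>L\<ge>0. \<forall>p q. norm p \<le> r \<longrightarrow> norm q \<le> r \<longrightarrow> norm (f p + g p - (f q + g q)) \<le> L * norm (p - q)"
    using L(1) M(1) by (intro exI[of _ "L + M"]) simp
qed

lemma lipschitz_on_balls_mult:
  fixes f g :: "'a::real_normed_vector \<Rightarrow> real"
  assumes "lipschitz_on_balls f" "lipschitz_on_balls g"
  shows "lipschitz_on_balls (\<lambda>p. f p * g p)"
  unfolding lipschitz_on_balls_def
proof
  fix r :: real
  obtain L where L: "L \<ge> 0" "\<And>p q. norm p \<le> r \<Longrightarrow> norm q \<le> r \<Longrightarrow> \<bar>f p - f q\<bar> \<le> L * norm (p - q)"
    using lipschitz_on_ballsE[OF assms(1), of r] unfolding real_norm_def by blast
  obtain M where M: "M \<ge> 0" "\<And>p q. norm p \<le> r \<Longrightarrow> norm q \<le> r \<Longrightarrow> \<bar>g p - g q\<bar> \<le> M * norm (p - q)"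
    using lipschitz_on_ballsE[OF assms(2), of r] unfolding real_norm_def by blast
  \<comment> \<open>\<open>A\<close> and \<open>B\<close> bound |f| and |g| on the ball by
    comparison with the value at the origin. The absolute value of \<open>r\<close> keeps them
    nonnegative even when the ball is empty.\<close>
  define A where "A = \<bar>f 0\<bar> + L * \<bar>r\<bar>"
  define B where "B = \<bar>g 0\<bar> + M * \<bar>r\<bar>"
  have "\<bar>f p * g p - f q * g q\<bar> \<le> (A * M + B * L) * norm (p - q)" if pq: "norm p \<le> r" "norm q \<le> r" for p q
  proof -
    have r: "0 \<le> r" using pq(1) norm_ge_zero order_trans by blast
    have "\<bar>f p\<bar> \<le> A"
      using L(2)[of p 0] pq r mult_left_mono[OF pq(1) L(1)] unfolding A_def by simp
    moreover have "\<bar>g q\<bar> \<le> B"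
      using M(2)[of q 0] pq r mult_left_mono[OF pq(2) M(1)] unfolding B_def by simp
    moreover have "f p * g p - f q * g q = f p * (g p - g q) + g q * (f p - f q)"
      by (simp add: algebra_simps)
    moreover have "\<bar>f p * (g p - g q) + g q * (f p - f q)\<bar> \<le> \<bar>f p\<bar> * \<bar>g p - g q\<bar> + \<bar>g q\<bar> * \<bar>f p - f q\<bar>"
      using abs_triangle_ineq[of "f p * (g p - g q)" "g q * (f p - f q)"] by (simp add: abs_mult)
    moreover have "\<bar>f p\<bar> * \<bar>g p - g q\<bar> \<le> A * (M * norm (p - q))"
      using \<open>\<bar>f p\<bar> \<le> A\<close> M(2)[OF pq] by (intro mult_mono) auto
    moreover have "\<bar>g q\<bar> * \<bar>f p - f q\<bar> \<le> B * (L * norm (p - q))"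
      using \<open>\<bar>g q\<bar> \<le> B\<close> L(2)[OF pq] by (intro mult_mono) auto
    ultimately show ?thesis by (simp add: algebra_simps)
  qed
  moreover have "A * M + B * L \<ge> 0"
    using L(1) M(1) by (simp add: A_def B_def)
  ultimately show "\<exists>L\<ge>0. \<forall>p q. norm p \<le> r \<longrightarrow> norm q \<le> r \<longrightarrow> norm (f p * g p - f q * g q) \<le> L * norm (p - q)"
    by (intro exI[of _ "A * M + B * L"]) simp
qed

lemma lipschitz_on_balls_power:
  fixes f :: "'a::real_normed_vector \<Rightarrow> real"
  assumes "lipschitz_on_balls f" shows "lipschitz_on_balls (\<lambda>p. f p ^ n)"
proof (induction n)
  case 0
  show ?case by (simp add: lipschitz_on_balls_const)
next
  case (Suc n)
  show ?case using lipschitz_on_balls_mult[OF assms Suc] by simp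
qed

lemma lipschitz_on_balls_minus:
  assumes "lipschitz_on_balls f" shows "lipschitz_on_balls (\<lambda>p. - f p)"
proof -
  have "norm (- f p - - f q) = norm (f p - f q)" for p q
    using norm_minus_cancel[of "f p - f q"] by simp
  then show ?thesis using assms unfolding lipschitz_on_balls_def by presburger
qed

lemma lipschitz_on_balls_diff:
  "lipschitz_on_balls f \<Longrightarrow> lipschitz_on_balls g \<Longrightarrow> lipschitz_on_balls (\<lambda>p. f p - g p)"
  using lipschitz_on_balls_add[of f "\<lambda>p. - g p"] lipschitz_on_balls_minus[of g] by simp

lemma lipschitz_on_balls_Pair:
  assumes "lipschitz_on_balls f" "lipschitz_on_balls g"
  shows "lipschitz_on_balls (\<lambda>p. (f p, g p))"
  unfolding lipschitz_on_balls_def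
proof
  fix r
  obtain L where L: "L \<ge> 0" "\<And>p q. norm p \<le> r \<Longrightarrow> norm q \<le> r \<Longrightarrow> norm (f p - f q) \<le> L * norm (p - q)"
    using lipschitz_on_ballsE[OF assms(1), of r] unfolding real_norm_def by blast
  obtain M where M: "M \<ge> 0" "\<And>p q. norm p \<le> r \<Longrightarrow> norm q \<le> r \<Longrightarrow> norm (g p - g q) \<le> M * norm (p - q)"
    using lipschitz_on_ballsE[OF assms(2), of r] unfolding real_norm_def by blast
  have "norm ((f p, g p) - (f q, g q)) \<le> (L + M) * norm (p - q)" if "norm p \<le> r" "norm q \<le> r" for p q
    using norm_Pair_le[of "f p - f q" "g p - g q"] L(2)[OF that] M(2)[OF that]
    by (simp add: algebra_simps)
  then show "\<exists>L\<ge>0. \<forall>p q. norm p \<le> r \<longrightarrow> norm q \<le> r \<longrightarrow> norm ((f p, g p) - (f q, g q)) \<le> L * norm (p - q)"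
    using L(1) M(1) by (intro exI[of _ "L + M"]) simp
qed

lemmas lipschitz_on_balls_intros = lipschitz_on_balls_const lipschitz_on_balls_add
  lipschitz_on_balls_mult lipschitz_on_balls_power lipschitz_on_balls_minus lipschitz_on_balls_diff
  lipschitz_on_balls_Pair lipschitz_on_balls_bounded_linear[OF bounded_linear_fst]
  lipschitz_on_balls_bounded_linear[OF bounded_linear_snd]

text \<open>Gronwall's argument in differential form: if \<open>L\<close> is a Lipschitz constant on
  a ball containing both trajectories, then |g - h|^2 exp(-2 L s) does not increase, and it starts
  at 0.\<close>

lemma solves_unique:
  assumes lip: "lipschitz_on_balls F" and g: "solves F g T" and h: "solves F h T"
    and init: "g 0 = h 0" and t: "t \<in> {0..T}"
  shows "g t = h t"
proof (cases "t = 0")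
  case False
  have "compact (g ` {0..T} \<union> h ` {0..T})"
    by (intro compact_Un compact_continuous_image solves_continuous[OF g] solves_continuous[OF h]) simp_all
  then obtain r where r: "\<And>p. p \<in> g ` {0..T} \<union> h ` {0..T} \<Longrightarrow> norm p \<le> r"
    using compact_imp_bounded bounded_iff by metis
  obtain L where L: "L \<ge> 0" "\<And>p q. norm p \<le> r \<Longrightarrow> norm q \<le> r \<Longrightarrow> norm (F p - F q) \<le> L * norm (p - q)"
    using lipschitz_on_ballsE[OF lip, of r] by blast
  define w where "w s = (g s - h s) \<bullet> (g s - h s) * exp (- 2 * L * s)" for s
  have sub: "{0..t} \<subseteq> {0..T}" using t by auto
  have "w t \<le> w 0"
  proof (rule DERIV_nonpos_imp_decreasing_open[of 0 t w])
    show "0 \<le> t" using t by simp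
    show "continuous_on {0..t} w"
      unfolding w_def
      by (intro continuous_intros continuous_on_subset[OF solves_continuous[OF g] sub]
          continuous_on_subset[OF solves_continuous[OF h] sub])
    fix s assume s: "0 < s" "s < t"
    then have at: "at s within {0..T} = at s" "s \<in> {0..T}"
      using t by (auto simp: at_within_Icc_at)
    define d where "d = g s - h s"
    define D where "D = F (g s) - F (h s)"
    have 1: "((\<lambda>s. g s - h s) has_derivative (\<lambda>x. x *\<^sub>R D)) (at s)"
      using has_vector_derivative_diff[OF solvesD[OF g at(2)] solvesD[OF h at(2)]]
      unfolding at(1) has_vector_derivative_def D_def .
    have "((\<lambda>s. (g s - h s) \<bullet> (g s - h s)) has_derivative (\<lambda>x. d \<bullet> (x *\<^sub>R D) + (x *\<^sub>R D) \<bullet> d)) (at s)"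
      unfolding d_def by (rule has_derivative_inner[OF 1 1])
    then have "((\<lambda>s. (g s - h s) \<bullet> (g s - h s)) has_real_derivative (2 * (d \<bullet> D))) (at s)"
      by (rule has_derivative_imp_has_field_derivative) (simp add: inner_commute)
    then have "(w has_real_derivative (2 * (d \<bullet> D) * exp (- 2 * L * s) + exp (- 2 * L * s) * (- 2 * L) * (d \<bullet> d))) (at s)"
      unfolding w_def d_def by (auto intro!: derivative_eq_intros)
    moreover have "d \<bullet> D \<le> L * (d \<bullet> d)"
    proof -
      have "norm D \<le> L * norm d"
        unfolding D_def d_def using at(2) by (intro L(2) r) auto
      then have "norm d * norm D \<le> norm d * (L * norm d)"
        by (intro mult_left_mono) auto
      then show ?thesis
        using norm_cauchy_schwarz[of d D] by (simp add: dot_square_norm power2_eq_square algebra_simps)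
    qed
    then have "2 * (d \<bullet> D) * exp (- 2 * L * s) + exp (- 2 * L * s) * (- 2 * L) * (d \<bullet> d) \<le> 0"
      using mult_left_mono[of "d \<bullet> D" "L * (d \<bullet> d)" "2 * exp (- 2 * L * s)"] by (simp add: algebra_simps)
    ultimately show "\<exists>y. (w has_real_derivative y) (at s) \<and> y \<le> 0" by blast
  qed
  then have "(g t - h t) \<bullet> (g t - h t) * exp (- 2 * L * t) \<le> 0"
    by (simp add: w_def init)
  then have "(g t - h t) \<bullet> (g t - h t) \<le> 0"
    by (simp add: mult_le_0_iff)
  then show ?thesis by (metis inner_gt_zero_iff eq_iff_diff_eq_0 not_less)
qed (simp add: init)

text \<open>\<open>W\<close> is filled by periodic orbits and \<mu> is an integrating factor: dE =
  \<mu> (Y dx - X dy) for the field (X, Y). As \<mu> is positive, \<open>E\<close> grows in the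
  direction of the field turned clockwise by a right angle, which for a counterclockwise center is
  outwards.\<close>

locale planar_center =
  fixes F :: "real \<times> real \<Rightarrow> real \<times> real" and W :: "(real \<times> real) set"
    and E \<mu> :: "real \<times> real \<Rightarrow> real"
  assumes open_W: "open W"
    and unique: "solves F g T \<Longrightarrow> solves F h T \<Longrightarrow> g 0 = h 0 \<Longrightarrow> t \<in> {0..T} \<Longrightarrow> g t = h t"
    and mu_pos: "p \<in> W \<Longrightarrow> \<mu> p > 0"
    and E_deriv: "p \<in> W \<Longrightarrow>
      (E has_derivative (\<lambda>v. \<mu> p * (snd (F p) * fst v - fst (F p) * snd v))) (at p)"
    and periodic: "p \<in> W \<Longrightarrow> \<exists>\<gamma> T. T > 0 \<and> \<gamma> 0 = p \<and> \<gamma> T = p \<and>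
      (\<forall>t. (\<gamma> has_vector_derivative F (\<gamma> t)) (at t) \<and> \<gamma> t \<in> W)"
begin

lemma conserved:
  assumes g: "solves F g T" and W: "\<And>t. t \<in> {0..T} \<Longrightarrow> g t \<in> W" and t: "t \<in> {0..T}"
  shows "E (g t) = E (g 0)"
proof (rule has_derivative_zero_unique[of "{0..T}" "E \<circ> g", unfolded o_def])
  fix s assume s: "s \<in> {0..T}"
  have "((E \<circ> g) has_derivative (\<lambda>v. \<mu> (g s) * (snd (F (g s)) * fst v - fst (F (g s)) * snd v)) \<circ> (\<lambda>x. x *\<^sub>R F (g s))) (at s within {0..T})"
    using solvesD[OF g s] W[OF s] has_derivative_at_withinI[OF E_deriv]
    unfolding has_vector_derivative_def by (intro diff_chain_within) auto
  then show "((\<lambda>x. E (g x)) has_derivative (\<lambda>h. 0)) (at s within {0..T})"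
    by (simp add: o_def algebra_simps)
qed (use t in auto)

end

section \<open>Arcs of periodic orbits on one side of a line\<close>

text \<open>Periodicity forces a return to the line. At the first return the arc arrives from the
  side \<open>s\<close>, so \<open>s * fst\<close> cannot be strictly increasing at that moment, as
  it is at every passage through \<open>p\<close>. Hence the return takes place at
  \<open>q\<close>.\<close>

lemma first_return:
  fixes \<gamma> :: "real \<Rightarrow> real \<times> real" and s :: real
  assumes T: "T > 0" and p: "\<gamma> 0 = p" "\<gamma> T = p"
    and ode: "\<And>t. (\<gamma> has_vector_derivative F (\<gamma> t)) (at t)"
    and line: "fst p = 0" and out: "s * fst (F p) > 0"
    and hits: "\<And>t. fst (\<gamma> t) = 0 \<Longrightarrow> \<gamma> t = p \<or> \<gamma> t = q"
  obtains S where "S > 0" "\<gamma> S = q" "\<And>t. t \<in> {0<..<S} \<Longrightarrow> s * fst (\<gamma> t) > 0"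
proof -
  define x where "x t = s * fst (\<gamma> t)" for t
  have dx: "(x has_real_derivative s * fst (F (\<gamma> t))) (at t)" for t
  proof -
    have "((\<lambda>t. fst (\<gamma> t)) has_real_derivative fst (F (\<gamma> t))) (at t)"
      using bounded_linear.has_vector_derivative[OF bounded_linear_fst ode]
      by (simp add: has_real_derivative_iff_has_vector_derivative)
    then show ?thesis
      unfolding x_def by (rule DERIV_cmult)
  qed
  have cont: "continuous_on A x" for A
    using dx by (meson DERIV_continuous_on has_field_derivative_at_within)
  have s0: "s \<noteq> 0" using out by auto
  have x0: "x t = 0 \<longleftrightarrow> fst (\<gamma> t) = 0" for t
    using s0 by (simp add: x_def)
  obtain d where d: "d > 0" "\<And>h. 0 < h \<Longrightarrow> h < d \<Longrightarrow> x h > 0"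
  proof -
    have "x 0 = 0" using line p by (simp add: x0)
    then show ?thesis
      using DERIV_pos_inc_right[OF dx[of 0]] out p that by auto
  qed
  have Td: "T \<ge> d"
    using d(2)[of T] T line p by (force simp: x_def)
  \<comment> \<open>Time 0 is itself a zero of \<open>x\<close>. Starting at \<open>d/2\<close>
    excludes it, keeps the set compact and loses no other zero, since \<open>x\<close> is positive
    on the open interval from 0 to \<open>d\<close>.\<close>
  define Z where "Z = {d/2..T} \<inter> x -` {0}"
  have "compact Z"
    unfolding Z_def
    by (intro compact_Int_closed compact_Icc continuous_closed_vimage)
      (auto intro: DERIV_isCont dx)
  moreover have "T \<in> Z" using Td d(1) line p by (auto simp: Z_def x0)
  ultimately obtain S where S: "S \<in> Z" "\<And>t. t \<in> Z \<Longrightarrow> S \<le> t"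
    using compact_attains_inf[of Z] by blast
  have Spos: "S > 0" using S(1) d(1) by (auto simp: Z_def)
  have pos: "x t > 0" if t: "0 < t" "t < S" for t
  proof (cases "t < d")
    case False
    show ?thesis
    proof (rule ccontr)
      assume "\<not> x t > 0"
      then obtain u where u: "d/2 \<le> u" "u \<le> t" "x u = 0"
        using IVT2'[of x t 0 "d/2"] d(2)[of "d/2"] d(1) False cont by auto
      then have "u \<in> Z" using t S(1) by (auto simp: Z_def)
      then show False using S(2) u t by fastforce
    qed
  qed (use d t in auto)
  have "\<gamma> S \<noteq> p"
  proof
    assume "\<gamma> S = p"
    then obtain e where e: "e > 0" "\<And>h. 0 < h \<Longrightarrow> h < e \<Longrightarrow> x (S - h) < x S"
      using DERIV_pos_inc_left[OF dx[of S]] out by auto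
    define h where "h = min (e/2) (S/2)"
    have "0 < h" "h < e" "0 < S - h" "S - h < S"
      using e(1) Spos by (auto simp: h_def min_def)
    then have "x (S - h) < x S" "x (S - h) > 0" using e(2) pos by auto
    then show False using S(1) by (simp add: Z_def)
  qed
  moreover have "fst (\<gamma> S) = 0" using S(1) by (auto simp: Z_def x0)
  ultimately have "\<gamma> S = q" using hits by blast
  then show ?thesis using that[OF Spos] pos by (simp add: x_def)
qed

lemma solves_of_global:
  assumes "\<And>t. (\<gamma> has_vector_derivative F (\<gamma> t)) (at t)"
  shows "solves F \<gamma> T"
  unfolding solves_def using assms by (blast intro: has_vector_derivative_at_within)

text \<open>\<open>c\<close> is the tangency point of the field with the line x = 0, and the two
  signs express a counterclockwise turn around it. Since \<open>W\<close> meets the line in an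
  interval, membership of a whole segment follows from that of its ends.\<close>

locale crossing_side = planar_center +
  fixes c :: real
  assumes interval: "is_interval {y. (0, y) \<in> W}"
    and below: "(0, y) \<in> W \<Longrightarrow> y < c \<Longrightarrow> fst (F (0, y)) > 0"
    and above: "(0, y) \<in> W \<Longrightarrow> y > c \<Longrightarrow> fst (F (0, y)) < 0"
begin

lemma between_W: "(0, a) \<in> W \<Longrightarrow> (0, b) \<in> W \<Longrightarrow> a \<le> y \<Longrightarrow> y \<le> b \<Longrightarrow> (0, y) \<in> W"
  using interval unfolding is_interval_1 by blast

lemma E_line_deriv:
  assumes "(0, y) \<in> W"
  shows "((\<lambda>y. E (0, y)) has_real_derivative - \<mu> (0, y) * fst (F (0, y))) (at y)"
proof -
  have "((\<lambda>y. (0::real, y)) has_derivative (\<lambda>h. (0, h))) (at y)"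
    by (auto intro!: derivative_eq_intros)
  from diff_chain_at[OF this E_deriv[OF assms]] show ?thesis
    unfolding o_def by (rule has_derivative_imp_has_field_derivative) simp
qed

lemma E_line_continuous: "(\<And>y. y \<in> A \<Longrightarrow> (0, y) \<in> W) \<Longrightarrow> continuous_on A (\<lambda>y. E (0, y))"
  using E_line_deriv by (meson DERIV_isCont continuous_at_imp_continuous_on)

lemma E_line_decreasing:
  assumes "(0, y) \<in> W" "(0, z) \<in> W" "y < z" "z \<le> c"
  shows "E (0, z) < E (0, y)"
proof (rule DERIV_neg_imp_decreasing_open[OF assms(3)])
  fix x assume x: "y < x" "x < z"
  then have "(0, x) \<in> W" using between_W assms by (meson less_imp_le)
  then show "\<exists>d. ((\<lambda>y. E (0, y)) has_real_derivative d) (at x) \<and> d < 0"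
    using E_line_deriv[of x] mult_pos_pos[OF mu_pos[of "(0, x)"] below[of x]] x assms(4)
    by (intro exI[of _ "- \<mu> (0, x) * fst (F (0, x))"]) simp
next
  show "continuous_on {y..z} (\<lambda>y. E (0, y))"
    by (rule E_line_continuous) (use between_W[OF assms(1,2)] in simp)
qed

lemma E_line_increasing:
  assumes "(0, y) \<in> W" "(0, z) \<in> W" "y < z" "c \<le> y"
  shows "E (0, y) < E (0, z)"
proof (rule DERIV_pos_imp_increasing_open[OF assms(3)])
  fix x assume x: "y < x" "x < z"
  then have "(0, x) \<in> W" using between_W assms by (meson less_imp_le)
  then show "\<exists>d. ((\<lambda>y. E (0, y)) has_real_derivative d) (at x) \<and> d > 0"
    using E_line_deriv[of x] mult_pos_neg[OF mu_pos[of "(0, x)"] above[of x]] x assms(4)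
    by (intro exI[of _ "- \<mu> (0, x) * fst (F (0, x))"]) simp
next
  show "continuous_on {y..z} (\<lambda>y. E (0, y))"
    by (rule E_line_continuous) (use between_W[OF assms(1,2)] in simp)
qed

text \<open>\<open>E\<close> falls strictly up to \<open>c\<close> and rises strictly afterwards, so
  a level is met at most once on each side of \<open>c\<close>; \<open>a\<close> and
  \<open>b\<close> are these two points.\<close>

lemma level_line:
  assumes "(0, a) \<in> W" "(0, b) \<in> W" "a < c" "c < b" "E (0, a) = E (0, b)"
    and "(0, y) \<in> W" "E (0, y) = E (0, a)"
  shows "y = a \<or> y = b"
proof (rule ccontr)
  assume "\<not> (y = a \<or> y = b)"
  then consider "y < a" | "a < y" "y \<le> c" | "c \<le> y" "y < b" | "b < y" by linarith
  then show False
  proof cases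
    case 1 then show False using E_line_decreasing[of y a] assms by simp
  next
    case 2 then show False using E_line_decreasing[of a y] assms by simp
  next
    case 3 then show False using E_line_increasing[of y b] assms by simp
  next
    case 4 then show False using E_line_increasing[of b y] assms by simp
  qed
qed

text \<open>The periodic orbit through \<open>(0, a)\<close> keeps its value of \<open>E\<close>, so
  it meets the line only at the two given points, and \<open>first_return\<close> cuts the arc out
  of it. The alternatives for \<open>s\<close> are right-hand arcs, run upwards, and left-hand arcs,
  run downwards.\<close>

lemma arc_exists:
  assumes "(0, a) \<in> W" "(0, b) \<in> W" "E (0, a) = E (0, b)"
    and "a < c \<and> c < b \<and> s = 1 \<or> b < c \<and> c < a \<and> s = -1"
  obtains g T where "T > 0" "solves F g T" "g 0 = (0, a)" "g T = (0, b)"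
    "\<And>t. t \<in> {0<..<T} \<Longrightarrow> s * fst (g t) > 0" "\<And>t. g t \<in> W"
proof -
  obtain \<gamma> T where \<gamma>: "T > 0" "\<gamma> 0 = (0, a)" "\<gamma> T = (0, a)"
    "\<And>t. (\<gamma> has_vector_derivative F (\<gamma> t)) (at t)" "\<And>t. \<gamma> t \<in> W"
    using periodic[OF assms(1)] by blast
  have hits: "\<gamma> t = (0, a) \<or> \<gamma> t = (0, b)" if "fst (\<gamma> t) = 0" for t
  proof -
    have E: "E (\<gamma> t) = E (0, a)"
    proof (cases "t \<ge> 0")
      case True
      then show ?thesis
        using conserved[OF solves_of_global[OF \<gamma>(4)], of t t] \<gamma> by auto
    next
      case False
      \<comment> \<open>\<open>conserved\<close> covers forward time only, so for negative
        \<open>t\<close> the time is shifted to make \<gamma> t the initial point.\<close>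
      have "((\<lambda>s. \<gamma> (s + t)) has_vector_derivative F (\<gamma> (s + t))) (at s)" for s
      proof -
        have "((\<lambda>s. s + t) has_vector_derivative 1) (at s)"
          by (auto intro!: derivative_eq_intros)
        from vector_diff_chain_at[OF this \<gamma>(4)] show ?thesis by (simp add: o_def)
      qed
      then show ?thesis
        using conserved[OF solves_of_global[of "\<lambda>s. \<gamma> (s + t)"], of "-t" "-t"] \<gamma> False by auto
    qed
    obtain y where "\<gamma> t = (0, y)" using \<open>fst (\<gamma> t) = 0\<close> by (cases "\<gamma> t") simp
    then show ?thesis
      using assms E \<gamma>(5)[of t] level_line[of a b y] level_line[of b a y] by auto
  qed
  obtain S where "S > 0" "\<gamma> S = (0, b)" "\<And>t. t \<in> {0<..<S} \<Longrightarrow> s * fst (\<gamma> t) > 0"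
  proof (rule first_return[OF \<gamma>(1-4), of s "(0, b)"])
    show "s * fst (F (0, a)) > 0"
      using below[OF assms(1)] above[OF assms(1)] assms(4) by auto
  qed (use hits in auto)
  then show ?thesis using that \<gamma> solves_of_global[OF \<gamma>(4)] by blast
qed

text \<open>Orbits are compared as sets, so the durations must agree as well: the shorter arc would
  end on the line at a time when the other one is still strictly off it.\<close>

lemma arc_unique:
  assumes g: "solves F g T" "T > 0" "fst (g T) = 0" "\<And>t. t \<in> {0<..<T} \<Longrightarrow> fst (g t) \<noteq> 0"
    and h: "solves F h S" "S > 0" "fst (h S) = 0" "\<And>t. t \<in> {0<..<S} \<Longrightarrow> fst (h t) \<noteq> 0"
    and init: "g 0 = h 0"
  shows "g ` {0..T} = h ` {0..S}"
proof -
  define R where "R = min S T"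
  have eq: "g t = h t" if "t \<in> {0..R}" for t
    using unique[OF solves_subset[OF g(1)] solves_subset[OF h(1)] init that] by (simp add: R_def)
  have "S = T"
  proof (rule ccontr)
    assume "S \<noteq> T"
    then consider "S < T" | "T < S" by linarith
    then show False
      using eq[of R] g(2,3) h(2,3) g(4)[of S] h(4)[of T] by cases (auto simp: R_def min_def)
  qed
  then show ?thesis using eq by (intro image_cong) (auto simp: R_def)
qed

end

text \<open>The corner conditions on \<open>f\<close> put its values on the upper edge strictly
  between \<open>f a1\<close> and \<open>f a0\<close>, so \<open>f (\<alpha> b) = f b\<close>
  defines a continuous curve across the box. Along this curve \<open>g b - g (\<alpha> b)\<close>
  changes sign.\<close>

lemma box_solution:
  fixes f g :: "real \<Rightarrow> real"
  assumes "a0 < a1" "b0 < b1"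
    and f: "\<And>x y. a0 \<le> x \<Longrightarrow> x < y \<Longrightarrow> y \<le> a1 \<Longrightarrow> f y < f x"
      "\<And>x y. b0 \<le> x \<Longrightarrow> x < y \<Longrightarrow> y \<le> b1 \<Longrightarrow> f x < f y"
    and g: "\<And>x y. a0 \<le> x \<Longrightarrow> x < y \<Longrightarrow> y \<le> a1 \<Longrightarrow> g y < g x"
    and cont: "continuous_on {a0..a1} f" "continuous_on {b0..b1} f"
      "continuous_on {a0..a1} g" "continuous_on {b0..b1} g"
    and corner: "f b1 < f a0" "f a1 < f b0" "g b0 < g a1" "g a0 < g b1"
  obtains a b where "a \<in> {a0<..<a1}" "b \<in> {b0<..<b1}" "f a = f b" "g a = g b"
proof -
  have inj: "inj_on f {a0..a1}"
    by (rule linorder_inj_onI) (use f(1) in \<open>force+\<close>)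
  define \<alpha> where "\<alpha> b = the_inv_into {a0..a1} f (f b)" for b
  have f_mono: "f b0 \<le> f b" "f b \<le> f b1" if "b \<in> {b0..b1}" for b
    using f(2)[of b0 b] f(2)[of b b1] that by (cases "b = b0"; cases "b = b1"; force)+
  have surj: "f b \<in> f ` {a0..a1}" if b: "b \<in> {b0..b1}" for b
  proof -
    obtain a where "a0 \<le> a" "a \<le> a1" "f a = f b"
      using IVT2'[of f a1 "f b" a0] f_mono[OF b] corner cont(1) assms(1) by force
    then show ?thesis by (metis atLeastAtMost_iff image_eqI)
  qed
  have \<alpha>: "\<alpha> b \<in> {a0..a1}" "f (\<alpha> b) = f b" if "b \<in> {b0..b1}" for b
    using the_inv_into_into[OF inj surj[OF that] order.refl] f_the_inv_into_f[OF inj surj[OF that]]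
    by (auto simp: \<alpha>_def)
  have \<alpha>_open: "a0 < \<alpha> b" "\<alpha> b < a1" if "b \<in> {b0..b1}" for b
    using \<alpha>[OF that] f_mono[OF that] corner by (force simp: less_le)+
  have "continuous_on (f ` {a0..a1}) (the_inv_into {a0..a1} f)"
    by (rule continuous_on_inv[OF cont(1)]) (auto simp: the_inv_into_f_f[OF inj])
  then have "continuous_on {b0..b1} \<alpha>"
    unfolding \<alpha>_def using surj by (intro continuous_on_compose2[OF _ cont(2)]) auto
  then have "continuous_on {b0..b1} (\<lambda>b. g b - g (\<alpha> b))"
    using \<alpha>(1) by (intro continuous_on_diff cont(4) continuous_on_compose2[OF cont(3)]) auto
  \<comment> \<open>The chains are \<open>g (\<alpha> b0) > g a1 > g b0\<close> and
    \<open>g (\<alpha> b1) < g a0 < g b1\<close>. Their strictness keeps the zero away from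
    \<open>b0\<close> and \<open>b1\<close>, so the solution lies in the open box.\<close>
  moreover have "g b0 - g (\<alpha> b0) \<le> 0" "g b0 - g (\<alpha> b0) \<noteq> 0"
    using g[of "\<alpha> b0" a1] \<alpha>_open[of b0] corner(3) assms(2) by auto
  moreover have "0 \<le> g b1 - g (\<alpha> b1)" "g b1 - g (\<alpha> b1) \<noteq> 0"
    using g[of a0 "\<alpha> b1"] \<alpha>_open[of b1] corner(4) assms(2) by auto
  ultimately obtain b where b: "b0 \<le> b" "b \<le> b1" "g b - g (\<alpha> b) = 0" "b \<noteq> b0" "b \<noteq> b1"
    using IVT'[of "\<lambda>b. g b - g (\<alpha> b)" b0 0 b1] assms(2) by fastforce
  then show ?thesis
    using that[of "\<alpha> b" b] \<alpha>[of b] \<alpha>_open[of b] by auto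
qed

text \<open>By the monotonicity of \<open>f\<close>, lowering \<open>a\<close> raises
  \<open>b\<close>, so two distinct solutions are nested. As \<open>h = f - k * g\<close> decreases
  on both edges, the outer pair has the larger value of \<open>h\<close> at its lower end and the
  smaller one at its upper end; yet a solution has equal values of \<open>h\<close> at its two
  ends.\<close>

lemma box_unique:
  fixes f g :: "real \<Rightarrow> real"
  assumes mono: "\<And>x y. a0 \<le> x \<Longrightarrow> x < y \<Longrightarrow> y \<le> a1 \<Longrightarrow> f y < f x"
      "\<And>x y. b0 \<le> x \<Longrightarrow> x < y \<Longrightarrow> y \<le> b1 \<Longrightarrow> f x < f y"
    and f: "\<And>y. y \<in> {a0..a1} \<union> {b0..b1} \<Longrightarrow> (f has_real_derivative f' y) (at y)"
    and g: "\<And>y. y \<in> {a0..a1} \<union> {b0..b1} \<Longrightarrow> (g has_real_derivative g' y) (at y)"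
    and k: "\<And>y. y \<in> {a0..a1} \<union> {b0..b1} \<Longrightarrow> f' y < k * g' y"
    and ab: "a \<in> {a0..a1}" "b \<in> {b0..b1}" "f a = f b" "g a = g b"
    and xy: "x \<in> {a0..a1}" "y \<in> {b0..b1}" "f x = f y" "g x = g y"
  shows "x = a" "y = b"
proof -
  define h where "h y = f y - k * g y" for y
  have dec: "h v < h u" if "u < v" "a0 \<le> u \<and> v \<le> a1 \<or> b0 \<le> u \<and> v \<le> b1" for u v
  proof (rule DERIV_neg_imp_decreasing[OF that(1)])
    fix z assume "u \<le> z" "z \<le> v"
    then have z: "z \<in> {a0..a1} \<union> {b0..b1}" using that by auto
    have "(h has_real_derivative f' z - k * g' z) (at z)"
      unfolding h_def using f[OF z] g[OF z] by (auto intro!: derivative_eq_intros)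
    then show "\<exists>d. (h has_real_derivative d) (at z) \<and> d < 0" using k[OF z] by force
  qed
  have h: "h a = h b" "h x = h y" using ab xy by (simp_all add: h_def)
  have "\<not> x < a"
  proof
    assume "x < a"
    then have "f b < f y" using mono(1)[of x a] ab xy by auto
    then have "b < y" using mono(2)[of y b] ab xy by (cases y b rule: linorder_cases) auto
    then have "h y < h b" "h a < h x" using dec[of b y] dec[of x a] \<open>x < a\<close> ab xy by auto
    then show False using h by simp
  qed
  moreover have "\<not> a < x"
  proof
    assume "a < x"
    then have "f y < f b" using mono(1)[of a x] ab xy by auto
    then have "y < b" using mono(2)[of b y] ab xy by (cases y b rule: linorder_cases) auto
    then have "h b < h y" "h x < h a" using dec[of y b] dec[of a x] \<open>a < x\<close> ab xy by auto
    then show False using h by simp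
  qed
  ultimately show "x = a" by simp
  then show "y = b"
    using mono(2)[of y b] mono(2)[of b y] ab xy by (cases y b rule: linorder_cases) auto
qed

section \<open>Crossing limit cycles from isolated solutions\<close>

text \<open>The definition is not symmetric in the two functions. On the lower edge both derivatives
  will be negative and the last condition reads \<open>f' / g' > k\<close>; on the upper edge both
  will be positive and it reads \<open>f' / g' < k\<close>. This fixes the direction in which the
  two curves cross; exchanging the functions describes a crossing in the other direction.\<close>

definition crossing_box ::
  "(real \<Rightarrow> real) \<Rightarrow> (real \<Rightarrow> real) \<Rightarrow> (real \<Rightarrow> real) \<Rightarrow> (real \<Rightarrow> real) \<Rightarrow> real \<Rightarrow> real \<Rightarrow> real \<Rightarrow> real \<Rightarrow> bool" where
  "crossing_box f f' g g' a0 a1 b0 b1 \<longleftrightarrow> a0 < a1 \<and> b0 < b1 \<and>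
     f b1 < f a0 \<and> f a1 < f b0 \<and> g b0 < g a1 \<and> g a0 < g b1 \<and>
     (\<exists>k. \<forall>y\<in>{a0..a1} \<union> {b0..b1}. f' y < k * g' y)"

lemma crossing_box_isolated_solution:
  fixes f g f' g' :: "real \<Rightarrow> real"
  assumes box: "crossing_box f f' g g' a0 a1 b0 b1 \<or> crossing_box g g' f f' a0 a1 b0 b1"
    and f: "\<And>x y. a0 \<le> x \<Longrightarrow> x < y \<Longrightarrow> y \<le> a1 \<Longrightarrow> f y < f x"
      "\<And>x y. b0 \<le> x \<Longrightarrow> x < y \<Longrightarrow> y \<le> b1 \<Longrightarrow> f x < f y"
      "\<And>y. y \<in> {a0..a1} \<union> {b0..b1} \<Longrightarrow> (f has_real_derivative f' y) (at y)"
    and g: "\<And>x y. a0 \<le> x \<Longrightarrow> x < y \<Longrightarrow> y \<le> a1 \<Longrightarrow> g y < g x"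
      "\<And>x y. b0 \<le> x \<Longrightarrow> x < y \<Longrightarrow> y \<le> b1 \<Longrightarrow> g x < g y"
      "\<And>y. y \<in> {a0..a1} \<union> {b0..b1} \<Longrightarrow> (g has_real_derivative g' y) (at y)"
  obtains a b where "a \<in> {a0<..<a1}" "b \<in> {b0<..<b1}" "f a = f b" "g a = g b"
    "\<And>x y. x \<in> {a0<..<a1} \<Longrightarrow> y \<in> {b0<..<b1} \<Longrightarrow> f x = f y \<Longrightarrow> g x = g y \<Longrightarrow> x = a \<and> y = b"
proof -
  have cf: "continuous_on A f" if "A \<subseteq> {a0..a1} \<union> {b0..b1}" for A
    using f(3) that by (meson DERIV_isCont continuous_at_imp_continuous_on subsetD)
  have cg: "continuous_on A g" if "A \<subseteq> {a0..a1} \<union> {b0..b1}" for A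
    using g(3) that by (meson DERIV_isCont continuous_at_imp_continuous_on subsetD)
  show ?thesis
    using box
  proof
    assume b: "crossing_box f f' g g' a0 a1 b0 b1"
    then obtain k where k: "\<And>y. y \<in> {a0..a1} \<union> {b0..b1} \<Longrightarrow> f' y < k * g' y"
      unfolding crossing_box_def by blast
    obtain a b where ab: "a \<in> {a0<..<a1}" "b \<in> {b0<..<b1}" "f a = f b" "g a = g b"
      by (rule box_solution[of a0 a1 b0 b1 f g]) (use b f g cf cg in \<open>auto simp: crossing_box_def\<close>)
    have "x = a \<and> y = b" if "x \<in> {a0<..<a1}" "y \<in> {b0<..<b1}" "f x = f y" "g x = g y" for x y
      using box_unique[of a0 a1 f b0 b1 f' g g' k a b x y, OF f(1,2,3) g(3) k] ab that by auto
    then show ?thesis using that[OF ab] by blast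
  next
    assume b: "crossing_box g g' f f' a0 a1 b0 b1"
    then obtain k where k: "\<And>y. y \<in> {a0..a1} \<union> {b0..b1} \<Longrightarrow> g' y < k * f' y"
      unfolding crossing_box_def by blast
    obtain a b where ab: "a \<in> {a0<..<a1}" "b \<in> {b0<..<b1}" "g a = g b" "f a = f b"
      by (rule box_solution[of a0 a1 b0 b1 g f]) (use b f g cf cg in \<open>auto simp: crossing_box_def\<close>)
    have "x = a \<and> y = b" if "x \<in> {a0<..<a1}" "y \<in> {b0<..<b1}" "f x = f y" "g x = g y" for x y
      using box_unique[of a0 a1 g b0 b1 g' f f' k a b x y, OF g(1,2,3) f(3) k] ab that by auto
    then show ?thesis using that[OF ab(1,2,4,3)] by blast
  qed
qed

locale two_sides =
  P: crossing_side Fp Wp Ep \<mu>p cp + M: crossing_side Fm Wm Em \<mu>m cm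
  for Fp Wp Ep \<mu>p cp Fm Wm Em \<mu>m cm
begin

abbreviation "f \<equiv> \<lambda>y. Ep (0, y)"
abbreviation "g \<equiv> \<lambda>y. Em (0, y)"
abbreviation "f' \<equiv> \<lambda>y. - \<mu>p (0, y) * fst (Fp (0, y))"
abbreviation "g' \<equiv> \<lambda>y. - \<mu>m (0, y) * fst (Fm (0, y))"

definition limit_cycle_box :: "real \<Rightarrow> real \<Rightarrow> real \<Rightarrow> real \<Rightarrow> bool" where
  "limit_cycle_box a0 a1 b0 b1 \<longleftrightarrow>
     (crossing_box f f' g g' a0 a1 b0 b1 \<or> crossing_box g g' f f' a0 a1 b0 b1) \<and>
     a1 < cp \<and> a1 < cm \<and> cp < b0 \<and> cm < b0 \<and>
     (0, a0) \<in> Wp \<and> (0, b1) \<in> Wp \<and> (0, a0) \<in> Wm \<and> (0, b1) \<in> Wm"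

text \<open>The solution in the box is joined by a right-hand arc upwards and a left-hand arc
  downwards. A competing orbit near it meets the line at a pair on which both first integrals agree,
  hence at the same pair, and unique solvability then makes the arcs equal.\<close>

lemma limit_cycle_in_box:
  assumes "limit_cycle_box a0 a1 b0 b1"
  obtains \<Gamma> a b where "crossing_limit_cycle Fp Fm \<Gamma>" "a \<in> {a0<..<a1}" "b \<in> {b0<..<b1}"
    "\<And>y. (0, y) \<in> \<Gamma> \<longleftrightarrow> y = a \<or> y = b"
proof -
  have box: "crossing_box f f' g g' a0 a1 b0 b1 \<or> crossing_box g g' f f' a0 a1 b0 b1"
    and c: "a1 < cp" "a1 < cm" "cp < b0" "cm < b0"
    and W: "(0, a0) \<in> Wp" "(0, b1) \<in> Wp" "(0, a0) \<in> Wm" "(0, b1) \<in> Wm"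
    using assms unfolding limit_cycle_box_def by blast+
  have lt: "a0 < a1" "b0 < b1" using box by (auto simp: crossing_box_def)
  have inW: "(0, y) \<in> Wp" "(0, y) \<in> Wm" if "y \<in> {a0..b1}" for y
    using that W P.between_W[of a0 b1 y] M.between_W[of a0 b1 y] by auto
  obtain a b where ab: "a \<in> {a0<..<a1}" "b \<in> {b0<..<b1}" "f a = f b" "g a = g b"
    and uniq: "\<And>x y. x \<in> {a0<..<a1} \<Longrightarrow> y \<in> {b0<..<b1} \<Longrightarrow> f x = f y \<Longrightarrow> g x = g y \<Longrightarrow> x = a \<and> y = b"
  proof (rule crossing_box_isolated_solution[OF box])
    show "f y < f x" "g y < g x" if "a0 \<le> x" "x < y" "y \<le> a1" for x y
      using that c lt inW P.E_line_decreasing[of x y] M.E_line_decreasing[of x y] by auto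
    show "f x < f y" "g x < g y" if "b0 \<le> x" "x < y" "y \<le> b1" for x y
      using that c lt inW P.E_line_increasing[of x y] M.E_line_increasing[of x y] by auto
    show "(f has_real_derivative f' y) (at y)" "(g has_real_derivative g' y) (at y)"
      if "y \<in> {a0..a1} \<union> {b0..b1}" for y
    proof -
      have "y \<in> {a0..b1}" using that c lt by auto
      then show "(f has_real_derivative f' y) (at y)" "(g has_real_derivative g' y) (at y)"
        using P.E_line_deriv M.E_line_deriv inW by blast+
    qed
  qed blast
  have pq: "(0, a) \<in> Wp" "(0, b) \<in> Wp" "(0, a) \<in> Wm" "(0, b) \<in> Wm" "a < cp" "a < cm" "cp < b" "cm < b"
    using ab c lt inW[of a] inW[of b] by auto
  obtain g1 T1 where g1: "T1 > 0" "solves Fp g1 T1" "g1 0 = (0, a)" "g1 T1 = (0, b)"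
    "\<And>t. t \<in> {0<..<T1} \<Longrightarrow> fst (g1 t) > 0" "\<And>t. g1 t \<in> Wp"
    by (rule P.arc_exists[of a b 1]) (use pq ab in auto)
  obtain g2 T2 where g2: "T2 > 0" "solves Fm g2 T2" "g2 0 = (0, b)" "g2 T2 = (0, a)"
    "\<And>t. t \<in> {0<..<T2} \<Longrightarrow> fst (g2 t) < 0" "\<And>t. g2 t \<in> Wm"
    by (rule M.arc_exists[of b a "-1"]) (use pq ab in auto)
  define \<Gamma> where "\<Gamma> = g1 ` {0..T1} \<union> g2 ` {0..T2}"
  have g1_cases: "t = 0 \<or> t = T1 \<or> fst (g1 t) > 0" if "t \<in> {0..T1}" for t
    using that g1(5)[of t] by force
  have g2_cases: "t = 0 \<or> t = T2 \<or> fst (g2 t) < 0" if "t \<in> {0..T2}" for t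
    using that g2(5)[of t] by force
  have crossing: "crossing_point Fp Fm (0, a)" "crossing_point Fp Fm (0, b)"
    using P.below[of a] M.below[of a] P.above[of b] M.above[of b] pq
    by (auto simp: crossing_point_def mult_neg_neg)
  have orbit: "crossing_periodic_orbit Fp Fm \<Gamma>"
    unfolding crossing_periodic_orbit_def
    by (rule exI[of _ "(0, a)"], rule exI[of _ "(0, b)"], rule exI[of _ T1], rule exI[of _ T2],
        rule exI[of _ g1], rule exI[of _ g2])
      (use g1 g2 crossing ab c lt in \<open>auto simp: solves_def \<Gamma>_def\<close>)
  have line: "(0, y) \<in> \<Gamma> \<longleftrightarrow> y = a \<or> y = b" for y
  proof
    assume "(0, y) \<in> \<Gamma>"
    then consider t where "t \<in> {0..T1}" "g1 t = (0, y)" | t where "t \<in> {0..T2}" "g2 t = (0, y)"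
      unfolding \<Gamma>_def by force
    then show "y = a \<or> y = b"
    proof cases
      case 1 then show ?thesis using g1_cases[OF 1(1)] g1(3,4) by auto
    next
      case 2 then show ?thesis using g2_cases[OF 2(1)] g2(3,4) by auto
    qed
  next
    have "g1 0 \<in> \<Gamma>" "g1 T1 \<in> \<Gamma>" using g1(1) by (auto simp: \<Gamma>_def)
    then show "y = a \<or> y = b \<Longrightarrow> (0, y) \<in> \<Gamma>" using g1(3,4) by auto
  qed
  \<comment> \<open>The three factors force points of \<open>U\<close> with nonnegative abscissa
    into \<open>Wp\<close>, those with nonpositive abscissa into \<open>Wm\<close>, and those on the
    line into the two edges. Each factor is built from open half-planes, so \<open>U\<close> is
    open.\<close>
  define U where "U = ({p. fst p < 0} \<union> Wp) \<inter> ({p. fst p > 0} \<union> Wm) \<inter>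
    ({p. fst p < 0} \<union> {p. fst p > 0} \<union> snd -` ({a0<..<a1} \<union> {b0<..<b1}))"
  have "open U"
    unfolding U_def
    by (intro open_Int open_Un P.open_W M.open_W open_vimage_snd open_greaterThanLessThan
        open_Collect_less continuous_intros)
  moreover have "\<Gamma> \<subseteq> U"
  proof
    fix p assume "p \<in> \<Gamma>"
    then consider t where "t \<in> {0..T1}" "p = g1 t" | t where "t \<in> {0..T2}" "p = g2 t"
      unfolding \<Gamma>_def by blast
    then show "p \<in> U"
    proof cases
      case 1
      then show ?thesis
        using g1_cases[of t] g1(3,4) g1(6)[of t] pq ab by (auto simp: U_def)
    next
      case 2
      then show ?thesis
        using g2_cases[of t] g2(3,4) g2(6)[of t] pq ab by (auto simp: U_def)
    qed
  qed
  moreover have "\<Gamma>' = \<Gamma>" if \<Gamma>': "crossing_periodic_orbit Fp Fm \<Gamma>'" "\<Gamma>' \<subseteq> U" for \<Gamma>'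
  proof -
    obtain p q S1 S2 h1 h2 where h: "p \<noteq> q" "crossing_point Fp Fm p" "crossing_point Fp Fm q"
      "S1 > 0" "S2 > 0" "solves Fp h1 S1" "h1 0 = p" "h1 S1 = q" "\<And>t. t \<in> {0<..<S1} \<Longrightarrow> fst (h1 t) > 0"
      "solves Fm h2 S2" "h2 0 = q" "h2 S2 = p" "\<And>t. t \<in> {0<..<S2} \<Longrightarrow> fst (h2 t) < 0"
      "\<Gamma>' = h1 ` {0..S1} \<union> h2 ` {0..S2}"
      using \<Gamma>'(1) unfolding crossing_periodic_orbit_def solves_def by blast
    obtain x where x: "p = (0, x)" using h(2) by (cases p) (auto simp: crossing_point_def)
    obtain y where y: "q = (0, y)" using h(3) by (cases q) (auto simp: crossing_point_def)
    have h1U: "h1 t \<in> U" if "t \<in> {0..S1}" for t using that h(14) \<Gamma>'(2) by blast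
    have h2U: "h2 t \<in> U" if "t \<in> {0..S2}" for t using that h(14) \<Gamma>'(2) by blast
    have xU: "x \<in> {a0<..<a1} \<union> {b0<..<b1}"
      using h1U[of 0] h(4,7) x by (auto simp: U_def)
    have yU: "y \<in> {a0<..<a1} \<union> {b0<..<b1}"
      using h1U[of S1] h(4,8) y by (auto simp: U_def)
    have h1W: "h1 t \<in> Wp" if "t \<in> {0..S1}" for t
    proof -
      have "\<not> fst (h1 t) < 0"
        using h(7,8) h(9)[of t] x y that by (cases "t = 0"; cases "t = S1") auto
      then show ?thesis using h1U[OF that] by (auto simp: U_def)
    qed
    have h2W: "h2 t \<in> Wm" if "t \<in> {0..S2}" for t
    proof -
      have "\<not> fst (h2 t) > 0"
        using h(11,12) h(13)[of t] x y that by (cases "t = 0"; cases "t = S2") auto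
      then show ?thesis using h2U[OF that] by (auto simp: U_def)
    qed
    have fxy: "f x = f y"
      using P.conserved[OF h(6) h1W, of S1] h(4,7,8) x y by auto
    have gxy: "g x = g y"
      using M.conserved[OF h(10) h2W, of S2] h(5,11,12) x y by auto
    have xW: "(0, x) \<in> Wp" "(0, y) \<in> Wp"
      using h1W[of 0] h1W[of S1] h(4,7,8) x y by auto
    \<comment> \<open>From the upper edge \<open>Fp\<close> points to the left, whereas
      \<open>h1\<close> must enter the right half-plane. The derivative at time 0 is
      one-sided.\<close>
    have xA: "x \<in> {a0<..<a1}"
    proof (rule ccontr)
      assume "x \<notin> {a0<..<a1}"
      then have "fst (Fp (h1 0)) < 0" using xU c xW P.above[of x] h(7) x by auto
      moreover have "((\<lambda>t. fst (h1 t)) has_real_derivative fst (Fp (h1 0))) (at 0 within {0..S1})"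
        using bounded_linear.has_vector_derivative[OF bounded_linear_fst solvesD[OF h(6)]] h(4)
        by (simp add: has_real_derivative_iff_has_vector_derivative)
      ultimately obtain d where d: "d > 0" "\<And>t. t > 0 \<Longrightarrow> 0 + t \<in> {0..S1} \<Longrightarrow> t < d \<Longrightarrow> fst (h1 0) > fst (h1 (0 + t))"
        using has_real_derivative_neg_dec_right[of "\<lambda>t. fst (h1 t)" _ 0 "{0..S1}"] by blast
      define t where "t = min (d/2) (S1/2)"
      have "t > 0" "t < d" "t < S1" using d(1) h(4) by (auto simp: t_def min_def)
      then show False using d(2)[of t] h(9)[of t] h(7) x by auto
    qed
    \<comment> \<open>On the lower edge \<open>f\<close> is strictly decreasing, so two different
      points there cannot share its value.\<close>
    have yB: "y \<in> {b0<..<b1}"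
    proof (rule ccontr)
      assume "y \<notin> {b0<..<b1}"
      then have "y \<in> {a0<..<a1}" using yU by auto
      then show False
        using xA c xW fxy h(1) x y P.E_line_decreasing[of x y] P.E_line_decreasing[of y x]
        by (cases x y rule: linorder_cases) auto
    qed
    have "x = a" "y = b" using uniq[OF xA yB fxy gxy] by auto
    have "h1 ` {0..S1} = g1 ` {0..T1}"
    proof (rule P.arc_unique[OF h(6,4) _ _ g1(2,1)])
      show "fst (h1 t) \<noteq> 0" if "t \<in> {0<..<S1}" for t using h(9)[OF that] by simp
      show "fst (g1 t) \<noteq> 0" if "t \<in> {0<..<T1}" for t using g1(5)[OF that] by simp
    qed (simp_all add: h(7,8) x y g1(3,4) \<open>x = a\<close>)
    moreover have "h2 ` {0..S2} = g2 ` {0..T2}"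
    proof (rule M.arc_unique[OF h(10,5) _ _ g2(2,1)])
      show "fst (h2 t) \<noteq> 0" if "t \<in> {0<..<S2}" for t using h(13)[OF that] by simp
      show "fst (g2 t) \<noteq> 0" if "t \<in> {0<..<T2}" for t using g2(5)[OF that] by simp
    qed (simp_all add: h(11,12) x y g2(3,4) \<open>y = b\<close>)
    ultimately show ?thesis using h(14) \<Gamma>_def by simp
  qed
  ultimately have "crossing_limit_cycle Fp Fm \<Gamma>"
    unfolding crossing_limit_cycle_def using orbit by blast
  then show ?thesis using that ab line by blast
qed

text \<open>The cycles are told apart by their upper crossing points, which lie in successive
  windows; \<open>cp\<close> separates these from all lower crossing points.\<close>

lemma three_limit_cycles:
  assumes box1: "limit_cycle_box a0 a1 b0 b1" and box2: "limit_cycle_box a0' a1' b0' b1'"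
    and box3: "limit_cycle_box a0'' a1'' b0'' b1''"
    and disjoint: "b1 \<le> b0'" "b1' \<le> b0''"
  shows "has_three_crossing_limit_cycles Fp Fm"
proof -
  obtain \<Gamma> a b where 1: "crossing_limit_cycle Fp Fm \<Gamma>" "a \<in> {a0<..<a1}" "b \<in> {b0<..<b1}"
    "\<And>y. (0, y) \<in> \<Gamma> \<longleftrightarrow> y = a \<or> y = b"
    using limit_cycle_in_box[OF box1] by blast
  obtain \<Gamma>' a' b' where 2: "crossing_limit_cycle Fp Fm \<Gamma>'" "a' \<in> {a0'<..<a1'}" "b' \<in> {b0'<..<b1'}"
    "\<And>y. (0, y) \<in> \<Gamma>' \<longleftrightarrow> y = a' \<or> y = b'"
    using limit_cycle_in_box[OF box2] by blast
  obtain \<Gamma>'' a'' b'' where 3: "crossing_limit_cycle Fp Fm \<Gamma>''" "a'' \<in> {a0''<..<a1''}" "b'' \<in> {b0''<..<b1''}"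
    "\<And>y. (0, y) \<in> \<Gamma>'' \<longleftrightarrow> y = a'' \<or> y = b''"
    using limit_cycle_in_box[OF box3] by blast
  have "a < cp" "a' < cp" "a'' < cp" "cp < b" "cp < b'" "cp < b''"
    using box1 box2 box3 1(2,3) 2(2,3) 3(2,3) unfolding limit_cycle_box_def by auto
  moreover have "b < b'" "b' < b''" using disjoint 1(3) 2(3) 3(3) by auto
  ultimately have "(0, b) \<notin> \<Gamma>'" "(0, b) \<notin> \<Gamma>''" "(0, b') \<notin> \<Gamma>''"
    unfolding 2(4) 3(4) by auto
  then have "\<Gamma> \<noteq> \<Gamma>'" "\<Gamma> \<noteq> \<Gamma>''" "\<Gamma>' \<noteq> \<Gamma>''"
    using 1(4)[of b] 2(4)[of b'] by auto
  then show ?thesis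
    unfolding has_three_crossing_limit_cycles_def using 1(1) 2(1) 3(1) by blast
qed

end

section \<open>Affine changes of variables\<close>

text \<open>A rotation with scaling, followed by a translation. The vertical line goes to the line
  through \<open>(c, \<gamma>)\<close> with direction \<open>(b, \<beta>)\<close>, and the first
  column of the linear part is this direction turned clockwise, so the determinant is the squared
  length of the direction.\<close>

definition affine_map :: "real \<Rightarrow> real \<Rightarrow> real \<Rightarrow> real \<Rightarrow> real \<times> real \<Rightarrow> real \<times> real" where
  "affine_map b \<beta> c \<gamma> p = (\<beta> * fst p + b * snd p + c, - b * fst p + \<beta> * snd p + \<gamma>)"

definition affine_pullback ::
  "real \<Rightarrow> real \<Rightarrow> real \<Rightarrow> real \<Rightarrow> (real \<times> real \<Rightarrow> real \<times> real) \<Rightarrow> real \<times> real \<Rightarrow> real \<times> real" where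
  "affine_pullback b \<beta> c \<gamma> S p = (let q = S (affine_map b \<beta> c \<gamma> p); d = b\<^sup>2 + \<beta>\<^sup>2
     in ((\<beta> * fst q - b * snd q) / d, (\<beta> * snd q + b * fst q) / d))"

lemma in_class_affine_pullback:
  assumes "b\<^sup>2 + \<beta>\<^sup>2 > 0" shows "in_class S (affine_pullback b \<beta> c \<gamma> S)"
  unfolding in_class_def
proof (intro exI conjI allI)
  \<comment> \<open>This goal fixes the entries left open by \<open>exI\<close>: a = \<beta> and
    \<alpha> = -b.\<close>
  show "b * (- b) - \<beta> * \<beta> \<noteq> 0" using assms by (simp add: power2_eq_square)
  fix x y
  show "let (u, v) = S (\<beta> * x + b * y + c, - b * x + \<beta> * y + \<gamma>); d = \<beta> * \<beta> - b * - b
    in affine_pullback b \<beta> c \<gamma> S (x, y) = ((\<beta> * u - b * v) / d, (\<beta> * v - (- b) * u) / d)"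
    by (simp add: affine_pullback_def affine_map_def Let_def split_beta power2_eq_square add.commute)
qed

locale affine_center = planar_center S W E \<mu> for S W E \<mu> +
  fixes b \<beta> c \<gamma> :: real
  assumes det_pos: "b\<^sup>2 + \<beta>\<^sup>2 > 0"
begin

abbreviation "\<phi> \<equiv> affine_map b \<beta> c \<gamma>"
abbreviation "F \<equiv> affine_pullback b \<beta> c \<gamma> S"

definition L :: "real \<times> real \<Rightarrow> real \<times> real" where
  "L v = (\<beta> * fst v + b * snd v, - b * fst v + \<beta> * snd v)"

definition \<psi> :: "real \<times> real \<Rightarrow> real \<times> real" where
  "\<psi> q = ((\<beta> * (fst q - c) - b * (snd q - \<gamma>)) / (b\<^sup>2 + \<beta>\<^sup>2), (b * (fst q - c) + \<beta> * (snd q - \<gamma>)) / (b\<^sup>2 + \<beta>\<^sup>2))"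

lemma det_ne: "b * b + \<beta> * \<beta> \<noteq> 0"
  using det_pos unfolding power2_eq_square by linarith

lemma \<phi>_deriv: "(\<phi> has_derivative L) (at p within A)"
proof -
  have "((\<lambda>p. (\<beta> * fst p + b * snd p + c, - b * fst p + \<beta> * snd p + \<gamma>)) has_derivative L) (at p within A)"
    unfolding L_def by (auto intro!: derivative_eq_intros)
  then show ?thesis by (simp add: affine_map_def[abs_def])
qed

lemma \<psi>_\<phi>: "\<psi> (\<phi> p) = p"
proof -
  have "\<beta> * (\<beta> * fst p + b * snd p) - b * (\<beta> * snd p - b * fst p) = fst p * (b * b + \<beta> * \<beta>)"
    "b * (\<beta> * fst p + b * snd p) + \<beta> * (\<beta> * snd p - b * fst p) = snd p * (b * b + \<beta> * \<beta>)"
    by (simp_all add: algebra_simps)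
  then show ?thesis
    using det_ne by (simp add: \<psi>_def affine_map_def prod_eq_iff power2_eq_square)
qed

lemma \<phi>_\<psi>: "\<phi> (\<psi> q) = q"
proof -
  define d where "d = b\<^sup>2 + \<beta>\<^sup>2"
  have d: "d > 0" "b\<^sup>2 + \<beta>\<^sup>2 = d" using det_pos by (simp_all add: d_def)
  define x y where "x = fst q - c" and "y = snd q - \<gamma>"
  have "\<beta> * ((\<beta> * x - b * y) / d) + b * ((b * x + \<beta> * y) / d) = (b\<^sup>2 + \<beta>\<^sup>2) * x / d"
    "- b * ((\<beta> * x - b * y) / d) + \<beta> * ((b * x + \<beta> * y) / d) = (b\<^sup>2 + \<beta>\<^sup>2) * y / d"
    using d(1) by (simp_all add: field_simps power2_eq_square)
  then show ?thesis
    using d by (simp add: \<psi>_def affine_map_def prod_eq_iff x_def y_def)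
qed

lemma L_F: "L (F p) = S (\<phi> p)"
proof -
  define d where "d = b\<^sup>2 + \<beta>\<^sup>2"
  have d: "d > 0" "b\<^sup>2 + \<beta>\<^sup>2 = d" using det_pos by (simp_all add: d_def)
  define x y where "x = fst (S (\<phi> p))" and "y = snd (S (\<phi> p))"
  have "\<beta> * ((\<beta> * x - b * y) / d) + b * ((\<beta> * y + b * x) / d) = (b\<^sup>2 + \<beta>\<^sup>2) * x / d"
    "- b * ((\<beta> * x - b * y) / d) + \<beta> * ((\<beta> * y + b * x) / d) = (b\<^sup>2 + \<beta>\<^sup>2) * y / d"
    using d(1) by (simp_all add: field_simps power2_eq_square)
  then show ?thesis
    using d by (simp add: L_def affine_pullback_def prod_eq_iff x_def y_def Let_def)
qed

lemma solves_\<phi>: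
  assumes "solves F g T" shows "solves S (\<lambda>t. \<phi> (g t)) T"
  unfolding solves_def
proof
  fix t assume t: "t \<in> {0..T}"
  have lin: "L (x *\<^sub>R v) = x *\<^sub>R L v" for x v by (simp add: L_def algebra_simps)
  have "((\<phi> \<circ> g) has_derivative (L \<circ> (\<lambda>x. x *\<^sub>R F (g t)))) (at t within {0..T})"
    using solvesD[OF assms t] \<phi>_deriv unfolding has_vector_derivative_def by (rule diff_chain_within)
  then show "((\<lambda>t. \<phi> (g t)) has_vector_derivative S (\<phi> (g t))) (at t within {0..T})"
    by (simp add: has_vector_derivative_def o_def lin L_F)
qed

text \<open>Orbits, uniqueness and the first integral are carried over by \<phi>. The form Y dx - X
  dy is a determinant of the field and a displacement, so it is multiplied by the determinant of
  \<open>L\<close>, which enters the integrating factor.\<close>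

sublocale pulled: planar_center F "\<phi> -` W" "\<lambda>p. E (\<phi> p)" "\<lambda>p. (b\<^sup>2 + \<beta>\<^sup>2) * \<mu> (\<phi> p)"
proof
  have "continuous_on UNIV \<phi>"
    by (rule has_derivative_continuous_on[where f' = "\<lambda>_. L"]) (rule \<phi>_deriv)
  with open_W show "open (\<phi> -` W)" by (rule open_vimage)
next
  fix g h T t
  assume a: "solves F g T" "solves F h T" "g 0 = h 0" "t \<in> {0..T}"
  then have "\<phi> (g t) = \<phi> (h t)"
    using unique[OF solves_\<phi>[OF a(1)] solves_\<phi>[OF a(2)]] by simp
  then show "g t = h t" by (metis \<psi>_\<phi>)
next
  fix p assume p: "p \<in> \<phi> -` W"
  then show "(b\<^sup>2 + \<beta>\<^sup>2) * \<mu> (\<phi> p) > 0" using mu_pos det_pos by simp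
  have "((E \<circ> \<phi>) has_derivative (\<lambda>v. \<mu> (\<phi> p) * (snd (S (\<phi> p)) * fst v - fst (S (\<phi> p)) * snd v)) \<circ> L) (at p)"
    using p by (intro diff_chain_at \<phi>_deriv E_deriv) simp
  moreover have "snd (S (\<phi> p)) * fst (L v) - fst (S (\<phi> p)) * snd (L v) =
      (b\<^sup>2 + \<beta>\<^sup>2) * (snd (F p) * fst v - fst (F p) * snd v)" for v
    unfolding L_F[symmetric] by (simp add: L_def power2_eq_square algebra_simps)
  ultimately show "((\<lambda>p. E (\<phi> p)) has_derivative
      (\<lambda>v. (b\<^sup>2 + \<beta>\<^sup>2) * \<mu> (\<phi> p) * (snd (F p) * fst v - fst (F p) * snd v))) (at p)"
    by (simp add: o_def mult.assoc mult.left_commute)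
  obtain \<delta> T where \<delta>: "T > 0" "\<delta> 0 = \<phi> p" "\<delta> T = \<phi> p"
    "\<And>t. (\<delta> has_vector_derivative S (\<delta> t)) (at t)" "\<And>t. \<delta> t \<in> W"
    using periodic[of "\<phi> p"] p by auto
  have "((\<lambda>t. \<psi> (\<delta> t)) has_vector_derivative F (\<psi> (\<delta> t))) (at t)" for t
  proof -
    \<comment> \<open>\<open>P\<close> is the derivative of \<psi>, that is, the inverse of
      \<open>L\<close>.\<close>
    define P where "P v = ((\<beta> * fst v - b * snd v) / (b\<^sup>2 + \<beta>\<^sup>2), (b * fst v + \<beta> * snd v) / (b\<^sup>2 + \<beta>\<^sup>2))" for v
    have "(\<psi> has_derivative P) (at q)" for q
      unfolding \<psi>_def[abs_def] P_def[abs_def] using det_pos by (auto intro!: derivative_eq_intros)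
    then have "((\<psi> \<circ> \<delta>) has_derivative (P \<circ> (\<lambda>x. x *\<^sub>R S (\<delta> t)))) (at t)"
      using \<delta>(4)[of t] unfolding has_vector_derivative_def by (intro diff_chain_at)
    moreover have "P (x *\<^sub>R S (\<delta> t)) = x *\<^sub>R F (\<psi> (\<delta> t))" for x
      by (simp add: P_def affine_pullback_def \<phi>_\<psi> Let_def algebra_simps add_divide_distrib diff_divide_distrib)
    ultimately show ?thesis by (simp add: has_vector_derivative_def o_def)
  qed
  then show "\<exists>\<delta> T. T > 0 \<and> \<delta> 0 = p \<and> \<delta> T = p \<and> (\<forall>t. (\<delta> has_vector_derivative F (\<delta> t)) (at t) \<and> \<delta> t \<in> \<phi> -` W)"
    using \<delta> by (intro exI[of _ "\<lambda>t. \<psi> (\<delta> t)"] exI[of _ T]) (simp add: \<psi>_\<phi> \<phi>_\<psi>)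
qed

lemma fst_F: "fst (F (0, y)) = (\<beta> * fst (S (b * y + c, \<beta> * y + \<gamma>)) - b * snd (S (b * y + c, \<beta> * y + \<gamma>))) / (b\<^sup>2 + \<beta>\<^sup>2)"
  by (simp add: affine_pullback_def affine_map_def Let_def)

lemma crossing_side_pulled:
  assumes "is_interval {y. (b * y + c, \<beta> * y + \<gamma>) \<in> W}"
    and "\<And>y. (b * y + c, \<beta> * y + \<gamma>) \<in> W \<Longrightarrow> y < r \<Longrightarrow>
      b * snd (S (b * y + c, \<beta> * y + \<gamma>)) - \<beta> * fst (S (b * y + c, \<beta> * y + \<gamma>)) < 0"
    and "\<And>y. (b * y + c, \<beta> * y + \<gamma>) \<in> W \<Longrightarrow> y > r \<Longrightarrow>
      b * snd (S (b * y + c, \<beta> * y + \<gamma>)) - \<beta> * fst (S (b * y + c, \<beta> * y + \<gamma>)) > 0"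
  shows "crossing_side F (\<phi> -` W) (\<lambda>p. E (\<phi> p)) (\<lambda>p. (b\<^sup>2 + \<beta>\<^sup>2) * \<mu> (\<phi> p)) r"
proof
  show "is_interval {y. (0, y) \<in> \<phi> -` W}" using assms(1) by (simp add: affine_map_def)
  fix y assume "(0, y) \<in> \<phi> -` W"
  then have y: "(b * y + c, \<beta> * y + \<gamma>) \<in> W" by (simp add: affine_map_def)
  show "fst (F (0, y)) > 0" if "y < r"
    unfolding fst_F using assms(2)[OF y that] det_pos by simp
  show "fst (F (0, y)) < 0" if "y > r"
    unfolding fst_F using assms(3)[OF y that] det_pos by (simp add: divide_neg_pos)
qed

end

text \<open>The left side of \<open>tangency\<close> is the determinant of the direction of the line
  and the field, a negative multiple of the first component of the pulled-back field. For cubic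
  fields it is a polynomial in \<open>y\<close> of degree at most three with the root
  \<open>r\<close>; positivity of the cofactor makes \<open>r\<close> the only tangency inside
  \<open>W\<close>.\<close>

locale line_side = affine_center +
  fixes r :: real and Q :: "real \<Rightarrow> real"
  assumes line_interval: "is_interval {y. (b * y + c, \<beta> * y + \<gamma>) \<in> W}"
    and tangency: "b * snd (S (b * y + c, \<beta> * y + \<gamma>)) - \<beta> * fst (S (b * y + c, \<beta> * y + \<gamma>)) = (y - r) * Q y"
    and Q_pos: "(b * y + c, \<beta> * y + \<gamma>) \<in> W \<Longrightarrow> Q y > 0"
begin

definition line_E :: "real \<Rightarrow> real" where "line_E y = E (b * y + c, \<beta> * y + \<gamma>)"
definition line_E' :: "real \<Rightarrow> real" where "line_E' y = \<mu> (b * y + c, \<beta> * y + \<gamma>) * ((y - r) * Q y)"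

sublocale crossing_side F "\<phi> -` W" "\<lambda>p. E (\<phi> p)" "\<lambda>p. (b\<^sup>2 + \<beta>\<^sup>2) * \<mu> (\<phi> p)" r
proof (rule crossing_side_pulled[OF line_interval])
  fix y assume y: "(b * y + c, \<beta> * y + \<gamma>) \<in> W"
  show "b * snd (S (b * y + c, \<beta> * y + \<gamma>)) - \<beta> * fst (S (b * y + c, \<beta> * y + \<gamma>)) < 0" if "y < r"
    unfolding tangency using Q_pos[OF y] that by (simp add: mult_neg_pos)
  show "b * snd (S (b * y + c, \<beta> * y + \<gamma>)) - \<beta> * fst (S (b * y + c, \<beta> * y + \<gamma>)) > 0" if "y > r"
    unfolding tangency using Q_pos[OF y] that by simp
qed

lemma line_E_eq: "E (\<phi> (0, y)) = line_E y"
  by (simp add: line_E_def affine_map_def)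

text \<open>The determinant in the integrating factor cancels the one in the inverse of the linear
  part, so \<open>line_E'\<close> contains neither.\<close>

lemma line_E'_eq: "- ((b\<^sup>2 + \<beta>\<^sup>2) * \<mu> (\<phi> (0, y))) * fst (F (0, y)) = line_E' y"
proof -
  have "fst (F (0, y)) = - ((y - r) * Q y) / (b\<^sup>2 + \<beta>\<^sup>2)"
    unfolding fst_F tangency[symmetric] by simp
  moreover have "- (d * m) * (- x / d) = m * x" if "d > 0" for d m x :: real
    using that by simp
  ultimately show ?thesis
    using det_pos by (simp only: line_E'_def affine_map_def fst_conv snd_conv) simp
qed

end

locale two_lines =
  P: line_side Sp Wp Ep \<mu>p bp \<beta>p cp \<gamma>p rp Qp + M: line_side Sm Wm Em \<mu>m bm \<beta>m cm \<gamma>m rm Qm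
  for Sp Wp Ep \<mu>p bp \<beta>p cp \<gamma>p rp Qp Sm Wm Em \<mu>m bm \<beta>m cm \<gamma>m rm Qm
begin

sublocale two_sides P.F "P.\<phi> -` Wp" "\<lambda>p. Ep (P.\<phi> p)" "\<lambda>p. (bp\<^sup>2 + \<beta>p\<^sup>2) * \<mu>p (P.\<phi> p)" rp
  M.F "M.\<phi> -` Wm" "\<lambda>p. Em (M.\<phi> p)" "\<lambda>p. (bm\<^sup>2 + \<beta>m\<^sup>2) * \<mu>m (M.\<phi> p)" rm ..

definition line_box :: "real \<Rightarrow> real \<Rightarrow> real \<Rightarrow> real \<Rightarrow> bool" where
  "line_box a0 a1 b0 b1 \<longleftrightarrow>
     (crossing_box P.line_E P.line_E' M.line_E M.line_E' a0 a1 b0 b1 \<or>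
      crossing_box M.line_E M.line_E' P.line_E P.line_E' a0 a1 b0 b1) \<and>
     a1 < rp \<and> a1 < rm \<and> rp < b0 \<and> rm < b0"

text \<open>The third box is the outermost, so every edge lies between \<open>a0''\<close> and
  \<open>b1''\<close>. Since the domains meet the line in intervals, four membership tests cover all
  three boxes.\<close>

theorem three_limit_cycles_on_lines:
  assumes box1: "line_box a0 a1 b0 b1" and box2: "line_box a0' a1' b0' b1'" and box3: "line_box a0'' a1'' b0'' b1''"
    and order: "a0'' \<le> a0'" "a0' \<le> a0" "b1 \<le> b0'" "b1' \<le> b0''"
    and W: "(bp * a0'' + cp, \<beta>p * a0'' + \<gamma>p) \<in> Wp" "(bp * b1'' + cp, \<beta>p * b1'' + \<gamma>p) \<in> Wp"
      "(bm * a0'' + cm, \<beta>m * a0'' + \<gamma>m) \<in> Wm" "(bm * b1'' + cm, \<beta>m * b1'' + \<gamma>m) \<in> Wm"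
  shows "\<exists>Fp Fm. in_class Sp Fp \<and> in_class Sm Fm \<and> has_three_crossing_limit_cycles Fp Fm"
proof -
  have W': "(0, a0'') \<in> P.\<phi> -` Wp" "(0, b1'') \<in> P.\<phi> -` Wp" "(0, a0'') \<in> M.\<phi> -` Wm" "(0, b1'') \<in> M.\<phi> -` Wm"
    using W by (simp_all add: affine_map_def)
  have inW: "(0, y) \<in> P.\<phi> -` Wp" "(0, y) \<in> M.\<phi> -` Wm" if "a0'' \<le> y" "y \<le> b1''" for y
    using P.between_W[OF W'(1,2) that] M.between_W[OF W'(3,4) that] .
  have *: "limit_cycle_box x0 x1 y0 y1" if "line_box x0 x1 y0 y1" "a0'' \<le> x0" "y1 \<le> b1''" for x0 x1 y0 y1
  proof -
    have "x0 < x1" "y0 < y1" "x1 < rp" "rp < y0"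
      using that(1) unfolding line_box_def crossing_box_def by blast+
    then have "a0'' \<le> y1" "x0 \<le> b1''" using that(2,3) by linarith+
    then show ?thesis
      using that inW unfolding limit_cycle_box_def line_box_def
        P.line_E_eq P.line_E'_eq M.line_E_eq M.line_E'_eq by blast
  qed
  have "b0' < b1'" "b0'' < b1''"
    using box2 box3 unfolding line_box_def crossing_box_def by blast+
  then have "limit_cycle_box a0 a1 b0 b1" "limit_cycle_box a0' a1' b0' b1'" "limit_cycle_box a0'' a1'' b0'' b1''"
    using order by (auto intro!: * box1 box2 box3)
  then have "has_three_crossing_limit_cycles P.F M.F"
    using three_limit_cycles order(3,4) by blast
  then show ?thesis
    using in_class_affine_pullback P.det_pos M.det_pos by blast
qed

end

section \<open>The four isochronous centers\<close>

lemma pair_has_vector_derivative: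
  fixes x y :: "real \<Rightarrow> real"
  assumes "(x has_real_derivative u) (at t)" "(y has_real_derivative v) (at t)"
  shows "((\<lambda>t. (x t, y t)) has_vector_derivative (u, v)) (at t)"
  using has_vector_derivative_Pair assms unfolding has_real_derivative_iff_has_vector_derivative .

lemma polynomial_field_unique:
  assumes "lipschitz_on_balls (\<lambda>p. fst (S p))" "lipschitz_on_balls (\<lambda>p. snd (S p))"
    and "solves S g T" "solves S h T" "g 0 = h 0" "t \<in> {0..T}"
  shows "g t = h t"
proof -
  have "lipschitz_on_balls S" using lipschitz_on_balls_Pair[OF assms(1,2)] by simp
  then show ?thesis using solves_unique assms(3-) by blast
qed

section \<open>The center \<open>S1\<close>\<close>

definition W1 :: "(real \<times> real) set" where "W1 = {p. (fst p - snd p)\<^sup>2 < 1}"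
definition E1 :: "real \<times> real \<Rightarrow> real" where
  "E1 p = ((fst p)\<^sup>2 + (snd p)\<^sup>2) / (1 + 2 * fst p * snd p)"
definition \<mu>1 :: "real \<times> real \<Rightarrow> real" where "\<mu>1 p = 2 / (1 + 2 * fst p * snd p)\<^sup>2"

lemma W1_pos: "p \<in> W1 \<Longrightarrow> 1 + 2 * fst p * snd p > 0"
  using sum_power2_ge_zero[of "fst p" "snd p"] unfolding W1_def power2_diff mem_Collect_eq by linarith

text \<open>\<open>S1\<close> is the rotation field plus the radial field (x^2 - y^2) (x, y), so the
  angular speed is 1. The vector (x, y) / sqrt(1 + 2 x y) turns rigidly, and solving this for the
  point gives \<open>(A t, B t)\<close> divided by the square root of \<open>q t\<close>.\<close>

lemma S1_periodic:
  assumes "p \<in> W1"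
  shows "\<exists>\<gamma> T. T > 0 \<and> \<gamma> 0 = p \<and> \<gamma> T = p \<and> (\<forall>t. (\<gamma> has_vector_derivative S1 (\<gamma> t)) (at t) \<and> \<gamma> t \<in> W1)"
proof -
  obtain x y where p: "p = (x, y)" by (cases p)
  have xy: "(x - y)\<^sup>2 < 1" using assms by (simp add: p W1_def)
  define A where "A t = x * cos t - y * sin t" for t
  define B where "B t = x * sin t + y * cos t" for t
  define q where "q t = 1 + 2 * x * y - 2 * A t * B t" for t
  define \<gamma> where "\<gamma> t = (A t / sqrt (q t), B t / sqrt (q t))" for t
  have "(A t)\<^sup>2 + (B t)\<^sup>2 = (x\<^sup>2 + y\<^sup>2) * ((sin t)\<^sup>2 + (cos t)\<^sup>2)" for t
    unfolding A_def B_def by algebra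
  then have AB: "(A t)\<^sup>2 + (B t)\<^sup>2 = x\<^sup>2 + y\<^sup>2" for t by simp
  \<comment> \<open>This form explains \<open>W1\<close>: the condition (x - y)^2 < 1 keeps
    \<open>q\<close> positive during the whole turn. Equivalently, \<open>E1\<close> is less than
    1.\<close>
  have q: "q t = (A t - B t)\<^sup>2 + (1 - (x - y)\<^sup>2)" for t
    using AB[of t] by (simp add: q_def power2_diff algebra_simps)
  have q_pos: "q t > 0" for t
    using xy q[of t] zero_le_power2[of "A t - B t"] by linarith
  have dA: "(A has_real_derivative - B t) (at t)" and dB: "(B has_real_derivative A t) (at t)" for t
    unfolding A_def B_def by (auto intro!: derivative_eq_intros)
  have dq: "(q has_real_derivative - 2 * ((A t)\<^sup>2 - (B t)\<^sup>2)) (at t)" for t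
    unfolding q_def
    by (auto intro!: derivative_eq_intros dA dB simp: power2_eq_square algebra_simps)
  have ode: "(\<gamma> has_vector_derivative S1 (\<gamma> t)) (at t)" for t
  proof -
    define s where "s = sqrt (q t)"
    have s: "s > 0" "q t = s\<^sup>2" "sqrt (q t) = s" using q_pos[of t] by (simp_all add: s_def)
    have ds: "((\<lambda>t. sqrt (q t)) has_real_derivative - ((A t)\<^sup>2 - (B t)\<^sup>2) / s) (at t)"
      using dq[of t] q_pos[of t] s by (auto intro!: derivative_eq_intros simp: field_simps)
    have 1: "((\<lambda>t. A t / sqrt (q t)) has_real_derivative fst (S1 (\<gamma> t))) (at t)"
      by (rule DERIV_cong[OF DERIV_divide[OF dA ds]])
        (use s(1) in \<open>simp_all add: S1_def \<gamma>_def s(3) field_simps power2_eq_square power3_eq_cube\<close>)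
    have 2: "((\<lambda>t. B t / sqrt (q t)) has_real_derivative snd (S1 (\<gamma> t))) (at t)"
      by (rule DERIV_cong[OF DERIV_divide[OF dB ds]])
        (use s(1) in \<open>simp_all add: S1_def \<gamma>_def s(3) field_simps power2_eq_square power3_eq_cube\<close>)
    show ?thesis
      using pair_has_vector_derivative[OF 1 2] by (simp add: \<gamma>_def[abs_def])
  qed
  have W: "\<gamma> t \<in> W1" for t
  proof -
    have "(A t / sqrt (q t) - B t / sqrt (q t))\<^sup>2 = (A t - B t)\<^sup>2 / q t"
      using q_pos[of t] by (simp add: diff_divide_distrib[symmetric] power_divide)
    also have "\<dots> < 1"
      using q_pos[of t] q[of t] xy by simp
    finally show ?thesis by (simp add: W1_def \<gamma>_def)
  qed
  have "\<gamma> 0 = p" "\<gamma> (2 * pi) = p"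
    by (simp_all add: \<gamma>_def A_def B_def q_def p)
  then show ?thesis
    using ode W by (intro exI[of _ \<gamma>] exI[of _ "2 * pi"]) simp
qed

interpretation S1: planar_center S1 W1 E1 \<mu>1
proof
  show "open W1" unfolding W1_def by (intro open_Collect_less continuous_intros)
next
  fix g h T t assume "solves S1 g T" "solves S1 h T" "g 0 = h 0" "t \<in> {0..T}"
  then show "g t = h t"
    by (rule polynomial_field_unique[rotated 2])
      (simp_all add: S1_def split_beta, (intro lipschitz_on_balls_intros)+)
next
  fix p assume p: "p \<in> W1"
  define x y where "x = fst p" and "y = snd p"
  have pos: "1 + 2 * x * y > 0" using W1_pos[OF p] by (simp add: x_def y_def)
  then show "\<mu>1 p > 0" by (simp add: \<mu>1_def x_def y_def)
  show "(E1 has_derivative (\<lambda>v. \<mu>1 p * (snd (S1 p) * fst v - fst (S1 p) * snd v))) (at p)"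
    unfolding E1_def[abs_def]
    by (rule has_derivative_eq_rhs, (rule derivative_intros)+)
      (use pos in \<open>auto simp: S1_def \<mu>1_def split_beta x_def y_def fun_eq_iff field_simps power2_eq_square power3_eq_cube\<close>)
  show "\<exists>\<gamma> T. T > 0 \<and> \<gamma> 0 = p \<and> \<gamma> T = p \<and> (\<forall>t. (\<gamma> has_vector_derivative S1 (\<gamma> t)) (at t) \<and> \<gamma> t \<in> W1)"
    using S1_periodic[OF p] .
qed

section \<open>The center \<open>S2\<close> as a holomorphic differential equation\<close>

definition W2 :: "(real \<times> real) set" where "W2 = {p. 1 + 4 * fst p * snd p > 0 \<and> p \<noteq> 0}"
definition E2 :: "real \<times> real \<Rightarrow> real" where
  "E2 p = ((fst p)\<^sup>2 + (snd p)\<^sup>2)\<^sup>2 / (1 + 4 * fst p * snd p)"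
text \<open>This factor vanishes at the origin, where \<open>E2\<close> is of fourth order; that is
  why \<open>W2\<close> omits the center itself.\<close>

definition \<mu>2 :: "real \<times> real \<Rightarrow> real" where
  "\<mu>2 p = 4 * ((fst p)\<^sup>2 + (snd p)\<^sup>2) / (1 + 4 * fst p * snd p)\<^sup>2"

lemma S2_complex: "S2 (Re z, Im z) = (Re (\<i> * z + z ^ 3), Im (\<i> * z + z ^ 3))"
  by (simp add: S2_def power3_eq_cube power2_eq_square algebra_simps)

text \<open>With k = i z^2 / (1 - i z^2), the domain is 0 < |k| < 1, and \<open>E2\<close> is |k|^2
  / (1 - |k|^2).\<close>

lemma W2_complex: "(Re z, Im z) \<in> W2 \<longleftrightarrow> cmod (z\<^sup>2) < cmod (1 - \<i> * z\<^sup>2) \<and> z \<noteq> 0"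
proof -
  have "(cmod (1 - \<i> * z\<^sup>2))\<^sup>2 - (cmod (z\<^sup>2))\<^sup>2 = 1 + 4 * Re z * Im z"
    unfolding cmod_power2 by (simp add: power2_eq_square algebra_simps)
  moreover have "cmod (z\<^sup>2) < cmod (1 - \<i> * z\<^sup>2) \<longleftrightarrow> (cmod (z\<^sup>2))\<^sup>2 < (cmod (1 - \<i> * z\<^sup>2))\<^sup>2"
    by (metis norm_ge_zero power_mono_iff pos2 not_le)
  ultimately show ?thesis
    by (auto simp: W2_def complex_eq_iff zero_prod_def)
qed

text \<open>In complex form the system is z' = i z + z^3. The coordinate k = i z^2 / (1 - i z^2)
  satisfies k' = 2 i k, so it rotates, and z is recovered as a square root of -i k / (1 +
  k).\<close>

lemma S2_periodic:
  assumes "p \<in> W2"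
  shows "\<exists>\<gamma> T. T > 0 \<and> \<gamma> 0 = p \<and> \<gamma> T = p \<and> (\<forall>t. (\<gamma> has_vector_derivative S2 (\<gamma> t)) (at t) \<and> \<gamma> t \<in> W2)"
proof -
  define z0 where "z0 = Complex (fst p) (snd p)"
  have p: "p = (Re z0, Im z0)" by (simp add: z0_def)
  have z0: "cmod (z0\<^sup>2) < cmod (1 - \<i> * z0\<^sup>2)" "z0 \<noteq> 0"
    using assms unfolding p W2_complex by auto
  have ne: "1 - \<i> * z0\<^sup>2 \<noteq> 0" using z0(1) by (metis norm_ge_zero norm_zero not_le)
  define k where "k = \<i> * z0\<^sup>2 / (1 - \<i> * z0\<^sup>2)"
  have k1: "1 + k = 1 / (1 - \<i> * z0\<^sup>2)" using ne by (simp add: k_def field_simps)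
  have kz: "z0\<^sup>2 * (1 + k) = - \<i> * k" unfolding k1 by (simp add: k_def)
  have k: "cmod k < 1"
    using z0(1) ne by (simp add: k_def norm_mult norm_divide)
  \<comment> \<open>The value of 1 + k at time \<open>w\<close>, taken for complex \<open>w\<close>
    so that complex differentiation applies.\<close>
  define e where "e w = 1 + k * exp (2 * \<i> * w)" for w :: complex
  have Re_e: "Re (e (of_real t)) > 0" for t
  proof -
    have "cmod (exp (2 * \<i> * of_real t)) = 1" by (simp add: norm_exp_eq_Re)
    then have "cmod (k * exp (2 * \<i> * of_real t)) < 1" using k by (simp add: norm_mult)
    then show ?thesis
      using abs_Re_le_cmod[of "k * exp (2 * \<i> * of_real t)"] by (simp add: e_def)
  qed
  have e_ne: "e (of_real t) \<noteq> 0" for t using Re_e[of t] by auto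
  define Z where "Z w = z0 * csqrt (1 + k) * exp (\<i> * w) / csqrt (e w)" for w
  define z where "z t = Z (of_real t)" for t :: real
  have z2: "(z t)\<^sup>2 = - \<i> * (e (of_real t) - 1) / e (of_real t)" for t
  proof -
    have "(z t)\<^sup>2 = z0\<^sup>2 * (1 + k) * (exp (\<i> * of_real t))\<^sup>2 / e (of_real t)"
      by (simp add: z_def Z_def power_mult_distrib power_divide)
    moreover have "(exp (\<i> * of_real t))\<^sup>2 = exp (2 * \<i> * complex_of_real t)"
      by (simp add: exp_double[symmetric] mult.assoc)
    ultimately show ?thesis by (simp add: kz e_def mult.assoc)
  qed
  have e0: "e 0 = 1 + k" by (simp add: e_def)
  have "1 + k \<noteq> 0" using ne by (simp add: k1)
  then have z_0: "z 0 = z0" by (simp add: z_def Z_def e0)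
  have dz: "(z has_vector_derivative (\<i> * z t + z t ^ 3)) (at t)" for t
  proof -
    have de: "(e has_field_derivative 2 * \<i> * (e w - 1)) (at w)" for w
      unfolding e_def by (auto intro!: derivative_eq_intros)
    \<comment> \<open>Because |k| < 1, \<open>e\<close> stays in the right half-plane and never
      meets the branch cut of \<open>csqrt\<close>.\<close>
    have nonpos: "e (of_real t) \<notin> \<real>\<^sub>\<le>\<^sub>0"
      using Re_e[of t] by (auto simp: complex_nonpos_Reals_iff)
    have ds: "((\<lambda>w. csqrt (e w)) has_field_derivative \<i> * (e (of_real t) - 1) / csqrt (e (of_real t))) (at (of_real t))"
    proof -
      have "inverse (2 * c) * (2 * \<i> * (x - 1)) = \<i> * (x - 1) / c" for c x :: complex
        by (cases "c = 0") (simp_all add: field_simps)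
      then show ?thesis
        using DERIV_chain2[OF has_field_derivative_csqrt[OF nonpos] de[of "of_real t"]] by simp
    qed
    define s where "s = csqrt (e (of_real t))"
    have s: "s \<noteq> 0" "e (of_real t) = s\<^sup>2" using e_ne[of t] by (simp_all add: s_def)
    \<comment> \<open>The logarithmic derivative of \<open>Z\<close> is i - e' / (2 e) = i - i (e -
      1) / e, which equals i + z^2 by \<open>z2\<close>.\<close>
    have "(Z has_field_derivative Z (of_real t) * (\<i> - \<i> * (e (of_real t) - 1) / e (of_real t))) (at (of_real t))"
      unfolding Z_def
    proof (rule DERIV_cong[OF DERIV_divide[OF _ ds]])
      show "((\<lambda>w. z0 * csqrt (1 + k) * exp (\<i> * w)) has_field_derivative
          z0 * csqrt (1 + k) * (exp (\<i> * of_real t) * \<i>)) (at (of_real t))"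
        by (auto intro!: derivative_eq_intros)
      have "(a * (x * \<i>) * s - a * x * (\<i> * (s\<^sup>2 - 1) / s)) / (s * s) = a * x / s * (\<i> - \<i> * (s\<^sup>2 - 1) / s\<^sup>2)" for a x
        using s(1) by (simp add: field_simps power2_eq_square)
      then show "(z0 * csqrt (1 + k) * (exp (\<i> * of_real t) * \<i>) * csqrt (e (of_real t)) -
          z0 * csqrt (1 + k) * exp (\<i> * of_real t) * (\<i> * (e (of_real t) - 1) / csqrt (e (of_real t)))) /
          (csqrt (e (of_real t)) * csqrt (e (of_real t))) =
          z0 * csqrt (1 + k) * exp (\<i> * of_real t) / csqrt (e (of_real t)) * (\<i> - \<i> * (e (of_real t) - 1) / e (of_real t))"
        unfolding s_def[symmetric] unfolding s(2) by simp
    qed (use e_ne[of t] in simp)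
    moreover have "Z (of_real t) * (\<i> - \<i> * (e (of_real t) - 1) / e (of_real t)) = \<i> * z t + z t * (z t)\<^sup>2"
      unfolding z2 z_def[symmetric] using e_ne[of t] by (simp add: field_simps)
    ultimately have "(Z has_field_derivative \<i> * z t + z t ^ 3) (at (of_real t))"
      by (simp add: power3_eq_cube power2_eq_square mult.assoc)
    then show ?thesis
      unfolding z_def[abs_def] using has_vector_derivative_real_field by blast
  qed
  define \<gamma> where "\<gamma> t = (Re (z t), Im (z t))" for t
  have ode: "(\<gamma> has_vector_derivative S2 (\<gamma> t)) (at t)" for t
    unfolding \<gamma>_def S2_complex
    by (intro has_vector_derivative_Pair bounded_linear.has_vector_derivative[OF bounded_linear_Re]
        bounded_linear.has_vector_derivative[OF bounded_linear_Im] dz)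
  have W: "\<gamma> t \<in> W2" for t
  proof -
    have "1 - \<i> * (z t)\<^sup>2 = 1 / e (of_real t)"
      unfolding z2 using e_ne[of t] by (simp add: field_simps)
    moreover have "cmod ((z t)\<^sup>2) = cmod k / cmod (e (of_real t))"
      unfolding z2 by (simp add: e_def norm_mult norm_divide norm_exp_eq_Re)
    moreover have "cmod k / cmod (e (of_real t)) < 1 / cmod (e (of_real t))"
      using k e_ne[of t] by (intro divide_strict_right_mono) auto
    moreover have "z t \<noteq> 0" using z0 e_ne[of t] \<open>1 + k \<noteq> 0\<close> by (simp add: z_def Z_def)
    ultimately show ?thesis unfolding \<gamma>_def W2_complex by (simp add: norm_divide)
  qed
  have "z (2 * pi) = z 0"
  proof -
    have "exp (2 * \<i> * complex_of_real (2 * pi)) = exp (\<i> * complex_of_real (2 * pi)) ^ 2"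
      by (simp add: exp_double[symmetric] mult.assoc)
    moreover have "exp (\<i> * complex_of_real (2 * pi)) = 1"
      by (metis cis_2pi cis_conv_exp)
    ultimately show ?thesis by (simp add: z_def Z_def e_def)
  qed
  then have "\<gamma> 0 = p" "\<gamma> (2 * pi) = p" by (simp_all add: \<gamma>_def z_0 p)
  then show ?thesis
    using ode W by (intro exI[of _ \<gamma>] exI[of _ "2 * pi"]) simp
qed

interpretation S2: planar_center S2 W2 E2 \<mu>2
proof
  have eq: "W2 = {p. 1 + 4 * fst p * snd p > 0} \<inter> - {0}" by (auto simp: W2_def)
  show "open W2"
    unfolding eq by (intro open_Int open_Collect_less continuous_intros open_Compl closed_singleton)
next
  fix g h T t assume "solves S2 g T" "solves S2 h T" "g 0 = h 0" "t \<in> {0..T}"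
  then show "g t = h t"
    by (rule polynomial_field_unique[rotated 2])
      (simp_all add: S2_def split_beta, (intro lipschitz_on_balls_intros)+)
next
  fix p assume p: "p \<in> W2"
  define x y where "x = fst p" and "y = snd p"
  have pos: "1 + 4 * x * y > 0" using p by (simp add: x_def y_def W2_def)
  have "x\<^sup>2 + y\<^sup>2 > 0"
    using p by (auto simp: W2_def x_def y_def sum_power2_gt_zero_iff prod_eq_iff)
  with pos show "\<mu>2 p > 0" by (simp add: \<mu>2_def x_def y_def)
  show "(E2 has_derivative (\<lambda>v. \<mu>2 p * (snd (S2 p) * fst v - fst (S2 p) * snd v))) (at p)"
    unfolding E2_def[abs_def]
    by (rule has_derivative_eq_rhs, (rule derivative_intros)+)
      (use pos in \<open>auto simp: S2_def \<mu>2_def split_beta x_def y_def fun_eq_iff field_simps power2_eq_square power3_eq_cube\<close>)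
  show "\<exists>\<gamma> T. T > 0 \<and> \<gamma> 0 = p \<and> \<gamma> T = p \<and> (\<forall>t. (\<gamma> has_vector_derivative S2 (\<gamma> t)) (at t) \<and> \<gamma> t \<in> W2)"
    using S2_periodic[OF p] .
qed

section \<open>The centers \<open>S3\<close> and \<open>S4\<close>, with e = 1 and e = -1\<close>

definition S34 :: "real \<Rightarrow> real \<times> real \<Rightarrow> real \<times> real" where
  "S34 e p = (- snd p + 3 * e * (fst p)\<^sup>2 * snd p, fst p - 2 * e * (fst p)^3 + 9 * e * fst p * (snd p)\<^sup>2)"

lemma S3_eq: "S3 = S34 1" and S4_eq: "S4 = S34 (-1)"
  by (auto simp: S3_def S4_def S34_def)

definition E34 :: "real \<Rightarrow> real \<times> real \<Rightarrow> real" where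
  "E34 e p = (27 * (snd p)\<^sup>2 - 9 * (fst p)\<^sup>2 + 4 * e) / (1 - 3 * e * (fst p)\<^sup>2)^3"
definition \<mu>34 :: "real \<Rightarrow> real \<times> real \<Rightarrow> real" where
  "\<mu>34 e p = 54 / (1 - 3 * e * (fst p)\<^sup>2)^4"
text \<open>For e = -1 the second condition says that \<open>E34 e p\<close> is negative. In the
  linearising coordinates this is the disc 27 (u^2 + v^2) < 4, on which the cubic \<xi> - \<xi>^3 =
  u can be solved for \<xi> on its increasing branch.\<close>

definition W34 :: "real \<Rightarrow> (real \<times> real) set" where
  "W34 e = {p. 1 - 3 * e * (fst p)\<^sup>2 > 0 \<and> (e = 1 \<or> 27 * (snd p)\<^sup>2 < 9 * (fst p)\<^sup>2 + 4)}"

text \<open>Four times the difference quotient is 4 + 4 e (x^2 + x y + y^2). For negative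
  \<open>e\<close> the estimate 4 (x^2 + x y + y^2) \<le> 6 x^2 + 6 y^2 bounds it below by 2 (1 + 3
  e x^2) + 2 (1 + 3 e y^2).\<close>

lemma cubic_increasing:
  fixes e x y :: real
  assumes "x < y" "1 + 3 * e * x\<^sup>2 > 0" "1 + 3 * e * y\<^sup>2 > 0"
  shows "x + e * x^3 < y + e * y^3"
proof -
  have "4 * ((y + e * y^3) - (x + e * x^3)) = (y - x) * (4 + 4 * e * (x\<^sup>2 + x * y + y\<^sup>2))"
    by (simp add: algebra_simps power2_eq_square power3_eq_cube)
  moreover have "4 + 4 * e * (x\<^sup>2 + x * y + y\<^sup>2) > 0"
  proof (cases "e \<ge> 0")
    case True
    have "x\<^sup>2 + x * y + y\<^sup>2 = (x + y / 2)\<^sup>2 + 3 * (y / 2)\<^sup>2"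
      by (simp add: power2_eq_square field_simps)
    then have "x\<^sup>2 + x * y + y\<^sup>2 \<ge> 0" by (simp only:) simp
    then have "e * (x\<^sup>2 + x * y + y\<^sup>2) \<ge> 0" using True by simp
    then show ?thesis by (simp add: mult.assoc)
  next
    case False
    have "4 * (x\<^sup>2 + x * y + y\<^sup>2) = 6 * x\<^sup>2 + 6 * y\<^sup>2 - 2 * (x - y)\<^sup>2"
      by (simp add: power2_eq_square algebra_simps)
    then have "4 * (x\<^sup>2 + x * y + y\<^sup>2) \<le> 6 * x\<^sup>2 + 6 * y\<^sup>2" by simp
    then have "e * (4 * (x\<^sup>2 + x * y + y\<^sup>2)) \<ge> e * (6 * x\<^sup>2 + 6 * y\<^sup>2)"
      using False by (intro mult_left_mono_neg) auto
    then show ?thesis using assms(2,3) by (simp add: algebra_simps)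
  qed
  ultimately show ?thesis
    using assms(1) by (smt (verit) mult_pos_pos)
qed

text \<open>For e = -1 the critical points of x - x^3 are r and -r with 3 r^2 = 1, and the critical
  values are 2 r / 3 and its negative; 27 u^2 < 4 says that \<open>u\<close> lies strictly between
  them.\<close>

lemma cubic_surj:
  fixes e u :: real
  assumes "e = 1 \<or> e = -1 \<and> 27 * u\<^sup>2 < 4"
  shows "\<exists>x. 1 + 3 * e * x\<^sup>2 > 0 \<and> x + e * x^3 = u"
  using assms
proof
  assume e: "e = 1"
  have "\<exists>x\<ge>- \<bar>u\<bar>. x \<le> \<bar>u\<bar> \<and> x + x^3 = u"
  proof (rule IVT')
    have "0 \<le> \<bar>u\<bar>^3" "(- \<bar>u\<bar>)^3 = - (\<bar>u\<bar>^3)" by simp_all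
    then show "- \<bar>u\<bar> + (- \<bar>u\<bar>)^3 \<le> u" "u \<le> \<bar>u\<bar> + \<bar>u\<bar>^3" by linarith+
  qed (auto intro!: continuous_intros)
  then obtain x where "x + x^3 = u" by blast
  moreover have "1 + 3 * x\<^sup>2 > 0" by (simp add: add_pos_nonneg)
  ultimately show ?thesis using e by auto
next
  assume e: "e = -1 \<and> 27 * u\<^sup>2 < 4"
  define r where "r = 1 / sqrt 3"
  have r: "r > 0" "3 * r\<^sup>2 = 1" by (simp_all add: r_def power_divide)
  have r3: "r - r^3 = 2 * r / 3" using r(2) by (simp add: power3_eq_cube power2_eq_square algebra_simps)
  have "27 * u\<^sup>2 < 27 * (2 * r / 3)\<^sup>2" using e r(2) by (simp add: power_divide power_mult_distrib)
  then have "u\<^sup>2 < (2 * r / 3)\<^sup>2" by simp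
  then have u: "\<bar>u\<bar> < 2 * r / 3"
    using r(1) by (intro power2_less_imp_less[of "\<bar>u\<bar>"]) simp_all
  have "\<exists>x\<ge>- r. x \<le> r \<and> x - x^3 = u"
  proof (rule IVT')
    show "- r - (- r)^3 \<le> u" "u \<le> r - r^3" using u r3 by auto
  qed (use r in \<open>auto intro!: continuous_intros\<close>)
  then obtain x where x: "- r \<le> x" "x \<le> r" "x - x^3 = u" by blast
  have "x \<noteq> r"
  proof
    assume "x = r"
    then have "u = 2 * r / 3" using x(3) r3 by metis
    then show False using u by linarith
  qed
  moreover have "x \<noteq> - r"
  proof
    assume "x = - r"
    then have "u = - (r - r^3)" using x(3) by simp
    then show False using u unfolding r3 by linarith
  qed
  ultimately have "\<bar>x\<bar> < r" using x by auto
  then have "x\<^sup>2 < r\<^sup>2" using power_strict_mono[of "\<bar>x\<bar>" r 2] by simp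
  then show ?thesis using e x r(2) by (intro exI[of _ x]) auto
qed

text \<open>The branch condition, positivity of the derivative of the cubic, makes the chosen point
  unique.\<close>

definition cubic_inv :: "real \<Rightarrow> real \<Rightarrow> real" where
  "cubic_inv e u = (SOME x. 1 + 3 * e * x\<^sup>2 > 0 \<and> x + e * x^3 = u)"

lemma cubic_inv:
  assumes "e = 1 \<or> e = -1 \<and> 27 * u\<^sup>2 < 4"
  shows "1 + 3 * e * (cubic_inv e u)\<^sup>2 > 0" "cubic_inv e u + e * (cubic_inv e u)^3 = u"
  using someI_ex[OF cubic_surj[OF assms]] by (simp_all add: cubic_inv_def)

lemma cubic_inv_eq:
  assumes "1 + 3 * e * x\<^sup>2 > 0" shows "cubic_inv e (x + e * x^3) = x"
proof -
  have "1 + 3 * e * (cubic_inv e (x + e * x^3))\<^sup>2 > 0 \<and>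
      cubic_inv e (x + e * x^3) + e * (cubic_inv e (x + e * x^3))^3 = x + e * x^3"
    unfolding cubic_inv_def by (rule someI[of _ x]) (use assms in simp)
  then show ?thesis
    using cubic_increasing[of x "cubic_inv e (x + e * x^3)" e] cubic_increasing[of "cubic_inv e (x + e * x^3)" x e] assms
    by (cases x "cubic_inv e (x + e * x^3)" rule: linorder_cases) auto
qed

lemma cubic_inv_deriv:
  assumes u: "e = 1 \<or> e = -1 \<and> 27 * u\<^sup>2 < 4"
  shows "(cubic_inv e has_real_derivative 1 / (1 + 3 * e * (cubic_inv e u)\<^sup>2)) (at u)"
proof -
  define x where "x = cubic_inv e u"
  define h where "h x = x + e * x^3" for x
  have x: "1 + 3 * e * x\<^sup>2 > 0" "h x = u" using cubic_inv[OF u] by (simp_all add: x_def h_def)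
  have dh: "(h has_real_derivative 1 + 3 * e * y\<^sup>2) (at y)" for y
    unfolding h_def by (auto intro!: derivative_eq_intros)
  have "open {y. 1 + 3 * e * y\<^sup>2 > 0}" by (intro open_Collect_less continuous_intros)
  then obtain d where d: "d > 0" "\<And>y. dist y x < d \<Longrightarrow> 1 + 3 * e * y\<^sup>2 > 0"
    using x(1) unfolding open_dist by blast
  have near: "1 + 3 * e * z\<^sup>2 > 0" if "\<bar>z - x\<bar> \<le> d / 2" for z
    using that d(1) by (intro d(2)) (simp add: dist_real_def)
  have "isCont (cubic_inv e) (h x)"
  proof (rule isCont_inverse_function[of "d / 2" x])
    show "cubic_inv e (h z) = z" if "\<bar>z - x\<bar> \<le> d / 2" for z
      using cubic_inv_eq[OF near[OF that]] by (simp add: h_def)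
    show "isCont h z" for z using dh DERIV_isCont by blast
  qed (use d in simp)
  moreover have "open {u :: real. e = 1 \<or> e = -1 \<and> 27 * u\<^sup>2 < 4}"
  proof (cases "e = 1 \<or> e \<noteq> -1")
    case False
    then show ?thesis by (simp) (intro open_Collect_less continuous_intros)
  qed auto
  then obtain r where r: "r > 0" "\<And>v. dist v u < r \<Longrightarrow> e = 1 \<or> e = -1 \<and> 27 * v\<^sup>2 < 4"
    using u unfolding open_dist by blast
  have inv: "h (cubic_inv e v) = v" if "u - r < v" "v < u + r" for v
    using cubic_inv(2)[OF r(2)[of v]] that by (simp add: h_def dist_real_def abs_less_iff)
  ultimately show ?thesis
    using DERIV_inverse_function[of h "1 + 3 * e * x\<^sup>2" "cubic_inv e" u "u - r" "u + r"] dh[of x] x r(1)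
    by (simp add: x_def[symmetric] inverse_eq_divide)
qed

text \<open>With \<xi> = x / sqrt(1 - 3 e x^2), u = \<xi> + e \<xi>^3 and v = y / sqrt(1 - 3 e
  x^2)^3 the system becomes u' = -v, v' = u. The orbit is recovered from this rotation through
  \<open>cubic_inv\<close>, using that w = 1 + 3 e \<xi>^2 is the reciprocal of 1 - 3 e x^2.\<close>

lemma S34_periodic:
  assumes e: "e = 1 \<or> e = -1" and "p \<in> W34 e"
  shows "\<exists>\<gamma> T. T > 0 \<and> \<gamma> 0 = p \<and> \<gamma> T = p \<and> (\<forall>t. (\<gamma> has_vector_derivative S34 e (\<gamma> t)) (at t) \<and> \<gamma> t \<in> W34 e)"
proof -
  obtain x0 y0 where p: "p = (x0, y0)" by (cases p)
  define D where "D = 1 - 3 * e * x0\<^sup>2"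
  define s0 where "s0 = sqrt D"
  have D: "D > 0" and W0: "e = 1 \<or> 27 * y0\<^sup>2 < 9 * x0\<^sup>2 + 4"
    using assms(2) by (auto simp: p W34_def D_def)
  have s0: "s0 > 0" "s0\<^sup>2 = D" using D by (simp_all add: s0_def)
  define \<xi>0 where "\<xi>0 = x0 / s0"
  define u0 where "u0 = \<xi>0 + e * \<xi>0^3"
  define v0 where "v0 = y0 / s0^3"
  define u where "u t = u0 * cos t - v0 * sin t" for t
  define v where "v t = u0 * sin t + v0 * cos t" for t
  define \<xi> where "\<xi> t = cubic_inv e (u t)" for t
  define w where "w t = 1 + 3 * e * (\<xi> t)\<^sup>2" for t
  define \<gamma> where "\<gamma> t = (\<xi> t / sqrt (w t), v t / sqrt (w t)^3)" for t
  have x0: "x0 = \<xi>0 * s0" and y0: "y0 = v0 * s0^3" using s0 by (simp_all add: \<xi>0_def v0_def)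
  have w0: "(1 + 3 * e * \<xi>0\<^sup>2) * s0\<^sup>2 = 1"
    using s0(2) unfolding D_def x0 by (simp add: algebra_simps power_mult_distrib)
  have w0_pos: "1 + 3 * e * \<xi>0\<^sup>2 > 0"
    using w0 s0(1) by (metis zero_less_mult_pos2 zero_less_one zero_less_power)
  have "(u t)\<^sup>2 + (v t)\<^sup>2 = (u0\<^sup>2 + v0\<^sup>2) * ((sin t)\<^sup>2 + (cos t)\<^sup>2)" for t
    unfolding u_def v_def by algebra
  then have uv: "(u t)\<^sup>2 + (v t)\<^sup>2 = u0\<^sup>2 + v0\<^sup>2" for t by simp
  (* in the coordinates u, v the first integral E34 is 27 (u^2 + v^2) + 4 e *)
  have energy: "27 * (Y * s^3)\<^sup>2 - 9 * (X * s)\<^sup>2 - 4 = s^6 * (27 * ((X - X^3)\<^sup>2 + Y\<^sup>2) - 4)"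
    if "(1 - 3 * X\<^sup>2) * s\<^sup>2 = 1" for X Y s :: real
  proof -
    define q where "q = s\<^sup>2"
    have "s^6 = q^3" by (simp add: q_def power_mult[symmetric])
    have "9 * X\<^sup>2 * q + 4 = q^3 * (4 - 27 * (X - X^3)\<^sup>2)"
      using that unfolding q_def[symmetric] by algebra
    then show ?thesis
      unfolding \<open>s^6 = q^3\<close> by (simp add: power_mult_distrib power_mult[symmetric] q_def algebra_simps)
  qed
  \<comment> \<open>For e = -1 the cubic must be invertible along the whole circle through
    \<open>(u0, v0)\<close>, not only at the initial point. The second condition in
    \<open>W34\<close> supplies exactly this.\<close>
  have R: "e = 1 \<or> e = -1 \<and> 27 * (u0\<^sup>2 + v0\<^sup>2) < 4"
  proof (cases "e = 1")
    case False
    then have e1: "e = -1" using e by simp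
    have "27 * y0\<^sup>2 - 9 * x0\<^sup>2 - 4 = s0^6 * (27 * ((\<xi>0 - \<xi>0^3)\<^sup>2 + v0\<^sup>2) - 4)"
      using energy[of \<xi>0 s0 v0] w0 e1 unfolding x0 y0 by simp
    moreover have "27 * y0\<^sup>2 - 9 * x0\<^sup>2 - 4 < 0" using W0 False by simp
    ultimately have "27 * ((\<xi>0 - \<xi>0^3)\<^sup>2 + v0\<^sup>2) - 4 < 0"
      using s0(1) by (simp add: mult_less_0_iff)
    then show ?thesis using e1 by (simp add: u0_def)
  qed simp
  have range: "e = 1 \<or> e = -1 \<and> 27 * (u t)\<^sup>2 < 4" for t
  proof -
    have "(u t)\<^sup>2 \<le> u0\<^sup>2 + v0\<^sup>2" unfolding uv[of t, symmetric] by simp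
    then show ?thesis using R by auto
  qed
  have \<xi>: "w t > 0" "\<xi> t + e * \<xi> t^3 = u t" for t
    using cubic_inv[OF range[of t]] by (simp_all add: \<xi>_def w_def)
  have du: "(u has_real_derivative - v t) (at t)" and dv: "(v has_real_derivative u t) (at t)" for t
    unfolding u_def v_def by (auto intro!: derivative_eq_intros)
  have d\<xi>: "(\<xi> has_real_derivative - v t / w t) (at t)" for t
    unfolding \<xi>_def[abs_def] w_def
    using DERIV_chain2[OF cubic_inv_deriv[OF range[of t]] du[of t]] by simp
  have dw: "(w has_real_derivative - 6 * e * \<xi> t * v t / w t) (at t)" for t
    unfolding w_def[abs_def] by (rule DERIV_cong, (rule derivative_intros d\<xi>)+) (simp add: w_def)
  have ode: "(\<gamma> has_vector_derivative S34 e (\<gamma> t)) (at t)" for t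
  proof -
    define s where "s = sqrt (w t)"
    have s: "s > 0" "w t = s\<^sup>2" "sqrt (w t) = s" using \<xi>(1)[of t] by (simp_all add: s_def)
    have s2: "s\<^sup>2 = 1 + 3 * e * (\<xi> t)\<^sup>2" using s(2) by (simp add: w_def)
    have ds: "((\<lambda>t. sqrt (w t)) has_real_derivative - 3 * e * \<xi> t * v t / s^3) (at t)"
      by (rule DERIV_cong[OF DERIV_chain2[OF DERIV_real_sqrt[OF \<xi>(1)] dw]])
        (use s(1) in \<open>simp add: s(2,3) real_sqrt_abs field_simps power2_eq_square power3_eq_cube\<close>)
    have ds3: "((\<lambda>t. sqrt (w t)^3) has_real_derivative - 9 * e * \<xi> t * v t / s) (at t)"
      by (rule DERIV_cong[OF DERIV_power[OF ds]])
        (use s(1) in \<open>simp add: s(2,3) real_sqrt_abs field_simps power2_eq_square power3_eq_cube\<close>)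
    have 1: "((\<lambda>t. \<xi> t / sqrt (w t)) has_real_derivative fst (S34 e (\<gamma> t))) (at t)"
    proof (rule DERIV_cong[OF DERIV_divide[OF d\<xi> ds]])
      have "(- v t / w t * sqrt (w t) - \<xi> t * (- 3 * e * \<xi> t * v t / s^3)) / (sqrt (w t) * sqrt (w t)) =
          - v t * (s\<^sup>2 - 3 * e * (\<xi> t)\<^sup>2) / s^5"
        using s(1) unfolding s(2) by (simp add: s(3) field_simps eval_nat_numeral)
      moreover have "fst (S34 e (\<gamma> t)) = - v t * (s\<^sup>2 - 3 * e * (\<xi> t)\<^sup>2) / s^5"
        using s(1) by (simp add: S34_def \<gamma>_def s(3) field_simps eval_nat_numeral)
      ultimately show "(- v t / w t * sqrt (w t) - \<xi> t * (- 3 * e * \<xi> t * v t / s^3)) / (sqrt (w t) * sqrt (w t)) =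
          fst (S34 e (\<gamma> t))" by simp
    qed (use s in simp)
    have 2: "((\<lambda>t. v t / sqrt (w t)^3) has_real_derivative snd (S34 e (\<gamma> t))) (at t)"
    proof (rule DERIV_cong[OF DERIV_divide[OF dv ds3]])
      have "snd (S34 e (\<gamma> t)) = (\<xi> t * s\<^sup>2 - 2 * e * \<xi> t^3) / s^3 + 9 * e * \<xi> t * (v t)\<^sup>2 / s^7"
        using s(1) by (simp add: S34_def \<gamma>_def s(3) field_simps eval_nat_numeral)
      also have "\<xi> t * s\<^sup>2 - 2 * e * \<xi> t^3 = u t"
        unfolding s2 \<xi>(2)[of t, symmetric] by (simp add: algebra_simps power2_eq_square power3_eq_cube)
      finally show "(u t * sqrt (w t)^3 - v t * (- 9 * e * \<xi> t * v t / s)) / (sqrt (w t)^3 * sqrt (w t)^3) = snd (S34 e (\<gamma> t))"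
        using s(1) by (simp add: s(3) field_simps eval_nat_numeral)
    qed (use s in simp)
    show ?thesis
      using pair_has_vector_derivative[OF 1 2] by (simp add: \<gamma>_def[abs_def])
  qed
  have W: "\<gamma> t \<in> W34 e" for t
  proof -
    define s where "s = 1 / sqrt (w t)"
    have s: "s > 0" "w t * s\<^sup>2 = 1" using \<xi>(1)[of t] by (simp_all add: s_def power_divide)
    have \<gamma>: "\<gamma> t = (\<xi> t * s, v t * s^3)" by (simp add: \<gamma>_def s_def power_divide)
    have "1 - 3 * e * (\<xi> t * s)\<^sup>2 = s\<^sup>2"
      using s(2) by (simp add: w_def algebra_simps power_mult_distrib)
    then have "1 - 3 * e * (\<xi> t * s)\<^sup>2 > 0" using s(1) by simp
    moreover have "e = 1 \<or> 27 * (v t * s^3)\<^sup>2 < 9 * (\<xi> t * s)\<^sup>2 + 4"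
    proof (cases "e = 1")
      case False
      then have e1: "e = -1" using e by simp
      have "27 * (v t * s^3)\<^sup>2 - 9 * (\<xi> t * s)\<^sup>2 - 4 = s^6 * (27 * ((\<xi> t - \<xi> t^3)\<^sup>2 + (v t)\<^sup>2) - 4)"
        using s(2) e1 by (intro energy) (simp add: w_def)
      also have "(\<xi> t - \<xi> t^3)\<^sup>2 + (v t)\<^sup>2 = u0\<^sup>2 + v0\<^sup>2"
        using uv[of t] \<xi>(2)[of t] e1 by simp
      also have "s^6 * (27 * (u0\<^sup>2 + v0\<^sup>2) - 4) < 0"
        using R False s(1) by (intro mult_pos_neg) auto
      finally show ?thesis by simp
    qed simp
    ultimately show ?thesis by (simp add: \<gamma> W34_def)
  qed
  have "\<gamma> 0 = p"
  proof -
    have x: "\<xi> 0 = \<xi>0" using cubic_inv_eq[OF w0_pos] by (simp add: \<xi>_def u_def u0_def)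
    have "w 0 = (1 / s0)\<^sup>2" using w0 s0(1) by (simp add: w_def x field_simps)
    then have "sqrt (w 0) = 1 / s0" using s0(1) by (simp add: real_sqrt_divide)
    then show ?thesis using s0(1) by (simp add: \<gamma>_def x p x0 y0 v_def power_divide)
  qed
  moreover have "\<gamma> (2 * pi) = \<gamma> 0" by (simp add: \<gamma>_def \<xi>_def w_def u_def v_def)
  ultimately show ?thesis
    using ode W by (intro exI[of _ \<gamma>] exI[of _ "2 * pi"]) simp
qed

lemma planar_center_S34:
  assumes e: "e = 1 \<or> e = -1"
  shows "planar_center (S34 e) (W34 e) (E34 e) (\<mu>34 e)"
proof
  have "open {p :: real \<times> real. 1 - 3 * e * (fst p)\<^sup>2 > 0}"
    "open {p :: real \<times> real. 27 * (snd p)\<^sup>2 < 9 * (fst p)\<^sup>2 + 4}"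
    by (intro open_Collect_less continuous_intros)+
  moreover have "W34 e = {p. 1 - 3 * e * (fst p)\<^sup>2 > 0} \<inter>
      (if e = 1 then UNIV else {p. 27 * (snd p)\<^sup>2 < 9 * (fst p)\<^sup>2 + 4})"
    by (auto simp: W34_def)
  ultimately show "open (W34 e)" by (simp add: open_Int)
next
  fix g h T t assume "solves (S34 e) g T" "solves (S34 e) h T" "g 0 = h 0" "t \<in> {0..T}"
  then show "g t = h t"
    by (rule polynomial_field_unique[rotated 2])
      (simp_all add: S34_def, (intro lipschitz_on_balls_intros)+)
next
  fix p assume p: "p \<in> W34 e"
  define D where "D = 1 - 3 * e * (fst p)\<^sup>2"
  have pos: "D > 0" using p by (simp add: D_def W34_def)
  then show "\<mu>34 e p > 0" by (simp add: \<mu>34_def D_def)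
  define N where "N = 27 * (snd p)\<^sup>2 - 9 * (fst p)\<^sup>2 + 4 * e"
  have dN: "((\<lambda>p. 27 * (snd p)\<^sup>2 - 9 * (fst p)\<^sup>2 + 4 * e) has_derivative
      (\<lambda>v. 54 * snd p * snd v - 18 * fst p * fst v)) (at p)"
    by (auto intro!: derivative_eq_intros)
  have dD: "((\<lambda>p. (1 - 3 * e * (fst p)\<^sup>2)^3) has_derivative (\<lambda>v. - 18 * e * fst p * fst v * D\<^sup>2)) (at p)"
    by (auto intro!: derivative_eq_intros simp: D_def fun_eq_iff)
  have key: "((54 * snd p * k - 18 * fst p * h) * D^3 - N * (- 18 * e * fst p * h * D\<^sup>2)) / (D^3 * D^3) =
      54 / D^4 * (snd (S34 e p) * h - fst (S34 e p) * k)" for h k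
  proof -
    \<comment> \<open>The linear terms in \<open>fst p\<close> combine to the right coefficient
      because e^2 = 1.\<close>
    have "(54 * snd p * k - 18 * fst p * h) * D + N * (18 * e * fst p * h) =
        54 * (snd (S34 e p) * h - fst (S34 e p) * k)"
      using e by (auto simp: N_def D_def S34_def algebra_simps power2_eq_square power3_eq_cube)
    moreover have "((54 * snd p * k - 18 * fst p * h) * D^3 - N * (- 18 * e * fst p * h * D\<^sup>2)) / (D^3 * D^3) =
        ((54 * snd p * k - 18 * fst p * h) * D + N * (18 * e * fst p * h)) / D^4"
      using pos by (simp add: field_simps eval_nat_numeral)
    ultimately show ?thesis by simp
  qed
  show "(E34 e has_derivative (\<lambda>v. \<mu>34 e p * (snd (S34 e p) * fst v - fst (S34 e p) * snd v))) (at p)"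
    unfolding E34_def[abs_def]
    by (rule has_derivative_eq_rhs[OF has_derivative_divide'[OF dN dD]])
      (use pos key in \<open>simp_all add: \<mu>34_def D_def[symmetric] N_def[symmetric] fun_eq_iff\<close>)
  show "\<exists>\<gamma> T. T > 0 \<and> \<gamma> 0 = p \<and> \<gamma> T = p \<and> (\<forall>t. (\<gamma> has_vector_derivative S34 e (\<gamma> t)) (at t) \<and> \<gamma> t \<in> W34 e)"
    using S34_periodic[OF e p] .
qed

section \<open>Bounds for quadratic polynomials\<close>

definition quad :: "real \<Rightarrow> real \<Rightarrow> real \<Rightarrow> real \<Rightarrow> real" where
  "quad q0 q1 q2 y = q0 + q1 * y + q2 * y\<^sup>2"

text \<open>Over \<open>[l, u]\<close> a quadratic lies below its chord by at most q2 (u - l)^2 / 4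
  if q2 > 0, and not at all otherwise. Two endpoint values with this margin thus give a bound on the
  interval that is checked by arithmetic on numerals.\<close>

definition quad_ge_on :: "real \<Rightarrow> real \<Rightarrow> real \<Rightarrow> real \<Rightarrow> real \<Rightarrow> real \<Rightarrow> bool" where
  "quad_ge_on l u m q0 q1 q2 \<longleftrightarrow>
     m + max 0 q2 * (u - l)\<^sup>2 / 4 \<le> quad q0 q1 q2 l \<and> m + max 0 q2 * (u - l)\<^sup>2 / 4 \<le> quad q0 q1 q2 u"

definition quad_le_on :: "real \<Rightarrow> real \<Rightarrow> real \<Rightarrow> real \<Rightarrow> real \<Rightarrow> real \<Rightarrow> bool" where
  "quad_le_on l u m q0 q1 q2 \<longleftrightarrow>
     quad q0 q1 q2 l \<le> m - max 0 (- q2) * (u - l)\<^sup>2 / 4 \<and> quad q0 q1 q2 u \<le> m - max 0 (- q2) * (u - l)\<^sup>2 / 4"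

lemmas quad_numeric = quad_ge_on_def quad_le_on_def quad_def power2_eq_square

lemma quad_ge:
  assumes "y \<in> {l..u}" and ge_on: "quad_ge_on l u m q0 q1 q2"
  shows "m \<le> quad q0 q1 q2 y"
proof (cases "l = u")
  case False
  have y: "l \<le> y" "y \<le> u" using assms(1) by auto
  then have lu: "u - l > 0" using False by simp
  define k where "k = max 0 q2 * (u - l)\<^sup>2 / 4"
  have p0: "0 \<le> (y - l) * (u - y)" using y by simp
  have "4 * ((y - l) * (u - y)) + (2 * y - l - u)\<^sup>2 = (u - l)\<^sup>2"
    by (simp add: power2_eq_square algebra_simps)
  then have p1: "(y - l) * (u - y) \<le> (u - l)\<^sup>2 / 4"
    using zero_le_power2[of "2 * y - l - u"] by linarith
  have "q2 * ((y - l) * (u - y)) \<le> max 0 q2 * ((y - l) * (u - y))"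
    using p0 by (intro mult_right_mono) auto
  also have "\<dots> \<le> max 0 q2 * ((u - l)\<^sup>2 / 4)"
    using p1 by (intro mult_left_mono) auto
  finally have k: "q2 * ((y - l) * (u - y)) \<le> k" by (simp add: k_def)
  have "(u - l) * quad q0 q1 q2 y = (u - y) * quad q0 q1 q2 l + (y - l) * quad q0 q1 q2 u - (u - l) * (q2 * ((y - l) * (u - y)))"
    by (simp add: quad_def power2_eq_square algebra_simps)
  also have "\<dots> \<ge> (u - y) * (m + k) + (y - l) * (m + k) - (u - l) * k"
    using ge_on y k lu unfolding quad_ge_on_def k_def[symmetric]
    by (intro diff_mono add_mono mult_left_mono) auto
  finally have "(u - l) * m \<le> (u - l) * quad q0 q1 q2 y" by (simp add: algebra_simps)
  then show ?thesis using lu by simp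
qed (use assms in \<open>auto simp: quad_ge_on_def\<close>)

lemma quad_le:
  assumes "y \<in> {l..u}" and "quad_le_on l u m q0 q1 q2"
  shows "quad q0 q1 q2 y \<le> m"
  using quad_ge[of y l u "- m" "- q0" "- q1" "- q2"] assms by (simp add: quad_numeric)

lemma quad_pos:
  assumes "q2 > 0" "q1\<^sup>2 < 4 * q0 * q2" shows "quad q0 q1 q2 y > 0"
proof -
  have "4 * q2 * quad q0 q1 q2 y = (2 * q2 * y + q1)\<^sup>2 + (4 * q0 * q2 - q1\<^sup>2)"
    by (simp add: quad_def power2_eq_square algebra_simps)
  also have "\<dots> > 0" using assms(2) by (simp add: add_nonneg_pos)
  finally show ?thesis using assms(1) by (simp add: zero_less_mult_iff)
qed

lemma is_interval_quad:
  assumes "q2 \<le> 0" shows "is_interval {y. quad q0 q1 q2 y > 0}"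
  unfolding is_interval_1
proof (intro ballI allI impI)
  fix a b x assume "a \<in> {y. quad q0 q1 q2 y > 0}" "b \<in> {y. quad q0 q1 q2 y > 0}" "a \<le> x \<and> x \<le> b"
  then show "x \<in> {y. quad q0 q1 q2 y > 0}"
    using quad_ge[of x a b "min (quad q0 q1 q2 a) (quad q0 q1 q2 b)" q0 q1 q2] assms by (auto simp: quad_ge_on_def)
qed

text \<open>The hypotheses match the coefficients of 1, y, y^2 and y^3, so for rational data the
  factorisation is a numerical check. The cubic part of \<open>S1\<close> is radial, so the last one
  always amounts to q2 = 0.\<close>

lemma S1_tangency:
  assumes "- r * q0 = b * (c + c\<^sup>2 * \<gamma> - \<gamma>^3) - \<beta> * (- \<gamma> + c^3 - c * \<gamma>\<^sup>2)"
    "q0 - r * q1 = b * (b + 2 * b * c * \<gamma> + c\<^sup>2 * \<beta> - 3 * \<gamma>\<^sup>2 * \<beta>) - \<beta> * (- \<beta> + 3 * c\<^sup>2 * b - b * \<gamma>\<^sup>2 - 2 * c * \<gamma> * \<beta>)"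
    "q1 - r * q2 = b * (b\<^sup>2 * \<gamma> + 2 * b * c * \<beta> - 3 * \<gamma> * \<beta>\<^sup>2) - \<beta> * (3 * c * b\<^sup>2 - 2 * b * \<gamma> * \<beta> - c * \<beta>\<^sup>2)"
    "q2 = b * (b\<^sup>2 * \<beta> - \<beta>^3) - \<beta> * (b^3 - b * \<beta>\<^sup>2)"
  shows "b * snd (S1 (b * y + c, \<beta> * y + \<gamma>)) - \<beta> * fst (S1 (b * y + c, \<beta> * y + \<gamma>)) = (y - r) * quad q0 q1 q2 y"
proof -
  have "(y - r) * quad q0 q1 q2 y = (- r * q0) + (q0 - r * q1) * y + (q1 - r * q2) * y\<^sup>2 + q2 * y^3"
    by (simp add: quad_def algebra_simps power2_eq_square power3_eq_cube)
  also have "\<dots> = b * snd (S1 (b * y + c, \<beta> * y + \<gamma>)) - \<beta> * fst (S1 (b * y + c, \<beta> * y + \<gamma>))"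
    \<comment> \<open>\<open>q2\<close> is rewritten last, since replacing it earlier would spoil
      the left-hand side of the third hypothesis.\<close>
    unfolding assms(1-3) unfolding assms(4) by (simp add: S1_def algebra_simps power2_eq_square power3_eq_cube)
  finally show ?thesis by simp
qed

lemma S2_tangency:
  assumes "- r * q0 = b * (c + 3 * c\<^sup>2 * \<gamma> - \<gamma>^3) - \<beta> * (- \<gamma> + c^3 - 3 * c * \<gamma>\<^sup>2)"
    "q0 - r * q1 = b * (b + 6 * b * c * \<gamma> + 3 * c\<^sup>2 * \<beta> - 3 * \<gamma>\<^sup>2 * \<beta>) - \<beta> * (- \<beta> + 3 * c\<^sup>2 * b - 3 * b * \<gamma>\<^sup>2 - 6 * c * \<gamma> * \<beta>)"
    "q1 - r * q2 = b * (3 * b\<^sup>2 * \<gamma> + 6 * b * c * \<beta> - 3 * \<gamma> * \<beta>\<^sup>2) - \<beta> * (3 * c * b\<^sup>2 - 6 * b * \<gamma> * \<beta> - 3 * c * \<beta>\<^sup>2)"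
    "q2 = b * (3 * b\<^sup>2 * \<beta> - \<beta>^3) - \<beta> * (b^3 - 3 * b * \<beta>\<^sup>2)"
  shows "b * snd (S2 (b * y + c, \<beta> * y + \<gamma>)) - \<beta> * fst (S2 (b * y + c, \<beta> * y + \<gamma>)) = (y - r) * quad q0 q1 q2 y"
proof -
  have "(y - r) * quad q0 q1 q2 y = (- r * q0) + (q0 - r * q1) * y + (q1 - r * q2) * y\<^sup>2 + q2 * y^3"
    by (simp add: quad_def algebra_simps power2_eq_square power3_eq_cube)
  also have "\<dots> = b * snd (S2 (b * y + c, \<beta> * y + \<gamma>)) - \<beta> * fst (S2 (b * y + c, \<beta> * y + \<gamma>))"
    unfolding assms(1-3) unfolding assms(4) by (simp add: S2_def algebra_simps power2_eq_square power3_eq_cube)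
  finally show ?thesis by simp
qed

lemma S34_tangency:
  assumes "- r * q0 = b * (c - 2 * e * c^3 + 9 * e * (c * \<gamma>\<^sup>2)) - \<beta> * (- \<gamma> + 3 * e * (c\<^sup>2 * \<gamma>))"
    "q0 - r * q1 = b * (b - 6 * e * (c\<^sup>2 * b) + 9 * e * (b * \<gamma>\<^sup>2 + 2 * c * \<gamma> * \<beta>)) - \<beta> * (- \<beta> + 3 * e * (2 * b * c * \<gamma> + c\<^sup>2 * \<beta>))"
    "q1 - r * q2 = b * (- 6 * e * (c * b\<^sup>2) + 9 * e * (2 * b * \<gamma> * \<beta> + c * \<beta>\<^sup>2)) - \<beta> * (3 * e * (b\<^sup>2 * \<gamma> + 2 * b * c * \<beta>))"
    "q2 = b * (- 2 * e * b^3 + 9 * e * (b * \<beta>\<^sup>2)) - \<beta> * (3 * e * (b\<^sup>2 * \<beta>))"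
  shows "b * snd (S34 e (b * y + c, \<beta> * y + \<gamma>)) - \<beta> * fst (S34 e (b * y + c, \<beta> * y + \<gamma>)) = (y - r) * quad q0 q1 q2 y"
proof -
  have "(y - r) * quad q0 q1 q2 y = (- r * q0) + (q0 - r * q1) * y + (q1 - r * q2) * y\<^sup>2 + q2 * y^3"
    by (simp add: quad_def algebra_simps power2_eq_square power3_eq_cube)
  also have "\<dots> = b * snd (S34 e (b * y + c, \<beta> * y + \<gamma>)) - \<beta> * fst (S34 e (b * y + c, \<beta> * y + \<gamma>))"
    unfolding assms(1-3) unfolding assms(4) by (simp add: S34_def algebra_simps power2_eq_square power3_eq_cube)
  finally show ?thesis by simp
qed

text \<open>On a short interval on one side of both tangency points, the comparison of the derivatives
  is decided by bounds on the factors.\<close>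

lemma ratio_bounds:
  fixes s0 s s1 A0 A A1 D0 D D1 :: real
  assumes "0 \<le> s0" "s0 \<le> s" "s \<le> s1" "0 \<le> A0" "A0 \<le> A" "A \<le> A1" "0 < D0" "D0 \<le> D" "D \<le> D1"
  shows "s0 * A0 / D1 ^ n \<le> s * A / D ^ n" "s * A / D ^ n \<le> s1 * A1 / D0 ^ n"
  using assms by (auto intro!: frac_le mult_mono power_mono)

text \<open>Below both tangency points neither side is positive, so absolute values are compared:
  the left one is bounded below with the shortest distance \<open>r - u\<close>, the right one above
  with the longest distance \<open>r' - l\<close>.\<close>

lemma deriv_less_left:
  fixes y :: real
  assumes y: "y \<in> {l..u}" "u \<le> r" "u \<le> r'"
    and f: "0 \<le> A0" "A0 \<le> A" "0 < D" "D \<le> D1"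
    and g: "0 \<le> B" "B \<le> B1" "0 < G0" "G0 \<le> G"
    and k: "0 \<le> k" "k * ((r' - l) * B1 / G0 ^ m) < (r - u) * A0 / D1 ^ n"
  shows "(y - r) * A / D ^ n < k * ((y - r') * B / G ^ m)"
proof -
  have "(r - u) * A0 / D1 ^ n \<le> (r - y) * A / D ^ n"
    using ratio_bounds(1)[of "r - u" "r - y" "r - y" A0 A A D D D1 n] assms by simp
  moreover have "(r' - y) * B / G ^ m \<le> (r' - l) * B1 / G0 ^ m"
    using ratio_bounds(2)[of "r' - y" "r' - y" "r' - l" B B B1 G0 G G m] assms by simp
  ultimately have "k * ((r' - y) * B / G ^ m) < (r - y) * A / D ^ n"
    using k mult_left_mono[of "(r' - y) * B / G ^ m" "(r' - l) * B1 / G0 ^ m" k] by linarith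
  moreover have "(y - r) * A / D ^ n = - ((r - y) * A / D ^ n)" "(y - r') * B / G ^ m = - ((r' - y) * B / G ^ m)"
    by (simp_all add: minus_divide_left left_diff_distrib)
  ultimately show ?thesis by (simp only: mult_minus_right neg_less_iff_less)
qed

lemma deriv_less_right:
  fixes y :: real
  assumes y: "y \<in> {l..u}" "r \<le> l" "r' \<le> l"
    and f: "0 \<le> A" "A \<le> A1" "0 < D0" "D0 \<le> D"
    and g: "0 \<le> B0" "B0 \<le> B" "0 < G" "G \<le> G1"
    and k: "0 \<le> k" "(u - r) * A1 / D0 ^ n < k * ((l - r') * B0 / G1 ^ m)"
  shows "(y - r) * A / D ^ n < k * ((y - r') * B / G ^ m)"
proof -
  have "(y - r) * A / D ^ n \<le> (u - r) * A1 / D0 ^ n"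
    using ratio_bounds(2)[of "y - r" "y - r" "u - r" A A A1 D0 D D n] assms by simp
  moreover have "(l - r') * B0 / G1 ^ m \<le> (y - r') * B / G ^ m"
    using ratio_bounds(1)[of "l - r'" "y - r'" "y - r'" B0 B B G G G1 m] assms by simp
  ultimately show ?thesis
    using k mult_left_mono[of "(l - r') * B0 / G1 ^ m" "(y - r') * B / G ^ m" k] by linarith
qed

lemma quad_deriv_less_left:
  assumes y: "y \<in> {l..u}" "u \<le> r" "u \<le> r'"
    and f: "0 \<le> A0" "quad_ge_on l u A0 a0 a1 a2" "0 < D0" "quad_ge_on l u D0 d0 d1 d2" "quad_le_on l u D1 d0 d1 d2"
    and g: "quad_ge_on l u 0 b0 b1 b2" "quad_le_on l u B1 b0 b1 b2" "0 < G0" "quad_ge_on l u G0 g0 g1 g2"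
    and k: "0 \<le> k" "k * ((r' - l) * B1 / G0 ^ m) < (r - u) * A0 / D1 ^ n"
  shows "(y - r) * quad a0 a1 a2 y / quad d0 d1 d2 y ^ n < k * ((y - r') * quad b0 b1 b2 y / quad g0 g1 g2 y ^ m)"
  using y f(1) quad_ge[OF y(1) f(2)] less_le_trans[OF f(3) quad_ge[OF y(1) f(4)]] quad_le[OF y(1) f(5)]
    quad_ge[OF y(1) g(1)] quad_le[OF y(1) g(2)] g(3) quad_ge[OF y(1) g(4)] k
  by (rule deriv_less_left)

lemma quad_deriv_less_right:
  assumes y: "y \<in> {l..u}" "r \<le> l" "r' \<le> l"
    and f: "quad_ge_on l u 0 a0 a1 a2" "quad_le_on l u A1 a0 a1 a2" "0 < D0" "quad_ge_on l u D0 d0 d1 d2"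
    and g: "0 \<le> B0" "quad_ge_on l u B0 b0 b1 b2" "0 < G0" "quad_ge_on l u G0 g0 g1 g2" "quad_le_on l u G1 g0 g1 g2"
    and k: "0 \<le> k" "(u - r) * A1 / D0 ^ n < k * ((l - r') * B0 / G1 ^ m)"
  shows "(y - r) * quad a0 a1 a2 y / quad d0 d1 d2 y ^ n < k * ((y - r') * quad b0 b1 b2 y / quad g0 g1 g2 y ^ m)"
  using y quad_ge[OF y(1) f(1)] quad_le[OF y(1) f(2)] f(3) quad_ge[OF y(1) f(4)]
    g(1) quad_ge[OF y(1) g(2)] less_le_trans[OF g(3) quad_ge[OF y(1) g(4)]] quad_le[OF y(1) g(5)] k
  by (rule deriv_less_right)

text \<open>\<open>v\<close> is a number separating the two quotients; \<open>d\<close> and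
  \<open>d'\<close> are short roundings of the denominators, so that powers are taken only of small
  numerals.\<close>

lemma quotient_less_pos:
  fixes v :: real
  assumes "0 \<le> v" "0 < d" "d \<le> D" "N < v * d ^ n" "0 < D'" "D' \<le> d'" "v * d' ^ n < N'"
  shows "N / D ^ n < N' / D' ^ n"
proof -
  have "N < v * D ^ n"
    using assms(1-4) mult_left_mono[OF power_mono[of d D n], of v] by simp
  moreover have "v * D' ^ n < N'"
    using assms(1,5-7) mult_left_mono[OF power_mono[of D' d' n], of v] by simp
  moreover have "0 < D ^ n" "0 < D' ^ n" using assms by simp_all
  ultimately have "N / D ^ n < v" "v < N' / D' ^ n"
    using pos_divide_less_eq pos_less_divide_eq by blast+
  then show ?thesis by (rule less_trans)
qed

text \<open>The variant for \<open>E34 (-1)\<close>, which is negative on its domain. With a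
  negative separator the roundings of the denominators go in the opposite directions.\<close>

lemma quotient_less_neg:
  fixes v :: real
  assumes "v \<le> 0" "0 < D" "D \<le> d" "N < v * d ^ n" "0 < d'" "d' \<le> D'" "v * d' ^ n < N'"
  shows "N / D ^ n < N' / D' ^ n"
proof -
  have "N < v * D ^ n"
    using assms(1-4) mult_left_mono_neg[OF power_mono[of D d n], of v] by simp
  moreover have "v * D' ^ n < N'"
    using assms(1,5-7) mult_left_mono_neg[OF power_mono[of d' D' n], of v] by simp
  moreover have "0 < D ^ n" "0 < D' ^ n" using assms by simp_all
  ultimately have "N / D ^ n < v" "v < N' / D' ^ n"
    using pos_divide_less_eq pos_less_divide_eq by blast+
  then show ?thesis by (rule less_trans)
qed

section \<open>Explicit systems\<close>

text \<open>
  The numbers below come from a numerical search. Each line is chosen tangent to its vector field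
  \<open>S\<close> at a rational point \<open>(X, Y)\<close>, reached for \<open>y = r\<close>, with direction \<open>k S (X, Y)\<close>; here \<open>r = 0\<close> on
  the right and \<open>r = 1\<close> on the left. The values of \<open>(X, Y; k)\<close> are
  \<open>(1/2, -2/5; 9/10)\<close> and \<open>(-1/10, 7/10; 2/5)\<close> for \<open>S1\<close> and \<open>S2\<close>,
  \<open>(7/20, 23/10; 1/100)\<close> and \<open>(-3/20, 15/4; 1/100)\<close> for \<open>S3\<close> and \<open>S3\<close>,
  \<open>(-2/5, 11/10; 1/100)\<close> and \<open>(-9/10, -2/5; 1/200)\<close> for \<open>S3\<close> and \<open>S4\<close>,
  \<open>(1/10, -1/10; 1/20)\<close> and \<open>(1/5, 3/10; 2/25)\<close> for \<open>S4\<close> and \<open>S4\<close>.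
  Since the tangency point is a root, the cubic \<open>b S\<^sub>2 - \<beta> S\<^sub>1\<close> along the line factors as \<open>(y - r) Q y\<close>
  with a quadratic \<open>Q\<close>; when \<open>Q\<close> itself is not positive everywhere, it is the sum of a positive
  quadratic and a multiple of the quadratic that defines the domain.
\<close>

abbreviation "S1_S2_right_Q \<equiv> quad (6372999 / 100000000) (516212919 / 100000000000) 0"
abbreviation "S1_S2_right_num \<equiv> quad (6372999 / 50000000) (516212919 / 50000000000) 0"
abbreviation "S1_S2_right_den \<equiv> quad (3 / 5) (243 / 2500) (209061 / 625000)"
abbreviation "S1_S2_right_dom \<equiv> quad (19 / 100) (1539 / 50000) (- (29241 / 100000000))"
abbreviation "S1_S2_right_E \<equiv> line_side.line_E E1 (801 / 2000) (261 / 625) (1 / 2) (- (2 / 5))"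
abbreviation "S1_S2_right_E' \<equiv> line_side.line_E' \<mu>1 (801 / 2000) (261 / 625) (1 / 2) (- (2 / 5)) 0 (S1_S2_right_Q)"

lemma S1_S2_right_line: "line_side S1 W1 E1 \<mu>1 (801 / 2000) (261 / 625) (1 / 2) (- (2 / 5)) 0 (S1_S2_right_Q)"
proof (intro line_side.intro line_side_axioms.intro affine_center.intro affine_center_axioms.intro)
  show "planar_center S1 W1 E1 \<mu>1" by (rule S1.planar_center_axioms)
  show "(0 :: real) < (801 / 2000)\<^sup>2 + (261 / 625)\<^sup>2" by (intro add_pos_pos) simp_all
  have om: "1 - (((801 / 2000) * y + (1 / 2)) - ((261 / 625) * y + (- (2 / 5))))\<^sup>2 = S1_S2_right_dom y" for y
    by (simp add: quad_def power2_eq_square algebra_simps)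
  have mem: "((801 / 2000) * y + (1 / 2), (261 / 625) * y + (- (2 / 5))) \<in> W1 \<longleftrightarrow> 0 < S1_S2_right_dom y" for y
    unfolding om[symmetric] by (simp add: W1_def)
  show "is_interval {y. ((801 / 2000) * y + (1 / 2), (261 / 625) * y + (- (2 / 5))) \<in> W1}"
    unfolding mem by (rule is_interval_quad) simp
  show "(801 / 2000) * snd (S1 ((801 / 2000) * y + (1 / 2), (261 / 625) * y + (- (2 / 5)))) - (261 / 625) * fst (S1 ((801 / 2000) * y + (1 / 2), (261 / 625) * y + (- (2 / 5)))) = (y - 0) * S1_S2_right_Q y" for y
    by (rule S1_tangency) (simp_all add: power2_eq_square power3_eq_cube)
  \<comment> \<open>The cofactor is affine here. The weight 17/100 is such that the remainder after
    removing this multiple of the domain quadratic has negative discriminant.\<close>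
  have "S1_S2_right_Q y = (17 / 100) * S1_S2_right_dom y + quad (3142999 / 100000000) (- (7047081 / 100000000000)) (497097 / 10000000000) y" for y
    by (simp add: quad_def algebra_simps)
  moreover have "0 < quad (3142999 / 100000000) (- (7047081 / 100000000000)) (497097 / 10000000000) y" for y
    by (rule quad_pos) (simp_all add: power2_eq_square)
  ultimately show "0 < S1_S2_right_Q y" if "((801 / 2000) * y + (1 / 2), (261 / 625) * y + (- (2 / 5))) \<in> W1" for y
    using that unfolding mem by (simp only:) (simp add: add_pos_pos)
qed

lemma S1_S2_right_deriv: "S1_S2_right_E' y = (y - 0) * S1_S2_right_num y / (S1_S2_right_den y) ^ 2"
proof -
  have den: "1 + 2 * ((801 / 2000) * y + (1 / 2)) * ((261 / 625) * y + (- (2 / 5))) = S1_S2_right_den y"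
    by (simp add: quad_def power2_eq_square algebra_simps)
  have num: "2 * S1_S2_right_Q y = S1_S2_right_num y"
    by (simp add: quad_def algebra_simps)
  have "\<mu>1 ((801 / 2000) * y + (1 / 2), (261 / 625) * y + (- (2 / 5))) = 2 / (S1_S2_right_den y)\<^sup>2"
    by (simp only: \<mu>1_def fst_conv snd_conv den)
  then show ?thesis
    unfolding line_side.line_E'_def[OF S1_S2_right_line] num[symmetric] by simp
qed

abbreviation "S1_S2_left_Q \<equiv> quad (20262621 / 244140625) (- (21383359 / 488281250)) (5669359 / 976562500)"
abbreviation "S1_S2_left_num \<equiv> quad (81050484 / 244140625) (- (42766718 / 244140625)) (5669359 / 244140625)"
abbreviation "S1_S2_left_den \<equiv> quad (555697 / 390625) (- (332894 / 390625)) (58447 / 390625)"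
abbreviation "S1_S2_left_rad \<equiv> quad (481 / 625) (- (217 / 625)) (97 / 1250)"
abbreviation "S1_S2_left_E \<equiv> line_side.line_E E2 (- (277 / 1250)) (- (211 / 1250)) (76 / 625) (543 / 625)"
abbreviation "S1_S2_left_E' \<equiv> line_side.line_E' \<mu>2 (- (277 / 1250)) (- (211 / 1250)) (76 / 625) (543 / 625) 1 (S1_S2_left_Q)"

lemma S1_S2_left_line: "line_side S2 W2 E2 \<mu>2 (- (277 / 1250)) (- (211 / 1250)) (76 / 625) (543 / 625) 1 (S1_S2_left_Q)"
proof (intro line_side.intro line_side_axioms.intro affine_center.intro affine_center_axioms.intro)
  show "planar_center S2 W2 E2 \<mu>2" by (rule S2.planar_center_axioms)
  show "(0 :: real) < (- (277 / 1250))\<^sup>2 + (- (211 / 1250))\<^sup>2" by (intro add_pos_pos) simp_all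
  have om: "1 + 4 * ((- (277 / 1250)) * y + (76 / 625)) * ((- (211 / 1250)) * y + (543 / 625)) = S1_S2_left_den y" for y
    by (simp add: quad_def power2_eq_square algebra_simps)
  have rad: "((- (277 / 1250)) * y + (76 / 625))\<^sup>2 + ((- (211 / 1250)) * y + (543 / 625))\<^sup>2 = S1_S2_left_rad y" for y
    by (simp add: quad_def power2_eq_square algebra_simps)
  have pos: "0 < ((- (277 / 1250)) * y + (76 / 625))\<^sup>2 + ((- (211 / 1250)) * y + (543 / 625))\<^sup>2" for y :: real
    unfolding rad by (rule quad_pos) (simp_all add: power2_eq_square)
  have nz: "((- (277 / 1250)) * y + (76 / 625), (- (211 / 1250)) * y + (543 / 625)) \<noteq> 0" for y :: real
  proof
    assume "((- (277 / 1250)) * y + (76 / 625), (- (211 / 1250)) * y + (543 / 625)) = 0"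
    then have "((- (277 / 1250)) * y + (76 / 625)) = 0" "((- (211 / 1250)) * y + (543 / 625)) = 0" unfolding zero_prod_def prod.inject by blast+
    then show False using pos[of y] by (simp only:)
  qed
  have mem: "((- (277 / 1250)) * y + (76 / 625), (- (211 / 1250)) * y + (543 / 625)) \<in> W2 \<longleftrightarrow> 0 < S1_S2_left_den y" for y
    unfolding om[symmetric] W2_def mem_Collect_eq fst_conv snd_conv using nz[of y] by blast
  \<comment> \<open>The discriminant is negative: the line misses the hyperbola 1 + 4 x y = 0 and,
    by \<open>nz\<close>, the origin, so it lies in \<open>W2\<close> entirely.\<close>
  have "0 < S1_S2_left_den y" for y
    by (rule quad_pos) (simp_all add: power2_eq_square)
  then show "is_interval {y. ((- (277 / 1250)) * y + (76 / 625), (- (211 / 1250)) * y + (543 / 625)) \<in> W2}"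
    unfolding mem by (simp add: is_interval_univ)
  show "(- (277 / 1250)) * snd (S2 ((- (277 / 1250)) * y + (76 / 625), (- (211 / 1250)) * y + (543 / 625))) - (- (211 / 1250)) * fst (S2 ((- (277 / 1250)) * y + (76 / 625), (- (211 / 1250)) * y + (543 / 625))) = (y - 1) * S1_S2_left_Q y" for y
    by (rule S2_tangency) (simp_all add: power2_eq_square power3_eq_cube)
  show "0 < S1_S2_left_Q y" for y
    by (rule quad_pos) (simp_all add: power2_eq_square)
qed

text \<open>The integrating factor of \<open>S2\<close> brings in x^2 + y^2. The resulting quartic
  is kept as a product of two quadratics, so that each can be bounded separately.\<close>

lemma S1_S2_left_deriv: "S1_S2_left_E' y = (y - 1) * (S1_S2_left_rad y * S1_S2_left_num y) / (S1_S2_left_den y) ^ 2"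
proof -
  have den: "1 + 4 * ((- (277 / 1250)) * y + (76 / 625)) * ((- (211 / 1250)) * y + (543 / 625)) = S1_S2_left_den y"
    by (simp add: quad_def power2_eq_square algebra_simps)
  have rad: "((- (277 / 1250)) * y + (76 / 625))\<^sup>2 + ((- (211 / 1250)) * y + (543 / 625))\<^sup>2 = S1_S2_left_rad y"
    by (simp add: quad_def power2_eq_square algebra_simps)
  have num: "4 * S1_S2_left_Q y = S1_S2_left_num y"
    by (simp add: quad_def algebra_simps)
  have "\<mu>2 ((- (277 / 1250)) * y + (76 / 625), (- (211 / 1250)) * y + (543 / 625)) = 4 * S1_S2_left_rad y / (S1_S2_left_den y)\<^sup>2"
    by (simp only: \<mu>2_def fst_conv snd_conv den rad)
  then show ?thesis
    unfolding line_side.line_E'_def[OF S1_S2_left_line] num[symmetric] by simp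
qed

lemma S1_S2_box1: "crossing_box S1_S2_right_E S1_S2_right_E' S1_S2_left_E S1_S2_left_E' (- (41 / 20)) (- (49 / 25)) (29 / 10) (76 / 25)"
  unfolding crossing_box_def
\<comment> \<open>The bounds below put the ratio of the derivatives above 0.19 on the lower edge and
  below 0.151 on the upper edge; 4/25 lies in the gap.\<close>
proof (intro conjI exI[of _ "(4 / 25)"] ballI)
  show "(- (41 / 20)) < ((- (49 / 25)) :: real)" "(29 / 10) < ((76 / 25) :: real)" by simp_all
  show "S1_S2_right_E (76 / 25) < S1_S2_right_E (- (41 / 20))"
    by (simp add: line_side.line_E_def[OF S1_S2_right_line] E1_def power2_eq_square power3_eq_cube)
  show "S1_S2_right_E (- (49 / 25)) < S1_S2_right_E (29 / 10)"
    by (simp add: line_side.line_E_def[OF S1_S2_right_line] E1_def power2_eq_square power3_eq_cube)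
  show "S1_S2_left_E (29 / 10) < S1_S2_left_E (- (49 / 25))"
    by (simp add: line_side.line_E_def[OF S1_S2_left_line] E2_def power2_eq_square power3_eq_cube)
  show "S1_S2_left_E (- (41 / 20)) < S1_S2_left_E (76 / 25)"
    by (simp add: line_side.line_E_def[OF S1_S2_left_line] E2_def power2_eq_square power3_eq_cube)
  fix y :: real assume "y \<in> {(- (41 / 20))..(- (49 / 25))} \<union> {(29 / 10)..(76 / 25)}"
  then show "S1_S2_right_E' y < (4 / 25) * S1_S2_left_E' y"
  proof
    assume y: "y \<in> {(- (41 / 20))..(- (49 / 25))}"
    show ?thesis unfolding S1_S2_right_deriv S1_S2_left_deriv
    proof (rule deriv_less_left[OF y])
      have fq: "(53 / 500) \<le> S1_S2_right_num y"
        by (rule quad_ge[OF y]) (simp add: quad_numeric)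
      have fd: "S1_S2_right_den y \<le> (181 / 100)"
        by (rule quad_le[OF y]) (simp add: quad_numeric)
      \<comment> \<open>The tiny constant stands in for 0: it turns positivity of the denominator
        into the non-strict bound that \<open>quad_ge\<close> delivers.\<close>
      have fd0: "(1 / 1000000000000) \<le> S1_S2_right_den y"
        by (rule quad_ge[OF y]) (simp add: quad_numeric)
      have gq: "S1_S2_left_num y \<le> (789 / 1000)"
        by (rule quad_le[OF y]) (simp add: quad_numeric)
      have gq0: "0 \<le> S1_S2_left_num y"
        by (rule quad_ge[OF y]) (simp add: quad_numeric)
      have gr: "S1_S2_left_rad y \<le> (181 / 100)"
        by (rule quad_le[OF y]) (simp add: quad_numeric)
      have gr0: "0 \<le> S1_S2_left_rad y"
        by (rule quad_ge[OF y]) (simp add: quad_numeric)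
      have gd: "(183 / 50) \<le> S1_S2_left_den y"
        by (rule quad_ge[OF y]) (simp add: quad_numeric)
      show "(0 :: real) \<le> (53 / 500)" by simp
      show "(53 / 500) \<le> S1_S2_right_num y" by (fact fq)
      show "0 < S1_S2_right_den y" using fd0 by simp
      show "S1_S2_right_den y \<le> (181 / 100)" by (fact fd)
      show "0 \<le> S1_S2_left_rad y * S1_S2_left_num y" using gr0 gq0 by simp
      show "S1_S2_left_rad y * S1_S2_left_num y \<le> (181 / 100) * (789 / 1000)" using gr gq gr0 gq0 by (intro mult_mono) simp_all
      show "(0 :: real) < (183 / 50)" by simp
      show "(183 / 50) \<le> S1_S2_left_den y" by (fact gd)
    qed (simp_all add: power_divide)
  next
    assume y: "y \<in> {(29 / 10)..(76 / 25)}"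
    show ?thesis unfolding S1_S2_right_deriv S1_S2_left_deriv
    proof (rule deriv_less_right[OF y])
      have fq: "S1_S2_right_num y \<le> (159 / 1000)"
        by (rule quad_le[OF y]) (simp add: quad_numeric)
      have fq0: "0 \<le> S1_S2_right_num y"
        by (rule quad_ge[OF y]) (simp add: quad_numeric)
      have fd: "(369 / 100) \<le> S1_S2_right_den y"
        by (rule quad_ge[OF y]) (simp add: quad_numeric)
      have gq: "(139 / 10000) \<le> S1_S2_left_num y"
        by (rule quad_ge[OF y]) (simp add: quad_numeric)
      have gr: "(207 / 500) \<le> S1_S2_left_rad y"
        by (rule quad_ge[OF y]) (simp add: quad_numeric)
      have gd: "S1_S2_left_den y \<le> (43 / 200)"
        by (rule quad_le[OF y]) (simp add: quad_numeric)
      have gd0: "(1 / 1000000000000) \<le> S1_S2_left_den y"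
        by (rule quad_ge[OF y]) (simp add: quad_numeric)
      show "0 \<le> S1_S2_right_num y" by (fact fq0)
      show "S1_S2_right_num y \<le> (159 / 1000)" by (fact fq)
      show "(0 :: real) < (369 / 100)" by simp
      show "(369 / 100) \<le> S1_S2_right_den y" by (fact fd)
      show "(0 :: real) \<le> (207 / 500) * (139 / 10000)" by simp
      show "(207 / 500) * (139 / 10000) \<le> S1_S2_left_rad y * S1_S2_left_num y" using gr gq by (intro mult_mono) simp_all
      show "0 < S1_S2_left_den y" using gd0 by simp
      show "S1_S2_left_den y \<le> (43 / 200)" by (fact gd)
    qed (simp_all add: power_divide)
  qed
qed

text \<open>At the middle intersection the curves cross the other way, so the left first integral
  takes the first place and the reciprocal ratio of derivatives is separated, here by 9/2.\<close>

lemma S1_S2_box2: "crossing_box S1_S2_left_E S1_S2_left_E' S1_S2_right_E S1_S2_right_E' (- (117 / 50)) (- (229 / 100)) (71 / 20) (193 / 50)"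
  unfolding crossing_box_def
proof (intro conjI exI[of _ "(9 / 2)"] ballI)
  show "(- (117 / 50)) < ((- (229 / 100)) :: real)" "(71 / 20) < ((193 / 50) :: real)" by simp_all
  show "S1_S2_left_E (193 / 50) < S1_S2_left_E (- (117 / 50))"
    by (simp add: line_side.line_E_def[OF S1_S2_left_line] E2_def power2_eq_square power3_eq_cube)
  show "S1_S2_left_E (- (229 / 100)) < S1_S2_left_E (71 / 20)"
    by (simp add: line_side.line_E_def[OF S1_S2_left_line] E2_def power2_eq_square power3_eq_cube)
  show "S1_S2_right_E (71 / 20) < S1_S2_right_E (- (229 / 100))"
    by (simp add: line_side.line_E_def[OF S1_S2_right_line] E1_def power2_eq_square power3_eq_cube)
  show "S1_S2_right_E (- (117 / 50)) < S1_S2_right_E (193 / 50)"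
    by (simp add: line_side.line_E_def[OF S1_S2_right_line] E1_def power2_eq_square power3_eq_cube)
  fix y :: real assume "y \<in> {(- (117 / 50))..(- (229 / 100))} \<union> {(71 / 20)..(193 / 50)}"
  then show "S1_S2_left_E' y < (9 / 2) * S1_S2_right_E' y"
  proof
    assume y: "y \<in> {(- (117 / 50))..(- (229 / 100))}"
    show ?thesis unfolding S1_S2_left_deriv S1_S2_right_deriv
    proof (rule deriv_less_left[OF y])
      have fq: "(17 / 20) \<le> S1_S2_left_num y"
        by (rule quad_ge[OF y]) (simp add: quad_numeric)
      have fr: "(19 / 10) \<le> S1_S2_left_rad y"
        by (rule quad_ge[OF y]) (simp add: quad_numeric)
      have fd: "S1_S2_left_den y \<le> (43 / 10)"
        by (rule quad_le[OF y]) (simp add: quad_numeric)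
      have fd0: "(1 / 1000000000000) \<le> S1_S2_left_den y"
        by (rule quad_ge[OF y]) (simp add: quad_numeric)
      have gq: "S1_S2_right_num y \<le> (11 / 100)"
        by (rule quad_le[OF y]) (simp add: quad_numeric)
      have gq0: "0 \<le> S1_S2_right_num y"
        by (rule quad_ge[OF y]) (simp add: quad_numeric)
      have gd: "(21 / 10) \<le> S1_S2_right_den y"
        by (rule quad_ge[OF y]) (simp add: quad_numeric)
      show "(0 :: real) \<le> (19 / 10) * (17 / 20)" by simp
      show "(19 / 10) * (17 / 20) \<le> S1_S2_left_rad y * S1_S2_left_num y" using fr fq by (intro mult_mono) simp_all
      show "0 < S1_S2_left_den y" using fd0 by simp
      show "S1_S2_left_den y \<le> (43 / 10)" by (fact fd)
      show "0 \<le> S1_S2_right_num y" by (fact gq0)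
      show "S1_S2_right_num y \<le> (11 / 100)" by (fact gq)
      show "(0 :: real) < (21 / 10)" by simp
      show "(21 / 10) \<le> S1_S2_right_den y" by (fact gd)
    qed (simp_all add: power_divide)
  next
    assume y: "y \<in> {(71 / 20)..(193 / 50)}"
    show ?thesis unfolding S1_S2_left_deriv S1_S2_right_deriv
    proof (rule deriv_less_right[OF y])
      have fq: "S1_S2_left_num y \<le> (7 / 2500)"
        by (rule quad_le[OF y]) (simp add: quad_numeric)
      have fq0: "0 \<le> S1_S2_left_num y"
        by (rule quad_ge[OF y]) (simp add: quad_numeric)
      have fr: "S1_S2_left_rad y \<le> (59 / 100)"
        by (rule quad_le[OF y]) (simp add: quad_numeric)
      have fr0: "0 \<le> S1_S2_left_rad y"
        by (rule quad_ge[OF y]) (simp add: quad_numeric)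
      have fd: "(27 / 100) \<le> S1_S2_left_den y"
        by (rule quad_ge[OF y]) (simp add: quad_numeric)
      have gq: "(4 / 25) \<le> S1_S2_right_num y"
        by (rule quad_ge[OF y]) (simp add: quad_numeric)
      have gd: "S1_S2_right_den y \<le> 6"
        by (rule quad_le[OF y]) (simp add: quad_numeric)
      have gd0: "(1 / 1000000000000) \<le> S1_S2_right_den y"
        by (rule quad_ge[OF y]) (simp add: quad_numeric)
      show "0 \<le> S1_S2_left_rad y * S1_S2_left_num y" using fr0 fq0 by simp
      show "S1_S2_left_rad y * S1_S2_left_num y \<le> (59 / 100) * (7 / 2500)" using fr fq fr0 fq0 by (intro mult_mono) simp_all
      show "(0 :: real) < (27 / 100)" by simp
      show "(27 / 100) \<le> S1_S2_left_den y" by (fact fd)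
      show "(0 :: real) \<le> (4 / 25)" by simp
      show "(4 / 25) \<le> S1_S2_right_num y" by (fact gq)
      show "0 < S1_S2_right_den y" using gd0 by simp
      show "S1_S2_right_den y \<le> 6" by (fact gd)
    qed (simp_all add: power_divide)
  qed
qed

lemma S1_S2_box3: "crossing_box S1_S2_right_E S1_S2_right_E' S1_S2_left_E S1_S2_left_E' (- (147 / 50)) (- (57 / 20)) (533 / 100) (139 / 25)"
  unfolding crossing_box_def
proof (intro conjI exI[of _ "(3 / 50)"] ballI)
  show "(- (147 / 50)) < ((- (57 / 20)) :: real)" "(533 / 100) < ((139 / 25) :: real)" by simp_all
  show "S1_S2_right_E (139 / 25) < S1_S2_right_E (- (147 / 50))"
    by (simp add: line_side.line_E_def[OF S1_S2_right_line] E1_def power2_eq_square power3_eq_cube)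
  show "S1_S2_right_E (- (57 / 20)) < S1_S2_right_E (533 / 100)"
    by (simp add: line_side.line_E_def[OF S1_S2_right_line] E1_def power2_eq_square power3_eq_cube)
  show "S1_S2_left_E (533 / 100) < S1_S2_left_E (- (57 / 20))"
    by (simp add: line_side.line_E_def[OF S1_S2_left_line] E2_def power2_eq_square power3_eq_cube)
  show "S1_S2_left_E (- (147 / 50)) < S1_S2_left_E (139 / 25)"
    by (simp add: line_side.line_E_def[OF S1_S2_left_line] E2_def power2_eq_square power3_eq_cube)
  fix y :: real assume "y \<in> {(- (147 / 50))..(- (57 / 20))} \<union> {(533 / 100)..(139 / 25)}"
  then show "S1_S2_right_E' y < (3 / 50) * S1_S2_left_E' y"
  proof
    assume y: "y \<in> {(- (147 / 50))..(- (57 / 20))}"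
    show ?thesis unfolding S1_S2_right_deriv S1_S2_left_deriv
    proof (rule deriv_less_left[OF y])
      have fq: "(971 / 10000) \<le> S1_S2_right_num y"
        by (rule quad_ge[OF y]) (simp add: quad_numeric)
      have fd: "S1_S2_right_den y \<le> (321 / 100)"
        by (rule quad_le[OF y]) (simp add: quad_numeric)
      have fd0: "(1 / 1000000000000) \<le> S1_S2_right_den y"
        by (rule quad_ge[OF y]) (simp add: quad_numeric)
      have gq: "S1_S2_left_num y \<le> (21 / 20)"
        by (rule quad_le[OF y]) (simp add: quad_numeric)
      have gq0: "0 \<le> S1_S2_left_num y"
        by (rule quad_ge[OF y]) (simp add: quad_numeric)
      have gr: "S1_S2_left_rad y \<le> (247 / 100)"
        by (rule quad_le[OF y]) (simp add: quad_numeric)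
      have gr0: "0 \<le> S1_S2_left_rad y"
        by (rule quad_ge[OF y]) (simp add: quad_numeric)
      have gd: "(253 / 50) \<le> S1_S2_left_den y"
        by (rule quad_ge[OF y]) (simp add: quad_numeric)
      show "(0 :: real) \<le> (971 / 10000)" by simp
      show "(971 / 10000) \<le> S1_S2_right_num y" by (fact fq)
      show "0 < S1_S2_right_den y" using fd0 by simp
      show "S1_S2_right_den y \<le> (321 / 100)" by (fact fd)
      show "0 \<le> S1_S2_left_rad y * S1_S2_left_num y" using gr0 gq0 by simp
      show "S1_S2_left_rad y * S1_S2_left_num y \<le> (247 / 100) * (21 / 20)" using gr gq gr0 gq0 by (intro mult_mono) simp_all
      show "(0 :: real) < (253 / 50)" by simp
      show "(253 / 50) \<le> S1_S2_left_den y" by (fact gd)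
    qed (simp_all add: power_divide)
  next
    assume y: "y \<in> {(533 / 100)..(139 / 25)}"
    show ?thesis unfolding S1_S2_right_deriv S1_S2_left_deriv
    proof (rule deriv_less_right[OF y])
      have fq: "S1_S2_right_num y \<le> (37 / 200)"
        by (rule quad_le[OF y]) (simp add: quad_numeric)
      have fq0: "0 \<le> S1_S2_right_num y"
        by (rule quad_ge[OF y]) (simp add: quad_numeric)
      have fd: "(53 / 5) \<le> S1_S2_right_den y"
        by (rule quad_ge[OF y]) (simp add: quad_numeric)
      have gq: "(577 / 10000) \<le> S1_S2_left_num y"
        by (rule quad_ge[OF y]) (simp add: quad_numeric)
      have gr: "(28 / 25) \<le> S1_S2_left_rad y"
        by (rule quad_ge[OF y]) (simp add: quad_numeric)
      have gd: "S1_S2_left_den y \<le> (131 / 100)"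
        by (rule quad_le[OF y]) (simp add: quad_numeric)
      have gd0: "(1 / 1000000000000) \<le> S1_S2_left_den y"
        by (rule quad_ge[OF y]) (simp add: quad_numeric)
      show "0 \<le> S1_S2_right_num y" by (fact fq0)
      show "S1_S2_right_num y \<le> (37 / 200)" by (fact fq)
      show "(0 :: real) < (53 / 5)" by simp
      show "(53 / 5) \<le> S1_S2_right_den y" by (fact fd)
      show "(0 :: real) \<le> (28 / 25) * (577 / 10000)" by simp
      show "(28 / 25) * (577 / 10000) \<le> S1_S2_left_rad y * S1_S2_left_num y" using gr gq by (intro mult_mono) simp_all
      show "0 < S1_S2_left_den y" using gd0 by simp
      show "S1_S2_left_den y \<le> (131 / 100)" by (fact gd)
    qed (simp_all add: power_divide)
  qed
qed

lemma S1_S2_three_limit_cycles: "\<exists>Fp Fm. in_class S1 Fp \<and> in_class S2 Fm \<and> has_three_crossing_limit_cycles Fp Fm"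
proof -
  interpret two_lines S1 W1 E1 \<mu>1 "(801 / 2000)" "(261 / 625)" "(1 / 2)" "(- (2 / 5))" 0 S1_S2_right_Q
    S2 W2 E2 \<mu>2 "(- (277 / 1250))" "(- (211 / 1250))" "(76 / 625)" "(543 / 625)" 1 S1_S2_left_Q
    by (intro two_lines.intro S1_S2_right_line S1_S2_left_line)
  show ?thesis
  proof (rule three_limit_cycles_on_lines)
    show "line_box (- (41 / 20)) (- (49 / 25)) (29 / 10) (76 / 25)"
      unfolding line_box_def using S1_S2_box1 by simp
    show "line_box (- (117 / 50)) (- (229 / 100)) (71 / 20) (193 / 50)"
      unfolding line_box_def using S1_S2_box2 by simp
    show "line_box (- (147 / 50)) (- (57 / 20)) (533 / 100) (139 / 25)"
      unfolding line_box_def using S1_S2_box3 by simp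
  qed (simp_all add: W1_def W2_def power_divide zero_prod_def)
qed

section \<open>A system with \<open>S3\<close> on both sides\<close>

abbreviation "S3_S3_right_Q \<equiv> quad (285926957987 / 64000000000000) (1030014761349189 / 1280000000000000000) (232292909829663661 / 6400000000000000000000)"
abbreviation "S3_S3_right_num \<equiv> quad (7720027865649 / 32000000000000) (27810398556428103 / 640000000000000000) (6271908565400918847 / 3200000000000000000000)"
abbreviation "S3_S3_right_den \<equiv> quad (253 / 400) (122199 / 4000000) (- (101582283 / 160000000000))"
abbreviation "S3_S3_right_energy \<equiv> quad (58291 / 400) (84463659 / 4000000) (61742150109 / 80000000000)"
abbreviation "S3_S3_right_E \<equiv> line_side.line_E (E34 1) (- (5819 / 400000)) (67711 / 400000) (7 / 20) (23 / 10)"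
abbreviation "S3_S3_right_E' \<equiv> line_side.line_E' (\<mu>34 1) (- (5819 / 400000)) (67711 / 400000) (7 / 20) (23 / 10) 0 (S3_S3_right_Q)"

lemma S3_S3_right_line: "line_side S3 (W34 1) (E34 1) (\<mu>34 1) (- (5819 / 400000)) (67711 / 400000) (7 / 20) (23 / 10) 0 (S3_S3_right_Q)"
proof (intro line_side.intro line_side_axioms.intro affine_center.intro affine_center_axioms.intro)
  show "planar_center S3 (W34 1) (E34 1) (\<mu>34 1)" by (rule planar_center_S34[of 1, folded S3_eq]) simp
  show "(0 :: real) < (- (5819 / 400000))\<^sup>2 + (67711 / 400000)\<^sup>2" by (intro add_pos_pos) simp_all
  have om: "1 - 3 * ((- (5819 / 400000)) * y + (7 / 20))\<^sup>2 = S3_S3_right_den y" for y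
    by (simp add: quad_def power2_eq_square algebra_simps)
  have mem: "((- (5819 / 400000)) * y + (7 / 20), (67711 / 400000) * y + (23 / 10)) \<in> (W34 1) \<longleftrightarrow> 0 < S3_S3_right_den y" for y
    unfolding om[symmetric] by (simp add: W34_def)
  show "is_interval {y. ((- (5819 / 400000)) * y + (7 / 20), (67711 / 400000) * y + (23 / 10)) \<in> (W34 1)}"
    unfolding mem by (rule is_interval_quad) simp
  show "(- (5819 / 400000)) * snd (S3 ((- (5819 / 400000)) * y + (7 / 20), (67711 / 400000) * y + (23 / 10))) - (67711 / 400000) * fst (S3 ((- (5819 / 400000)) * y + (7 / 20), (67711 / 400000) * y + (23 / 10))) = (y - 0) * S3_S3_right_Q y" for y
    unfolding S3_eq by (rule S34_tangency) (simp_all add: power2_eq_square power3_eq_cube)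
  show "0 < S3_S3_right_Q y" for y
    by (rule quad_pos) (simp_all add: power2_eq_square)
qed

lemma S3_S3_right_E_eq: "S3_S3_right_E y = S3_S3_right_energy y / S3_S3_right_den y ^ 3"
proof -
  have "1 - 3 * 1 * ((- (5819 / 400000)) * y + (7 / 20))\<^sup>2 = S3_S3_right_den y" "27 * ((67711 / 400000) * y + (23 / 10))\<^sup>2 - 9 * ((- (5819 / 400000)) * y + (7 / 20))\<^sup>2 + 4 * 1 = S3_S3_right_energy y"
    by (simp_all add: quad_def power2_eq_square algebra_simps)
  then show ?thesis
    by (simp only: line_side.line_E_def[OF S3_S3_right_line] E34_def fst_conv snd_conv)
qed

lemma S3_S3_right_deriv: "S3_S3_right_E' y = (y - 0) * S3_S3_right_num y / (S3_S3_right_den y) ^ 4"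
proof -
  have den: "1 - 3 * ((- (5819 / 400000)) * y + (7 / 20))\<^sup>2 = S3_S3_right_den y"
    by (simp add: quad_def power2_eq_square algebra_simps)
  have num: "54 * S3_S3_right_Q y = S3_S3_right_num y"
    by (simp add: quad_def algebra_simps)
  have "\<mu>34 1 ((- (5819 / 400000)) * y + (7 / 20), (67711 / 400000) * y + (23 / 10)) = 54 / (S3_S3_right_den y) ^ 4"
    unfolding den[symmetric] by (simp add: \<mu>34_def)
  then show ?thesis
    unfolding line_side.line_E'_def[OF S3_S3_right_line] num[symmetric] by simp
qed

abbreviation "S3_S3_left_Q \<equiv> quad (25833178727413428789 / 163840000000000000000) (- (1077268103254495989 / 81920000000000000000)) (43489854691083189 / 163840000000000000000)"
abbreviation "S3_S3_left_num \<equiv> quad (697495825640162577303 / 81920000000000000000) (- (29086238787871391703 / 40960000000000000000)) (1174226076659246103 / 81920000000000000000)"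
abbreviation "S3_S3_left_den \<equiv> quad (983350717 / 1024000000) (- (12357117 / 512000000)) (- (3756483 / 1024000000))"
abbreviation "S3_S3_left_energy \<equiv> quad (135452700554141 / 320000000000) (- (6525043554141 / 160000000000)) (312586554141 / 320000000000)"
abbreviation "S3_S3_left_E \<equiv> line_side.line_E (E34 1) (- (1119 / 32000)) (- (153021 / 800000)) (- (3681 / 32000)) (3153021 / 800000)"
abbreviation "S3_S3_left_E' \<equiv> line_side.line_E' (\<mu>34 1) (- (1119 / 32000)) (- (153021 / 800000)) (- (3681 / 32000)) (3153021 / 800000) 1 (S3_S3_left_Q)"

lemma S3_S3_left_line: "line_side S3 (W34 1) (E34 1) (\<mu>34 1) (- (1119 / 32000)) (- (153021 / 800000)) (- (3681 / 32000)) (3153021 / 800000) 1 (S3_S3_left_Q)"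
proof (intro line_side.intro line_side_axioms.intro affine_center.intro affine_center_axioms.intro)
  show "planar_center S3 (W34 1) (E34 1) (\<mu>34 1)" by (rule planar_center_S34[of 1, folded S3_eq]) simp
  show "(0 :: real) < (- (1119 / 32000))\<^sup>2 + (- (153021 / 800000))\<^sup>2" by (intro add_pos_pos) simp_all
  have om: "1 - 3 * ((- (1119 / 32000)) * y + (- (3681 / 32000)))\<^sup>2 = S3_S3_left_den y" for y
    by (simp add: quad_def power2_eq_square algebra_simps)
  have mem: "((- (1119 / 32000)) * y + (- (3681 / 32000)), (- (153021 / 800000)) * y + (3153021 / 800000)) \<in> (W34 1) \<longleftrightarrow> 0 < S3_S3_left_den y" for y
    unfolding om[symmetric] by (simp add: W34_def)
  show "is_interval {y. ((- (1119 / 32000)) * y + (- (3681 / 32000)), (- (153021 / 800000)) * y + (3153021 / 800000)) \<in> (W34 1)}"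
    unfolding mem by (rule is_interval_quad) simp
  show "(- (1119 / 32000)) * snd (S3 ((- (1119 / 32000)) * y + (- (3681 / 32000)), (- (153021 / 800000)) * y + (3153021 / 800000))) - (- (153021 / 800000)) * fst (S3 ((- (1119 / 32000)) * y + (- (3681 / 32000)), (- (153021 / 800000)) * y + (3153021 / 800000))) = (y - 1) * S3_S3_left_Q y" for y
    unfolding S3_eq by (rule S34_tangency) (simp_all add: power2_eq_square power3_eq_cube)
  have "S3_S3_left_Q y = (73 / 1000) * S3_S3_left_den y + quad (14347642352853428789 / 163840000000000000000) (- (932936976694495989 / 81920000000000000000)) (87365576131083189 / 163840000000000000000) y" for y
    by (simp add: quad_def algebra_simps)
  moreover have "0 < quad (14347642352853428789 / 163840000000000000000) (- (932936976694495989 / 81920000000000000000)) (87365576131083189 / 163840000000000000000) y" for y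
    by (rule quad_pos) (simp_all add: power2_eq_square)
  ultimately show "0 < S3_S3_left_Q y" if "((- (1119 / 32000)) * y + (- (3681 / 32000)), (- (153021 / 800000)) * y + (3153021 / 800000)) \<in> (W34 1)" for y
    using that unfolding mem by (simp only:) (simp add: add_pos_pos)
qed

lemma S3_S3_left_E_eq: "S3_S3_left_E y = S3_S3_left_energy y / S3_S3_left_den y ^ 3"
proof -
  have "1 - 3 * 1 * ((- (1119 / 32000)) * y + (- (3681 / 32000)))\<^sup>2 = S3_S3_left_den y" "27 * ((- (153021 / 800000)) * y + (3153021 / 800000))\<^sup>2 - 9 * ((- (1119 / 32000)) * y + (- (3681 / 32000)))\<^sup>2 + 4 * 1 = S3_S3_left_energy y"
    by (simp_all add: quad_def power2_eq_square algebra_simps)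
  then show ?thesis
    by (simp only: line_side.line_E_def[OF S3_S3_left_line] E34_def fst_conv snd_conv)
qed

lemma S3_S3_left_deriv: "S3_S3_left_E' y = (y - 1) * S3_S3_left_num y / (S3_S3_left_den y) ^ 4"
proof -
  have den: "1 - 3 * ((- (1119 / 32000)) * y + (- (3681 / 32000)))\<^sup>2 = S3_S3_left_den y"
    by (simp add: quad_def power2_eq_square algebra_simps)
  have num: "54 * S3_S3_left_Q y = S3_S3_left_num y"
    by (simp add: quad_def algebra_simps)
  have "\<mu>34 1 ((- (1119 / 32000)) * y + (- (3681 / 32000)), (- (153021 / 800000)) * y + (3153021 / 800000)) = 54 / (S3_S3_left_den y) ^ 4"
    unfolding den[symmetric] by (simp add: \<mu>34_def)
  then show ?thesis
    unfolding line_side.line_E'_def[OF S3_S3_left_line] num[symmetric] by simp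
qed

lemma S3_S3_box1: "crossing_box S3_S3_right_E S3_S3_right_E' S3_S3_left_E S3_S3_left_E' (- (751 / 100)) (- (363 / 50)) (15 / 2) (769 / 100)"
  unfolding crossing_box_def
proof (intro conjI exI[of _ "(1 / 20)"] ballI)
  show "(- (751 / 100)) < ((- (363 / 50)) :: real)" "(15 / 2) < ((769 / 100) :: real)" by simp_all
  show "S3_S3_right_E (769 / 100) < S3_S3_right_E (- (751 / 100))"
    \<comment> \<open>619.1 separates the two values. The other numbers round the denominators, down
      for the smaller quotient and up for the larger one.\<close>
    unfolding S3_S3_right_E_eq by (rule quotient_less_pos[of "(6191 / 10)" "(20747 / 25000)" _ _ _ _ "(36727 / 100000)"]) (simp_all add: quad_numeric power3_eq_cube)
  show "S3_S3_right_E (- (363 / 50)) < S3_S3_right_E (15 / 2)"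
    unfolding S3_S3_right_E_eq by (rule quotient_less_pos[of "(6167 / 10)" "(9431 / 25000)" _ _ _ _ "(2581 / 3125)"]) (simp_all add: quad_numeric power3_eq_cube)
  show "S3_S3_left_E (15 / 2) < S3_S3_left_E (- (363 / 50))"
    unfolding S3_S3_left_E_eq by (rule quotient_less_pos[of "918" "(5729 / 10000)" _ _ _ _ "(4711 / 5000)"]) (simp_all add: quad_numeric power3_eq_cube)
  show "S3_S3_left_E (- (751 / 100)) < S3_S3_left_E (769 / 100)"
    unfolding S3_S3_left_E_eq by (rule quotient_less_pos[of "962" "(4673 / 5000)" _ _ _ _ "(2789 / 5000)"]) (simp_all add: quad_numeric power3_eq_cube)
  fix y :: real assume "y \<in> {(- (751 / 100))..(- (363 / 50))} \<union> {(15 / 2)..(769 / 100)}"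
  then show "S3_S3_right_E' y < (1 / 20) * S3_S3_left_E' y"
  proof
    assume y: "y \<in> {(- (751 / 100))..(- (363 / 50))}"
    show ?thesis unfolding S3_S3_right_deriv S3_S3_left_deriv
      \<comment> \<open>\<open>?D0.0\<close> only witnesses that the first denominator is positive,
        so a rough value is enough; the other numbers enter the inequality between the
        derivatives.\<close>
      by (rule quad_deriv_less_left[OF y, where ?A0.0 = "(127 / 5000)" and ?D0.0 = "(3 / 10)" and ?D1.0 = "(189 / 500)" and ?B1.0 = "(147 / 10)" and ?G0.0 = "(467 / 500)"])
        (simp_all add: quad_numeric power_divide)
  next
    assume y: "y \<in> {(15 / 2)..(769 / 100)}"
    show ?thesis unfolding S3_S3_right_deriv S3_S3_left_deriv
      by (rule quad_deriv_less_right[OF y, where ?A1.0 = "(173 / 250)" and ?D0.0 = "(33 / 40)" and ?B0.0 = "(39 / 10)" and ?G0.0 = "(1 / 2)" and ?G1.0 = "(573 / 1000)"])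
        (simp_all add: quad_numeric power_divide)
  qed
qed

lemma S3_S3_box2: "crossing_box S3_S3_left_E S3_S3_left_E' S3_S3_right_E S3_S3_right_E' (- (23 / 2)) (- (113 / 10)) (979 / 100) (493 / 50)"
  unfolding crossing_box_def
proof (intro conjI exI[of _ "102"] ballI)
  show "(- (23 / 2)) < ((- (113 / 10)) :: real)" "(979 / 100) < ((493 / 50) :: real)" by simp_all
  show "S3_S3_left_E (493 / 50) < S3_S3_left_E (- (23 / 2))"
    unfolding S3_S3_left_E_eq by (rule quotient_less_pos[of "2381" "(457 / 1250)" _ _ _ _ "(941 / 1250)"]) (simp_all add: quad_numeric power3_eq_cube)
  show "S3_S3_left_E (- (113 / 10)) < S3_S3_left_E (979 / 100)"
    unfolding S3_S3_left_E_eq by (rule quotient_less_pos[of "2263" "(191 / 250)" _ _ _ _ "(373 / 1000)"]) (simp_all add: quad_numeric power3_eq_cube)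
  show "S3_S3_right_E (979 / 100) < S3_S3_right_E (- (113 / 10))"
    unfolding S3_S3_right_E_eq by (rule quotient_less_pos[of "646" "(87073 / 100000)" _ _ _ _ "(10311 / 50000)"]) (simp_all add: quad_numeric power3_eq_cube)
  show "S3_S3_right_E (- (23 / 2)) < S3_S3_right_E (493 / 50)"
    unfolding S3_S3_right_E_eq by (rule quotient_less_pos[of "(16173 / 25)" "(197213 / 1000000)" _ _ _ _ "(871997 / 1000000)"]) (simp_all add: quad_numeric power3_eq_cube)
  fix y :: real assume "y \<in> {(- (23 / 2))..(- (113 / 10))} \<union> {(979 / 100)..(493 / 50)}"
  then show "S3_S3_left_E' y < 102 * S3_S3_right_E' y"
  proof
    assume y: "y \<in> {(- (23 / 2))..(- (113 / 10))}"
    show ?thesis unfolding S3_S3_left_deriv S3_S3_right_deriv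
      by (rule quad_deriv_less_left[OF y, where ?A0.0 = "(183 / 10)" and ?D0.0 = "(7 / 10)" and ?D1.0 = "(153 / 200)" and ?B1.0 = "(739 / 1000000)" and ?G0.0 = "(197 / 1000)"])
        (simp_all add: quad_numeric power_divide)
  next
    assume y: "y \<in> {(979 / 100)..(493 / 50)}"
    show ?thesis unfolding S3_S3_left_deriv S3_S3_right_deriv
      by (rule quad_deriv_less_right[OF y, where ?A1.0 = "(147 / 50)" and ?D0.0 = "(73 / 200)" and ?B0.0 = "(427 / 500)" and ?G0.0 = "(4 / 5)" and ?G1.0 = "(109 / 125)"])
        (simp_all add: quad_numeric power_divide)
  qed
qed

lemma S3_S3_box3: "crossing_box S3_S3_right_E S3_S3_right_E' S3_S3_left_E S3_S3_left_E' (- (59 / 5)) (- (1167 / 100)) (199 / 20) (1003 / 100)"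
  unfolding crossing_box_def
proof (intro conjI exI[of _ "(13 / 1250)"] ballI)
  show "(- (59 / 5)) < ((- (1167 / 100)) :: real)" "(199 / 20) < ((1003 / 100) :: real)" by simp_all
  show "S3_S3_right_E (1003 / 100) < S3_S3_right_E (- (59 / 5))"
    unfolding S3_S3_right_E_eq by (rule quotient_less_pos[of "(3248 / 5)" "(5469 / 6250)" _ _ _ _ "(9181 / 50000)"]) (simp_all add: quad_numeric power3_eq_cube)
  show "S3_S3_right_E (- (1167 / 100)) < S3_S3_right_E (199 / 20)"
    unfolding S3_S3_right_E_eq by (rule quotient_less_pos[of "(2593 / 4)" "(189519 / 1000000)" _ _ _ _ "(174723 / 200000)"]) (simp_all add: quad_numeric power3_eq_cube)
  show "S3_S3_left_E (199 / 20) < S3_S3_left_E (- (1167 / 100))"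
    unfolding S3_S3_left_E_eq by (rule quotient_less_pos[of "2514" "(3569 / 10000)" _ _ _ _ "(464 / 625)"]) (simp_all add: quad_numeric power3_eq_cube)
  show "S3_S3_left_E (- (59 / 5)) < S3_S3_left_E (1003 / 100)"
    unfolding S3_S3_left_E_eq by (rule quotient_less_pos[of "2632" "(7343 / 10000)" _ _ _ _ "(873 / 2500)"]) (simp_all add: quad_numeric power3_eq_cube)
  fix y :: real assume "y \<in> {(- (59 / 5))..(- (1167 / 100))} \<union> {(199 / 20)..(1003 / 100)}"
  then show "S3_S3_right_E' y < (13 / 1250) * S3_S3_left_E' y"
  proof
    assume y: "y \<in> {(- (59 / 5))..(- (1167 / 100))}"
    show ?thesis unfolding S3_S3_right_deriv S3_S3_left_deriv
      by (rule quad_deriv_less_left[OF y, where ?A0.0 = "(1 / 1000)" and ?D0.0 = "(1 / 10)" and ?D1.0 = "(19 / 100)" and ?B1.0 = "19" and ?G0.0 = "(73 / 100)"])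
        (simp_all add: quad_numeric power_divide)
  next
    assume y: "y \<in> {(199 / 20)..(1003 / 100)}"
    show ?thesis unfolding S3_S3_right_deriv S3_S3_left_deriv
      by (rule quad_deriv_less_right[OF y, where ?A1.0 = "(22 / 25)" and ?D0.0 = "(87 / 100)" and ?B0.0 = "(14 / 5)" and ?G0.0 = "(3 / 10)" and ?G1.0 = "(9 / 25)"])
        (simp_all add: quad_numeric power_divide)
  qed
qed

lemma S3_S3_three_limit_cycles: "\<exists>Fp Fm. in_class S3 Fp \<and> in_class S3 Fm \<and> has_three_crossing_limit_cycles Fp Fm"
proof -
  interpret two_lines S3 "W34 1" "E34 1" "\<mu>34 1" "(- (5819 / 400000))" "(67711 / 400000)" "(7 / 20)" "(23 / 10)" 0 S3_S3_right_Q
    S3 "W34 1" "E34 1" "\<mu>34 1" "(- (1119 / 32000))" "(- (153021 / 800000))" "(- (3681 / 32000))" "(3153021 / 800000)" 1 S3_S3_left_Q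
    by (intro two_lines.intro S3_S3_right_line S3_S3_left_line)
  show ?thesis
  proof (rule three_limit_cycles_on_lines)
    show "line_box (- (751 / 100)) (- (363 / 50)) (15 / 2) (769 / 100)"
      unfolding line_box_def using S3_S3_box1 by simp
    show "line_box (- (23 / 2)) (- (113 / 10)) (979 / 100) (493 / 50)"
      unfolding line_box_def using S3_S3_box2 by simp
    show "line_box (- (59 / 5)) (- (1167 / 100)) (199 / 20) (1003 / 100)"
      unfolding line_box_def using S3_S3_box3 by simp
  qed (simp_all add: W34_def power_divide)
qed

section \<open>A system with \<open>S3\<close> on the right and \<open>S4\<close> on the
  left\<close>

abbreviation "S3_S4_right_Q \<equiv> quad (4602377 / 62500000000) (- (1676875629 / 156250000000000)) (40851969301 / 97656250000000000)"
abbreviation "S3_S4_right_num \<equiv> quad (124264179 / 31250000000) (- (45275641983 / 78125000000000)) (1103003171127 / 48828125000000000)"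
abbreviation "S3_S4_right_den \<equiv> quad (13 / 25) (- (429 / 31250)) (- (61347 / 625000000))"
abbreviation "S3_S4_right_energy \<equiv> quad (3523 / 100) (- (348777 / 125000)) (17979741 / 312500000)"
abbreviation "S3_S4_right_E \<equiv> line_side.line_E (E34 1) (- (143 / 25000)) (- (1157 / 25000)) (- (2 / 5)) (11 / 10)"
abbreviation "S3_S4_right_E' \<equiv> line_side.line_E' (\<mu>34 1) (- (143 / 25000)) (- (1157 / 25000)) (- (2 / 5)) (11 / 10) 0 (S3_S4_right_Q)"

lemma S3_S4_right_line: "line_side S3 (W34 1) (E34 1) (\<mu>34 1) (- (143 / 25000)) (- (1157 / 25000)) (- (2 / 5)) (11 / 10) 0 (S3_S4_right_Q)"
proof (intro line_side.intro line_side_axioms.intro affine_center.intro affine_center_axioms.intro)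
  show "planar_center S3 (W34 1) (E34 1) (\<mu>34 1)" by (rule planar_center_S34[of 1, folded S3_eq]) simp
  show "(0 :: real) < (- (143 / 25000))\<^sup>2 + (- (1157 / 25000))\<^sup>2" by (intro add_pos_pos) simp_all
  have om: "1 - 3 * ((- (143 / 25000)) * y + (- (2 / 5)))\<^sup>2 = S3_S4_right_den y" for y
    by (simp add: quad_def power2_eq_square algebra_simps)
  have mem: "((- (143 / 25000)) * y + (- (2 / 5)), (- (1157 / 25000)) * y + (11 / 10)) \<in> (W34 1) \<longleftrightarrow> 0 < S3_S4_right_den y" for y
    unfolding om[symmetric] by (simp add: W34_def)
  show "is_interval {y. ((- (143 / 25000)) * y + (- (2 / 5)), (- (1157 / 25000)) * y + (11 / 10)) \<in> (W34 1)}"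
    unfolding mem by (rule is_interval_quad) simp
  show "(- (143 / 25000)) * snd (S3 ((- (143 / 25000)) * y + (- (2 / 5)), (- (1157 / 25000)) * y + (11 / 10))) - (- (1157 / 25000)) * fst (S3 ((- (143 / 25000)) * y + (- (2 / 5)), (- (1157 / 25000)) * y + (11 / 10))) = (y - 0) * S3_S4_right_Q y" for y
    unfolding S3_eq by (rule S34_tangency) (simp_all add: power2_eq_square power3_eq_cube)
  show "0 < S3_S4_right_Q y" for y
    by (rule quad_pos) (simp_all add: power2_eq_square)
qed

lemma S3_S4_right_E_eq: "S3_S4_right_E y = S3_S4_right_energy y / S3_S4_right_den y ^ 3"
proof -
  have "1 - 3 * 1 * ((- (143 / 25000)) * y + (- (2 / 5)))\<^sup>2 = S3_S4_right_den y" "27 * ((- (1157 / 25000)) * y + (11 / 10))\<^sup>2 - 9 * ((- (143 / 25000)) * y + (- (2 / 5)))\<^sup>2 + 4 * 1 = S3_S4_right_energy y"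
    by (simp_all add: quad_def power2_eq_square algebra_simps)
  then show ?thesis
    by (simp only: line_side.line_E_def[OF S3_S4_right_line] E34_def fst_conv snd_conv)
qed

lemma S3_S4_right_deriv: "S3_S4_right_E' y = (y - 0) * S3_S4_right_num y / (S3_S4_right_den y) ^ 4"
proof -
  have den: "1 - 3 * ((- (143 / 25000)) * y + (- (2 / 5)))\<^sup>2 = S3_S4_right_den y"
    by (simp add: quad_def power2_eq_square algebra_simps)
  have num: "54 * S3_S4_right_Q y = S3_S4_right_num y"
    by (simp add: quad_def algebra_simps)
  have "\<mu>34 1 ((- (143 / 25000)) * y + (- (2 / 5)), (- (1157 / 25000)) * y + (11 / 10)) = 54 / (S3_S4_right_den y) ^ 4"
    unfolding den[symmetric] by (simp add: \<mu>34_def)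
  then show ?thesis
    unfolding line_side.line_E'_def[OF S3_S4_right_line] num[symmetric] by simp
qed

abbreviation "S3_S4_left_Q \<equiv> quad (5809947266787237 / 12500000000000000000) (- (16958013573487 / 6250000000000000000)) (- (44152140263 / 12500000000000000000))"
abbreviation "S3_S4_left_num \<equiv> quad (156868576203255399 / 6250000000000000000) (- (457866366484149 / 3125000000000000000)) (- (1192107787101 / 6250000000000000000))"
abbreviation "S3_S4_left_den \<equiv> quad (8667962947 / 2500000000) (- (46657947 / 1250000000)) (352947 / 2500000000)"
abbreviation "S3_S4_left_dom \<equiv> quad (71954902417 / 10000000000) (- (1125762417 / 5000000000)) (- (3377583 / 10000000000))"
abbreviation "S3_S4_left_energy \<equiv> quad (- (71954902417 / 10000000000)) (1125762417 / 5000000000) (3377583 / 10000000000)"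
abbreviation "S3_S4_left_E \<equiv> line_side.line_E (E34 (- 1)) (343 / 50000) (- (531 / 100000)) (- (45343 / 50000)) (- (39469 / 100000))"
abbreviation "S3_S4_left_E' \<equiv> line_side.line_E' (\<mu>34 (- 1)) (343 / 50000) (- (531 / 100000)) (- (45343 / 50000)) (- (39469 / 100000)) 1 (S3_S4_left_Q)"

lemma S3_S4_left_line: "line_side S4 (W34 (- 1)) (E34 (- 1)) (\<mu>34 (- 1)) (343 / 50000) (- (531 / 100000)) (- (45343 / 50000)) (- (39469 / 100000)) 1 (S3_S4_left_Q)"
proof (intro line_side.intro line_side_axioms.intro affine_center.intro affine_center_axioms.intro)
  show "planar_center S4 (W34 (- 1)) (E34 (- 1)) (\<mu>34 (- 1))" by (rule planar_center_S34[of "- 1", folded S4_eq]) simp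
  show "(0 :: real) < (343 / 50000)\<^sup>2 + (- (531 / 100000))\<^sup>2" by (intro add_pos_pos) simp_all
  have om: "9 * ((343 / 50000) * y + (- (45343 / 50000)))\<^sup>2 + 4 - 27 * ((- (531 / 100000)) * y + (- (39469 / 100000)))\<^sup>2 = S3_S4_left_dom y" for y
    by (simp add: quad_def power2_eq_square algebra_simps)
  \<comment> \<open>For e = -1 the first condition in \<open>W34\<close> holds everywhere, so the
    energy condition alone cuts out the domain; the domain quadratic is the negative of the energy
    quadratic.\<close>
  have "0 < 1 + 3 * ((343 / 50000) * y + (- (45343 / 50000)))\<^sup>2" for y :: real
    by (intro add_pos_nonneg) simp_all
  then have mem: "((343 / 50000) * y + (- (45343 / 50000)), (- (531 / 100000)) * y + (- (39469 / 100000))) \<in> W34 (- 1) \<longleftrightarrow> 0 < S3_S4_left_dom y" for y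
    unfolding om[symmetric] by (simp add: W34_def)
  show "is_interval {y. ((343 / 50000) * y + (- (45343 / 50000)), (- (531 / 100000)) * y + (- (39469 / 100000))) \<in> (W34 (- 1))}"
    unfolding mem by (rule is_interval_quad) simp
  show "(343 / 50000) * snd (S4 ((343 / 50000) * y + (- (45343 / 50000)), (- (531 / 100000)) * y + (- (39469 / 100000)))) - (- (531 / 100000)) * fst (S4 ((343 / 50000) * y + (- (45343 / 50000)), (- (531 / 100000)) * y + (- (39469 / 100000)))) = (y - 1) * S3_S4_left_Q y" for y
    unfolding S4_eq by (rule S34_tangency) (simp_all add: power2_eq_square power3_eq_cube)
  have "S3_S4_left_Q y = (3 / 250000) * S3_S4_left_dom y + quad (4730623730532237 / 12500000000000000000) (- (71577318487 / 6250000000000000000)) (6511604737 / 12500000000000000000) y" for y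
    by (simp add: quad_def algebra_simps)
  moreover have "0 < quad (4730623730532237 / 12500000000000000000) (- (71577318487 / 6250000000000000000)) (6511604737 / 12500000000000000000) y" for y
    by (rule quad_pos) (simp_all add: power2_eq_square)
  ultimately show "0 < S3_S4_left_Q y" if "((343 / 50000) * y + (- (45343 / 50000)), (- (531 / 100000)) * y + (- (39469 / 100000))) \<in> (W34 (- 1))" for y
    using that unfolding mem by (simp only:) (simp add: add_pos_pos)
qed

lemma S3_S4_left_E_eq: "S3_S4_left_E y = S3_S4_left_energy y / S3_S4_left_den y ^ 3"
proof -
  have "1 - 3 * (- 1) * ((343 / 50000) * y + (- (45343 / 50000)))\<^sup>2 = S3_S4_left_den y" "27 * ((- (531 / 100000)) * y + (- (39469 / 100000)))\<^sup>2 - 9 * ((343 / 50000) * y + (- (45343 / 50000)))\<^sup>2 + 4 * (- 1) = S3_S4_left_energy y"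
    by (simp_all add: quad_def power2_eq_square algebra_simps)
  then show ?thesis
    by (simp only: line_side.line_E_def[OF S3_S4_left_line] E34_def fst_conv snd_conv)
qed

lemma S3_S4_left_deriv: "S3_S4_left_E' y = (y - 1) * S3_S4_left_num y / (S3_S4_left_den y) ^ 4"
proof -
  have den: "1 + 3 * ((343 / 50000) * y + (- (45343 / 50000)))\<^sup>2 = S3_S4_left_den y"
    by (simp add: quad_def power2_eq_square algebra_simps)
  have num: "54 * S3_S4_left_Q y = S3_S4_left_num y"
    by (simp add: quad_def algebra_simps)
  have "\<mu>34 (- 1) ((343 / 50000) * y + (- (45343 / 50000)), (- (531 / 100000)) * y + (- (39469 / 100000))) = 54 / (S3_S4_left_den y) ^ 4"
    unfolding den[symmetric] by (simp add: \<mu>34_def)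
  then show ?thesis
    unfolding line_side.line_E'_def[OF S3_S4_left_line] num[symmetric] by simp
qed

lemma S3_S4_box1: "crossing_box S3_S4_right_E S3_S4_right_E' S3_S4_left_E S3_S4_left_E' (- (29 / 5)) (- (51 / 10)) (31 / 5) (69 / 10)"
  unfolding crossing_box_def
proof (intro conjI exI[of _ "274"] ballI)
  show "(- (29 / 5)) < ((- (51 / 10)) :: real)" "(31 / 5) < ((69 / 10) :: real)" by simp_all
  show "S3_S4_right_E (69 / 10) < S3_S4_right_E (- (29 / 5))"
    unfolding S3_S4_right_E_eq by (rule quotient_less_pos[of "(6289 / 25)" "(2103 / 5000)" _ _ _ _ "(59633 / 100000)"]) (simp_all add: quad_numeric power3_eq_cube)
  show "S3_S4_right_E (- (51 / 10)) < S3_S4_right_E (31 / 5)"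
    unfolding S3_S4_right_E_eq by (rule quotient_less_pos[of "(6284 / 25)" "(11749 / 20000)" _ _ _ _ "(5389 / 12500)"]) (simp_all add: quad_numeric power3_eq_cube)
  show "S3_S4_left_E (31 / 5) < S3_S4_left_E (- (51 / 10))"
    unfolding S3_S4_left_E_eq by (rule quotient_less_neg[of "(- (1699 / 10000))" _ "(8103 / 2500)" _ _ "(9153 / 2500)"]) (simp_all add: quad_numeric power3_eq_cube)
  show "S3_S4_left_E (- (29 / 5)) < S3_S4_left_E (69 / 10)"
    unfolding S3_S4_left_E_eq by (rule quotient_less_neg[of "(- (4229 / 25000))" _ "(7377 / 2000)" _ _ "(32163 / 10000)"]) (simp_all add: quad_numeric power3_eq_cube)
  fix y :: real assume "y \<in> {(- (29 / 5))..(- (51 / 10))} \<union> {(31 / 5)..(69 / 10)}"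
  then show "S3_S4_right_E' y < 274 * S3_S4_left_E' y"
  proof
    assume y: "y \<in> {(- (29 / 5))..(- (51 / 10))}"
    show ?thesis unfolding S3_S4_right_deriv S3_S4_left_deriv
      by (rule quad_deriv_less_left[OF y, where ?A0.0 = "(3 / 400)" and ?D0.0 = "(1 / 2)" and ?D1.0 = "(3 / 5)" and ?B1.0 = "(13 / 500)" and ?G0.0 = "(18 / 5)"])
        (simp_all add: quad_numeric power_divide)
  next
    assume y: "y \<in> {(31 / 5)..(69 / 10)}"
    show ?thesis unfolding S3_S4_right_deriv S3_S4_left_deriv
      by (rule quad_deriv_less_right[OF y, where ?A1.0 = "(13 / 10000)" and ?D0.0 = "(21 / 50)" and ?B0.0 = "(3 / 125)" and ?G0.0 = "3" and ?G1.0 = "(33 / 10)"])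
        (simp_all add: quad_numeric power_divide)
  qed
qed

lemma S3_S4_box2: "crossing_box S3_S4_left_E S3_S4_left_E' S3_S4_right_E S3_S4_right_E' (- (234 / 5)) (- (204 / 5)) (107 / 5) (221 / 10)"
  unfolding crossing_box_def
proof (intro conjI exI[of _ "(23 / 100000)"] ballI)
  show "(- (234 / 5)) < ((- (204 / 5)) :: real)" "(107 / 5) < ((221 / 10) :: real)" by simp_all
  show "S3_S4_left_E (221 / 10) < S3_S4_left_E (- (234 / 5))"
    unfolding S3_S4_left_E_eq by (rule quotient_less_neg[of "(- (51 / 500))" _ "(68 / 25)" _ _ "(138 / 25)"]) (simp_all add: quad_numeric power3_eq_cube)
  show "S3_S4_left_E (- (204 / 5)) < S3_S4_left_E (107 / 5)"
    unfolding S3_S4_left_E_eq by (rule quotient_less_neg[of "(- (11 / 100))" _ "(523 / 100)" _ _ "(273 / 100)"]) (simp_all add: quad_numeric power3_eq_cube)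
  show "S3_S4_right_E (107 / 5) < S3_S4_right_E (- (204 / 5))"
    unfolding S3_S4_right_E_eq by (rule quotient_less_pos[of "315" "(453 / 2500)" _ _ _ _ "(573 / 625)"]) (simp_all add: quad_numeric power3_eq_cube)
  show "S3_S4_right_E (- (234 / 5)) < S3_S4_right_E (221 / 10)"
    unfolding S3_S4_right_E_eq by (rule quotient_less_pos[of "345" "(947 / 1000)" _ _ _ _ "(169 / 1000)"]) (simp_all add: quad_numeric power3_eq_cube)
  fix y :: real assume "y \<in> {(- (234 / 5))..(- (204 / 5))} \<union> {(107 / 5)..(221 / 10)}"
  then show "S3_S4_left_E' y < (23 / 100000) * S3_S4_right_E' y"
  proof
    assume y: "y \<in> {(- (234 / 5))..(- (204 / 5))}"
    show ?thesis unfolding S3_S4_left_deriv S3_S4_right_deriv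
      by (rule quad_deriv_less_left[OF y, where ?A0.0 = "(307 / 10000)" and ?D0.0 = "5" and ?D1.0 = "(553 / 100)" and ?B1.0 = "(403 / 5000)" and ?G0.0 = "(229 / 250)"])
        (simp_all add: quad_numeric power_divide)
  next
    assume y: "y \<in> {(107 / 5)..(221 / 10)}"
    show ?thesis unfolding S3_S4_left_deriv S3_S4_right_deriv
      by (rule quad_deriv_less_right[OF y, where ?A1.0 = "(219 / 10000)" and ?D0.0 = "(271 / 100)" and ?B0.0 = "(191 / 100000)" and ?G0.0 = "(1 / 10)" and ?G1.0 = "(91 / 500)"])
        (simp_all add: quad_numeric power_divide)
  qed
qed

lemma S3_S4_box3: "crossing_box S3_S4_right_E S3_S4_right_E' S3_S4_left_E S3_S4_left_E' (- (807 / 5)) (- (1537 / 10)) (147 / 5) (297 / 10)"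
  unfolding crossing_box_def
\<comment> \<open>The constant is huge because the upper edge lies close to the boundary 1 - 3 x^2 =
  0 of the domain of \<open>S3\<close>: \<open>S3_S4_right_den\<close> is about 0.03 there, and its
  fourth power divides the derivative.\<close>
proof (intro conjI exI[of _ "31085598"] ballI)
  show "(- (807 / 5)) < ((- (1537 / 10)) :: real)" "(147 / 5) < ((297 / 10) :: real)" by simp_all
  show "S3_S4_right_E (297 / 10) < S3_S4_right_E (- (807 / 5))"
    unfolding S3_S4_right_E_eq by (rule quotient_less_pos[of "224390" "(1 / 40)" _ _ _ _ "(9 / 50)"]) (simp_all add: quad_numeric power3_eq_cube)
  show "S3_S4_right_E (- (1537 / 10)) < S3_S4_right_E (147 / 5)"
    unfolding S3_S4_right_E_eq by (rule quotient_less_pos[of "68673" "(31 / 100)" _ _ _ _ "(4 / 125)"]) (simp_all add: quad_numeric power3_eq_cube)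
  show "S3_S4_left_E (147 / 5) < S3_S4_left_E (- (1537 / 10))"
    unfolding S3_S4_left_E_eq by (rule quotient_less_neg[of "(- (9 / 500))" _ "(5 / 2)" _ _ "(25 / 2)"]) (simp_all add: quad_numeric power3_eq_cube)
  show "S3_S4_left_E (- (807 / 5)) < S3_S4_left_E (297 / 10)"
    unfolding S3_S4_left_E_eq by (rule quotient_less_neg[of "(- (29 / 2000))" _ "(66 / 5)" _ _ "(62 / 25)"]) (simp_all add: quad_numeric power3_eq_cube)
  fix y :: real assume "y \<in> {(- (807 / 5))..(- (1537 / 10))} \<union> {(147 / 5)..(297 / 10)}"
  then show "S3_S4_right_E' y < 31085598 * S3_S4_left_E' y"
  proof
    assume y: "y \<in> {(- (807 / 5))..(- (1537 / 10))}"
    show ?thesis unfolding S3_S4_right_deriv S3_S4_left_deriv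
      by (rule quad_deriv_less_left[OF y, where ?A0.0 = "(313 / 500)" and ?D0.0 = "(1 / 10)" and ?D1.0 = "(313 / 1000)" and ?B1.0 = "(219 / 5000)" and ?G0.0 = "(25 / 2)"])
        (simp_all add: quad_numeric power_divide)
  next
    assume y: "y \<in> {(147 / 5)..(297 / 10)}"
    show ?thesis unfolding S3_S4_right_deriv S3_S4_left_deriv
      by (rule quad_deriv_less_right[OF y, where ?A1.0 = "(67 / 10000)" and ?D0.0 = "(16 / 625)" and ?B0.0 = "(41 / 2000)" and ?G0.0 = "2" and ?G1.0 = "(5 / 2)"])
        (simp_all add: quad_numeric power_divide)
  qed
qed

lemma S3_S4_three_limit_cycles: "\<exists>Fp Fm. in_class S3 Fp \<and> in_class S4 Fm \<and> has_three_crossing_limit_cycles Fp Fm"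
proof -
  interpret two_lines S3 "W34 1" "E34 1" "\<mu>34 1" "(- (143 / 25000))" "(- (1157 / 25000))" "(- (2 / 5))" "(11 / 10)" 0 S3_S4_right_Q
    S4 "W34 (- 1)" "E34 (- 1)" "\<mu>34 (- 1)" "(343 / 50000)" "(- (531 / 100000))" "(- (45343 / 50000))" "(- (39469 / 100000))" 1 S3_S4_left_Q
    by (intro two_lines.intro S3_S4_right_line S3_S4_left_line)
  show ?thesis
  proof (rule three_limit_cycles_on_lines)
    show "line_box (- (29 / 5)) (- (51 / 10)) (31 / 5) (69 / 10)"
      unfolding line_box_def using S3_S4_box1 by simp
    show "line_box (- (234 / 5)) (- (204 / 5)) (107 / 5) (221 / 10)"
      unfolding line_box_def using S3_S4_box2 by simp
    show "line_box (- (807 / 5)) (- (1537 / 10)) (147 / 5) (297 / 10)"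
      unfolding line_box_def using S3_S4_box3 by simp
  qed (simp_all add: W34_def power_divide)
qed

section \<open>A system with \<open>S4\<close> on both sides\<close>

abbreviation "S4_S4_right_Q \<equiv> quad (508717 / 10000000000) (1167711 / 5000000000000) (- (81360421 / 40000000000000000))"
abbreviation "S4_S4_right_num \<equiv> quad (13735359 / 5000000000) (31528197 / 2500000000000) (- (2196731367 / 20000000000000000))"
abbreviation "S4_S4_right_den \<equiv> quad (103 / 100) (309 / 100000) (31827 / 400000000)"
abbreviation "S4_S4_right_dom \<equiv> quad (191 / 50) (1719 / 50000) (- (69021 / 200000000))"
abbreviation "S4_S4_right_energy \<equiv> quad (- (191 / 50)) (- (1719 / 50000)) (69021 / 200000000)"
abbreviation "S4_S4_right_E \<equiv> line_side.line_E (E34 (- 1)) (103 / 20000) (93 / 20000) (1 / 10) (- (1 / 10))"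
abbreviation "S4_S4_right_E' \<equiv> line_side.line_E' (\<mu>34 (- 1)) (103 / 20000) (93 / 20000) (1 / 10) (- (1 / 10)) 0 (S4_S4_right_Q)"

lemma S4_S4_right_line: "line_side S4 (W34 (- 1)) (E34 (- 1)) (\<mu>34 (- 1)) (103 / 20000) (93 / 20000) (1 / 10) (- (1 / 10)) 0 (S4_S4_right_Q)"
proof (intro line_side.intro line_side_axioms.intro affine_center.intro affine_center_axioms.intro)
  show "planar_center S4 (W34 (- 1)) (E34 (- 1)) (\<mu>34 (- 1))" by (rule planar_center_S34[of "- 1", folded S4_eq]) simp
  show "(0 :: real) < (103 / 20000)\<^sup>2 + (93 / 20000)\<^sup>2" by (intro add_pos_pos) simp_all
  have om: "9 * ((103 / 20000) * y + (1 / 10))\<^sup>2 + 4 - 27 * ((93 / 20000) * y + (- (1 / 10)))\<^sup>2 = S4_S4_right_dom y" for y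
    by (simp add: quad_def power2_eq_square algebra_simps)
  have "0 < 1 + 3 * ((103 / 20000) * y + (1 / 10))\<^sup>2" for y :: real
    by (intro add_pos_nonneg) simp_all
  then have mem: "((103 / 20000) * y + (1 / 10), (93 / 20000) * y + (- (1 / 10))) \<in> W34 (- 1) \<longleftrightarrow> 0 < S4_S4_right_dom y" for y
    unfolding om[symmetric] by (simp add: W34_def)
  show "is_interval {y. ((103 / 20000) * y + (1 / 10), (93 / 20000) * y + (- (1 / 10))) \<in> (W34 (- 1))}"
    unfolding mem by (rule is_interval_quad) simp
  show "(103 / 20000) * snd (S4 ((103 / 20000) * y + (1 / 10), (93 / 20000) * y + (- (1 / 10)))) - (93 / 20000) * fst (S4 ((103 / 20000) * y + (1 / 10), (93 / 20000) * y + (- (1 / 10)))) = (y - 0) * S4_S4_right_Q y" for y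
    unfolding S4_eq by (rule S34_tangency) (simp_all add: power2_eq_square power3_eq_cube)
  have "S4_S4_right_Q y = (67 / 10000000) * S4_S4_right_dom y + quad (252777 / 10000000000) (15981 / 5000000000000) (11127719 / 40000000000000000) y" for y
    by (simp add: quad_def algebra_simps)
  moreover have "0 < quad (252777 / 10000000000) (15981 / 5000000000000) (11127719 / 40000000000000000) y" for y
    by (rule quad_pos) (simp_all add: power2_eq_square)
  ultimately show "0 < S4_S4_right_Q y" if "((103 / 20000) * y + (1 / 10), (93 / 20000) * y + (- (1 / 10))) \<in> (W34 (- 1))" for y
    using that unfolding mem by (simp only:) (simp add: add_pos_pos)
qed

lemma S4_S4_right_E_eq: "S4_S4_right_E y = S4_S4_right_energy y / S4_S4_right_den y ^ 3"
proof -
  have "1 - 3 * (- 1) * ((103 / 20000) * y + (1 / 10))\<^sup>2 = S4_S4_right_den y" "27 * ((93 / 20000) * y + (- (1 / 10)))\<^sup>2 - 9 * ((103 / 20000) * y + (1 / 10))\<^sup>2 + 4 * (- 1) = S4_S4_right_energy y"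
    by (simp_all add: quad_def power2_eq_square algebra_simps)
  then show ?thesis
    by (simp only: line_side.line_E_def[OF S4_S4_right_line] E34_def fst_conv snd_conv)
qed

lemma S4_S4_right_deriv: "S4_S4_right_E' y = (y - 0) * S4_S4_right_num y / (S4_S4_right_den y) ^ 4"
proof -
  have den: "1 + 3 * ((103 / 20000) * y + (1 / 10))\<^sup>2 = S4_S4_right_den y"
    by (simp add: quad_def power2_eq_square algebra_simps)
  have num: "54 * S4_S4_right_Q y = S4_S4_right_num y"
    by (simp add: quad_def algebra_simps)
  have "\<mu>34 (- 1) ((103 / 20000) * y + (1 / 10), (93 / 20000) * y + (- (1 / 10))) = 54 / (S4_S4_right_den y) ^ 4"
    unfolding den[symmetric] by (simp add: \<mu>34_def)
  then show ?thesis
    unfolding line_side.line_E'_def[OF S4_S4_right_line] num[symmetric] by simp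
qed

abbreviation "S4_S4_left_Q \<equiv> quad (43221816036 / 95367431640625) (- (3717190197 / 95367431640625)) (91858536 / 95367431640625)"
abbreviation "S4_S4_left_num \<equiv> quad (2333978065944 / 95367431640625) (- (200728270638 / 95367431640625)) (4960360944 / 95367431640625)"
abbreviation "S4_S4_left_den \<equiv> quad (11273668 / 9765625) (- (357336 / 9765625)) (21168 / 9765625)"
abbreviation "S4_S4_left_dom \<equiv> quad (20534677 / 9765625) (- (1745604 / 9765625)) (234333 / 39062500)"
abbreviation "S4_S4_left_energy \<equiv> quad (- (20534677 / 9765625)) (1745604 / 9765625) (- (234333 / 39062500))"
abbreviation "S4_S4_left_E \<equiv> line_side.line_E (E34 (- 1)) (- (84 / 3125)) (27 / 6250) (709 / 3125) (924 / 3125)"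
abbreviation "S4_S4_left_E' \<equiv> line_side.line_E' (\<mu>34 (- 1)) (- (84 / 3125)) (27 / 6250) (709 / 3125) (924 / 3125) 1 (S4_S4_left_Q)"

lemma S4_S4_left_line: "line_side S4 (W34 (- 1)) (E34 (- 1)) (\<mu>34 (- 1)) (- (84 / 3125)) (27 / 6250) (709 / 3125) (924 / 3125) 1 (S4_S4_left_Q)"
proof (intro line_side.intro line_side_axioms.intro affine_center.intro affine_center_axioms.intro)
  show "planar_center S4 (W34 (- 1)) (E34 (- 1)) (\<mu>34 (- 1))" by (rule planar_center_S34[of "- 1", folded S4_eq]) simp
  show "(0 :: real) < (- (84 / 3125))\<^sup>2 + (27 / 6250)\<^sup>2" by (intro add_pos_pos) simp_all
  have om: "9 * ((- (84 / 3125)) * y + (709 / 3125))\<^sup>2 + 4 - 27 * ((27 / 6250) * y + (924 / 3125))\<^sup>2 = S4_S4_left_dom y" for y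
    by (simp add: quad_def power2_eq_square algebra_simps)
  have "0 < 1 + 3 * ((- (84 / 3125)) * y + (709 / 3125))\<^sup>2" for y :: real
    by (intro add_pos_nonneg) simp_all
  then have mem: "((- (84 / 3125)) * y + (709 / 3125), (27 / 6250) * y + (924 / 3125)) \<in> W34 (- 1) \<longleftrightarrow> 0 < S4_S4_left_dom y" for y
    unfolding om[symmetric] by (simp add: W34_def)
  \<comment> \<open>This line misses the hyperbola 27 y^2 = 9 x^2 + 4, so it lies in the domain
    entirely.\<close>
  have "0 < S4_S4_left_dom y" for y
    by (rule quad_pos) (simp_all add: power2_eq_square)
  then show "is_interval {y. ((- (84 / 3125)) * y + (709 / 3125), (27 / 6250) * y + (924 / 3125)) \<in> (W34 (- 1))}"
    unfolding mem by (simp add: is_interval_univ)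
  show "(- (84 / 3125)) * snd (S4 ((- (84 / 3125)) * y + (709 / 3125), (27 / 6250) * y + (924 / 3125))) - (27 / 6250) * fst (S4 ((- (84 / 3125)) * y + (709 / 3125), (27 / 6250) * y + (924 / 3125))) = (y - 1) * S4_S4_left_Q y" for y
    unfolding S4_eq by (rule S34_tangency) (simp_all add: power2_eq_square power3_eq_cube)
  show "0 < S4_S4_left_Q y" for y
    by (rule quad_pos) (simp_all add: power2_eq_square)
qed

lemma S4_S4_left_E_eq: "S4_S4_left_E y = S4_S4_left_energy y / S4_S4_left_den y ^ 3"
proof -
  have "1 - 3 * (- 1) * ((- (84 / 3125)) * y + (709 / 3125))\<^sup>2 = S4_S4_left_den y" "27 * ((27 / 6250) * y + (924 / 3125))\<^sup>2 - 9 * ((- (84 / 3125)) * y + (709 / 3125))\<^sup>2 + 4 * (- 1) = S4_S4_left_energy y"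
    by (simp_all add: quad_def power2_eq_square algebra_simps)
  then show ?thesis
    by (simp only: line_side.line_E_def[OF S4_S4_left_line] E34_def fst_conv snd_conv)
qed

lemma S4_S4_left_deriv: "S4_S4_left_E' y = (y - 1) * S4_S4_left_num y / (S4_S4_left_den y) ^ 4"
proof -
  have den: "1 + 3 * ((- (84 / 3125)) * y + (709 / 3125))\<^sup>2 = S4_S4_left_den y"
    by (simp add: quad_def power2_eq_square algebra_simps)
  have num: "54 * S4_S4_left_Q y = S4_S4_left_num y"
    by (simp add: quad_def algebra_simps)
  have "\<mu>34 (- 1) ((- (84 / 3125)) * y + (709 / 3125), (27 / 6250) * y + (924 / 3125)) = 54 / (S4_S4_left_den y) ^ 4"
    unfolding den[symmetric] by (simp add: \<mu>34_def)
  then show ?thesis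
    unfolding line_side.line_E'_def[OF S4_S4_left_line] num[symmetric] by simp
qed

lemma S4_S4_box1: "crossing_box S4_S4_right_E S4_S4_right_E' S4_S4_left_E S4_S4_left_E' (- (1049 / 100)) (- (999 / 100)) (211 / 20) (1103 / 100)"
  unfolding crossing_box_def
proof (intro conjI exI[of _ "(37 / 100)"] ballI)
  show "(- (1049 / 100)) < ((- (999 / 100)) :: real)" "(211 / 20) < ((1103 / 100) :: real)" by simp_all
  show "S4_S4_right_E (1103 / 100) < S4_S4_right_E (- (1049 / 100))"
    unfolding S4_S4_right_E_eq by (rule quotient_less_neg[of "(- (1343 / 400))" _ "(107377 / 100000)" _ _ "(50317 / 50000)"]) (simp_all add: quad_numeric power3_eq_cube)
  show "S4_S4_right_E (- (999 / 100)) < S4_S4_right_E (211 / 20)"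
    unfolding S4_S4_right_E_eq by (rule quotient_less_neg[of "(- (6739 / 2000))" _ "(25177 / 25000)" _ _ "(21429 / 20000)"]) (simp_all add: quad_numeric power3_eq_cube)
  show "S4_S4_left_E (211 / 20) < S4_S4_left_E (- (999 / 100))"
    unfolding S4_S4_left_E_eq by (rule quotient_less_neg[of "(- (429 / 500))" _ "(101 / 100)" _ _ "(217 / 125)"]) (simp_all add: quad_numeric power3_eq_cube)
  show "S4_S4_left_E (- (1049 / 100)) < S4_S4_left_E (1103 / 100)"
    unfolding S4_S4_left_E_eq by (rule quotient_less_neg[of "(- (413 / 500))" _ "(1777 / 1000)" _ _ "(507 / 500)"]) (simp_all add: quad_numeric power3_eq_cube)
  fix y :: real assume "y \<in> {(- (1049 / 100))..(- (999 / 100))} \<union> {(211 / 20)..(1103 / 100)}"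
  then show "S4_S4_right_E' y < (37 / 100) * S4_S4_left_E' y"
  proof
    assume y: "y \<in> {(- (1049 / 100))..(- (999 / 100))}"
    show ?thesis unfolding S4_S4_right_deriv S4_S4_left_deriv
      by (rule quad_deriv_less_left[OF y, where ?A0.0 = "(13 / 5000)" and ?D0.0 = "1" and ?D1.0 = "(101 / 100)" and ?B1.0 = "(523 / 10000)" and ?G0.0 = "(173 / 100)"])
        (simp_all add: quad_numeric power_divide)
  next
    assume y: "y \<in> {(211 / 20)..(1103 / 100)}"
    show ?thesis unfolding S4_S4_right_deriv S4_S4_left_deriv
      by (rule quad_deriv_less_right[OF y, where ?A1.0 = "(9 / 3125)" and ?D0.0 = "(107 / 100)" and ?B0.0 = "(379 / 50000)" and ?G0.0 = "1" and ?G1.0 = "(51 / 50)"])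
        (simp_all add: quad_numeric power_divide)
  qed
qed

lemma S4_S4_box2: "crossing_box S4_S4_left_E S4_S4_left_E' S4_S4_right_E S4_S4_right_E' (- (101 / 5)) (- (98 / 5)) (108 / 5) (113 / 5)"
  unfolding crossing_box_def
proof (intro conjI exI[of _ "(59 / 100)"] ballI)
  show "(- (101 / 5)) < ((- (98 / 5)) :: real)" "(108 / 5) < ((113 / 5) :: real)" by simp_all
  show "S4_S4_left_E (113 / 5) < S4_S4_left_E (- (101 / 5))"
    unfolding S4_S4_left_E_eq by (rule quotient_less_neg[of "(- (381 / 1000))" _ "(287 / 200)" _ _ "(1389 / 500)"]) (simp_all add: quad_numeric power3_eq_cube)
  show "S4_S4_left_E (- (98 / 5)) < S4_S4_left_E (108 / 5)"
    unfolding S4_S4_left_E_eq by (rule quotient_less_neg[of "(- (19999 / 50000))" _ "(8451 / 3125)" _ _ "(137537 / 100000)"]) (simp_all add: quad_numeric power3_eq_cube)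
  show "S4_S4_right_E (108 / 5) < S4_S4_right_E (- (98 / 5))"
    unfolding S4_S4_right_E_eq by (rule quotient_less_neg[of "(- (377 / 125))" _ "(567 / 500)" _ _ "1"]) (simp_all add: quad_numeric power3_eq_cube)
  show "S4_S4_right_E (- (101 / 5)) < S4_S4_right_E (113 / 5)"
    unfolding S4_S4_right_E_eq by (rule quotient_less_neg[of "(- (1491 / 500))" _ "(10001 / 10000)" _ _ "(2851 / 2500)"]) (simp_all add: quad_numeric power3_eq_cube)
  fix y :: real assume "y \<in> {(- (101 / 5))..(- (98 / 5))} \<union> {(108 / 5)..(113 / 5)}"
  then show "S4_S4_left_E' y < (59 / 100) * S4_S4_right_E' y"
  proof
    assume y: "y \<in> {(- (101 / 5))..(- (98 / 5))}"
    show ?thesis unfolding S4_S4_left_deriv S4_S4_right_deriv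
      by (rule quad_deriv_less_left[OF y, where ?A0.0 = "(857 / 10000)" and ?D0.0 = "2" and ?D1.0 = "(139 / 50)" and ?B1.0 = "(123 / 50000)" and ?G0.0 = "(999 / 1000)"])
        (simp_all add: quad_numeric power_divide)
  next
    assume y: "y \<in> {(108 / 5)..(113 / 5)}"
    show ?thesis unfolding S4_S4_left_deriv S4_S4_right_deriv
      by (rule quad_deriv_less_right[OF y, where ?A1.0 = "(87 / 25000)" and ?D0.0 = "(137 / 100)" and ?B0.0 = "(37 / 12500)" and ?G0.0 = "1" and ?G1.0 = "(23 / 20)"])
        (simp_all add: quad_numeric power_divide)
  qed
qed

lemma S4_S4_box3: "crossing_box S4_S4_right_E S4_S4_right_E' S4_S4_left_E S4_S4_left_E' (- (176 / 5)) (- (347 / 10)) (213 / 5) (433 / 10)"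
  unfolding crossing_box_def
proof (intro conjI exI[of _ "7"] ballI)
  show "(- (176 / 5)) < ((- (347 / 10)) :: real)" "(213 / 5) < ((433 / 10) :: real)" by simp_all
  show "S4_S4_right_E (433 / 10) < S4_S4_right_E (- (176 / 5))"
    unfolding S4_S4_right_E_eq by (rule quotient_less_neg[of "(- (1029 / 500))" _ "(1313 / 1000)" _ _ "(5099 / 5000)"]) (simp_all add: quad_numeric power3_eq_cube)
  show "S4_S4_right_E (- (347 / 10)) < S4_S4_right_E (213 / 5)"
    unfolding S4_S4_right_E_eq by (rule quotient_less_neg[of "(- (523 / 250))" _ "(5093 / 5000)" _ _ "(653 / 500)"]) (simp_all add: quad_numeric power3_eq_cube)
  show "S4_S4_left_E (213 / 5) < S4_S4_left_E (- (347 / 10))"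
    unfolding S4_S4_left_E_eq by (rule quotient_less_neg[of "(- (61 / 500))" _ "(353 / 100)" _ _ "(2517 / 500)"]) (simp_all add: quad_numeric power3_eq_cube)
  show "S4_S4_left_E (- (176 / 5)) < S4_S4_left_E (433 / 10)"
    unfolding S4_S4_left_E_eq by (rule quotient_less_neg[of "(- (293 / 2500))" _ "(5129 / 1000)" _ _ "(1817 / 500)"]) (simp_all add: quad_numeric power3_eq_cube)
  fix y :: real assume "y \<in> {(- (176 / 5))..(- (347 / 10))} \<union> {(213 / 5)..(433 / 10)}"
  then show "S4_S4_right_E' y < 7 * S4_S4_left_E' y"
  proof
    assume y: "y \<in> {(- (176 / 5))..(- (347 / 10))}"
    show ?thesis unfolding S4_S4_right_deriv S4_S4_left_deriv
      by (rule quad_deriv_less_left[OF y, where ?A0.0 = "(27 / 12500)" and ?D0.0 = "1" and ?D1.0 = "(51 / 50)" and ?B1.0 = "(41 / 250)" and ?G0.0 = "(503 / 100)"])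
        (simp_all add: quad_numeric power_divide)
  next
    assume y: "y \<in> {(213 / 5)..(433 / 10)}"
    show ?thesis unfolding S4_S4_right_deriv S4_S4_left_deriv
      by (rule quad_deriv_less_right[OF y, where ?A1.0 = "(309 / 100000)" and ?D0.0 = "(13 / 10)" and ?B0.0 = "(291 / 10000)" and ?G0.0 = "3" and ?G1.0 = "(91 / 25)"])
        (simp_all add: quad_numeric power_divide)
  qed
qed

lemma S4_S4_three_limit_cycles: "\<exists>Fp Fm. in_class S4 Fp \<and> in_class S4 Fm \<and> has_three_crossing_limit_cycles Fp Fm"
proof -
  interpret two_lines S4 "W34 (- 1)" "E34 (- 1)" "\<mu>34 (- 1)" "(103 / 20000)" "(93 / 20000)" "(1 / 10)" "(- (1 / 10))" 0 S4_S4_right_Q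
    S4 "W34 (- 1)" "E34 (- 1)" "\<mu>34 (- 1)" "(- (84 / 3125))" "(27 / 6250)" "(709 / 3125)" "(924 / 3125)" 1 S4_S4_left_Q
    by (intro two_lines.intro S4_S4_right_line S4_S4_left_line)
  show ?thesis
  proof (rule three_limit_cycles_on_lines)
    show "line_box (- (1049 / 100)) (- (999 / 100)) (211 / 20) (1103 / 100)"
      unfolding line_box_def using S4_S4_box1 by simp
    show "line_box (- (101 / 5)) (- (98 / 5)) (108 / 5) (113 / 5)"
      unfolding line_box_def using S4_S4_box2 by simp
    show "line_box (- (176 / 5)) (- (347 / 10)) (213 / 5) (433 / 10)"
      unfolding line_box_def using S4_S4_box3 by simp
  qed (simp_all add: W34_def power_divide)
qed

theorem theorem2:
  shows "(\<exists>Fp Fm. ((in_class S1 Fp \<and> in_class S2 Fm) \<or> (in_class S2 Fp \<and> in_class S1 Fm)) \<and>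
                 has_three_crossing_limit_cycles Fp Fm)
       \<and> (\<exists>Fp Fm. in_class S3 Fp \<and> in_class S3 Fm \<and> has_three_crossing_limit_cycles Fp Fm)
       \<and> (\<exists>Fp Fm. ((in_class S3 Fp \<and> in_class S4 Fm) \<or> (in_class S4 Fp \<and> in_class S3 Fm)) \<and>
                 has_three_crossing_limit_cycles Fp Fm)
       \<and> (\<exists>Fp Fm. in_class S4 Fp \<and> in_class S4 Fm \<and> has_three_crossing_limit_cycles Fp Fm)"
  using S1_S2_three_limit_cycles S3_S3_three_limit_cycles S3_S4_three_limit_cycles S4_S4_three_limit_cycles
  by blast

end
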